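(* Let $\mathcal{D} \subset \mathbb{R}^2$ be a regular (balanced) quadriculated disk containing a $2 \times 3$ rectangle, and let $\mathcal{R}_N=\mathcal{D}\times[0,N]$. Let $M$ be a nonnegative even integer such that for all $N\in\mathbb{N}$ and all $\mathbf{t}_0,\mathbf{t}_1\in\mathcal{T}(\mathcal{R}_N)$, $\operatorname{Tw}(\mathbf{t}_0)=\operatorname{Tw}(\mathbf{t}_1)$ implies $\mathbf{t}_0\ast\mathbf{t}_{\mathrm{vert},M}\approx\mathbf{t}_1\ast\mathbf{t}_{\mathrm{vert},M}$; call a connected component under flips of $\mathcal{T}(\mathcal{R}_N)$ fat if it includes at least one tiling with at least $M$ vertical floors. Let $c \in \mathbb{Q}$, $b \in \mathbb{R}$ be constants such that for all $N\in\mathbb{N}$: (i) every tiling $\mathbf{t}$ of $\mathcal{R}_N$ satisfies $|\operatorname{Tw}(\mathbf{t})|\le cN$; (ii) for every $t\in\mathbb{Z}\cap[-cN+b,cN-b]$ there is exactly one fat component $\mathcal{F}_{N,t}\subseteq\mathcal{T}(\mathcal{R}_N)$ with $\operatorname{Tw}(\mathcal{F}_{N,t})=t$; (iii) for every $t\in\mathbb{Z}$ there is at most one fat component of $\mathcal{T}(\mathcal{R}_N)$ with twist $t$. Then: (a) There exists $\tilde b \in \mathbb{R}$, $\tilde b \ge b$, such that for all $N$, if $t_0 \in \mathbb{Z} \cap [-cN+\tilde b,\, cN-\tilde b-1]$ then there exist tilings $\mathbf{t}_0 \in \mathcal{F}_{N,t_0}$ and $\mathbf{t}_1 \in \mathcal{F}_{N,t_0+1}$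 such that $\mathbf{t}_0$ and $\mathbf{t}_1$ are joined by a trit. (b) The set $\mathcal{T}(\mathcal{R}_N)$ has a giant component under flips and trits $\mathcal{G}=\mathcal{G}_N \subseteq \mathcal{T}(\mathcal{R}_N)$. More precisely, there exists $\tilde c \in (0,1)$ such that, as $N\to\infty$, $|\mathcal{T}(\mathcal{R}_N) \smallsetminus \mathcal{G}_N| = |\mathcal{T}(\mathcal{R}_N)|\,o(\tilde c^N)$.
   Context: Quadriculated disk: a set $\mathcal{D}\subset\mathbb{R}^2$ which is the union of finitely many closed unit squares with vertices in $\mathbb{Z}^2$ and is homeomorphic to the closed unit disk. Unit squares carry a checkerboard coloring and $\mathcal{D}$ is always assumed balanced (equal numbers of white and black squares). Tilings: $\mathcal{R}_N=\mathcal{D}\times[0,N]\subset\mathbb{R}^3$ is a union of closed unit cubes with vertices in $\mathbb{Z}^3$. A domino is the union of two unit cubes sharing a face; a tiling is a set of dominoes with disjoint interiors whose union is $\mathcal{R}_N$. $\mathcal{T}(\mathcal{R}_N)$ is the set of tilings. A domino is vertical if it is in the direction of the third axis. The $k$-th floor is $\mathcal{D}\times[k-1,k]$; a floor of a tiling is vertical if all dominoes of the tiling intersecting its interior are vertical. For $N$ even, $\mathbf{t}_{\mathrm{vert},N}\in\mathcal{T}(\mathcal{R}_N)$ is the tiling with all dominoes vertical. Concatenation (stacking) of $\mathbf{t}_0\in\mathcal{T}(\mathcal{R}_{N_0})$ and $\mathbf{t}_1\in\mathcal{T}(\mathcal{R}_{N_1})$ is $\mathbf{t}_0\ast\mathbf{t}_1\in\mathcal{T}(\mathcal{R}_{N_0+N_1})$.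 Flips: a flip removes two adjacent parallel dominoes (whose union is a $2\times2\times1$ block) and places them back in the other position. $\mathbf{t}_0\approx\mathbf{t}_1$ means that the two tilings of $\mathcal{R}_N$ are joined by a finite sequence of flips; the $\approx$-classes are the connected components under flips. For $\mathbf{t}_i\in\mathcal{T}(\mathcal{R}_{N_i})$ with $N_0\equiv N_1\pmod 2$, write $\mathbf{t}_0\sim\mathbf{t}_1$ if there exists $N\equiv N_0\pmod 2$, $N\ge\max\{N_0,N_1\}$, with $\mathbf{t}_0\ast\mathbf{t}_{\mathrm{vert},N-N_0}\approx\mathbf{t}_1\ast\mathbf{t}_{\mathrm{vert},N-N_1}$. Trits: consider three dominoes of a tiling, in three different directions, whose union is a $2\times2\times2$ cube minus two unit cubes in opposite corners; a trit removes these three dominoes and places them back in the only other possible way. A component under flips and trits is an equivalence class of tilings of $\mathcal{R}_N$ under being joined by a finite sequence of flips and trits. Twist: color unit cubes black and white in a checkerboard pattern. For a domino $d$, let $v(d)\in\{\pm e_1,\pm e_2,\pm e_3\}$ be the center of its black cube minus the center of its white cube. Fix $u\in\{\pm e_1,\pm e_2\}$. The (open) $u$-shade of $d$ is $S^u(d)=\operatorname{int}\big((\bigcup_{s\ge 0}(d+su))\smallsetminus d\big)$. Set $\tau^u(d_0,d_1)=\frac14\det(v(d_1),v(d_0),u)$ if $d_1\cap S^u(d_0)\neq\emptyset$ and $0$ otherwise. Then $\operatorname{Tw}(\mathbf{t})=\sum_{d_0,d_1\in\mathbf{t}}\tau^u(d_0,d_1)$; this is an integer, independent of $u$, invariant under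 flips and additive under concatenation. For a component under flips $\mathcal{C}$ with $\mathbf{t}\in\mathcal{C}$, $\operatorname{Tw}(\mathcal{C})=\operatorname{Tw}(\mathbf{t})$. Regular: $\mathcal{D}$ is regular if for every $N$ and any tilings $\mathbf{t}_0,\mathbf{t}_1$ of $\mathcal{R}_N$, $\operatorname{Tw}(\mathbf{t}_0)=\operatorname{Tw}(\mathbf{t}_1)$ implies $\mathbf{t}_0\sim\mathbf{t}_1$. For regular $\mathcal{D}$ containing a $2\times3$ rectangle, an integer $M$ and constants $c,b$ as in the claim are known to exist. *)

theory Defs
  imports "HOL-Analysis.Analysis" "HOL-Library.Disjoint_Sets" "HOL-Library.Landau_Symbols"
begin

text \<open>
  Regions of the plane and of space that are unions of unit squares or cubes with integer vertices
  are represented by the set of their squares or cubes.  A square or cube is named by its vertex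
  with the least coordinates; \<open>square_region\<close> and \<open>body\<close> return the actual subsets of the
  plane and of space.
\<close>

type_synonym square = "int \<times> int"
type_synonym cube = "int \<times> int \<times> int"
type_synonym domino = "cube set"
type_synonym tiling = "domino set"


subsection \<open>Quadriculated disks\<close>

definition unit_square :: "square \<Rightarrow> (real^2) set" where
  "unit_square = (\<lambda>(i, j). cbox (vector [of_int i, of_int j])
                                (vector [of_int i + 1, of_int j + 1]))"

definition square_region :: "square set \<Rightarrow> (real^2) set" where
  "square_region D = (\<Union>p\<in>D. unit_square p)"

definition quadriculated_disk :: "square set \<Rightarrow> bool" where
  "quadriculated_disk D \<longleftrightarrow>
     finite D \<and> square_region D homeomorphic cball (0 :: real^2) 1"

definition balanced :: "square set \<Rightarrow> bool" where
  "balanced D \<longleftrightarrow> card {(i, j) \<in> D. even (i + j)} = card {(i, j) \<in> D. odd (i + j)}"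

definition contains_2x3_rectangle :: "square set \<Rightarrow> bool" where
  "contains_2x3_rectangle D \<longleftrightarrow>
     (\<exists>i j. {i..i + 1} \<times> {j..j + 2} \<subseteq> D \<or> {i..i + 2} \<times> {j..j + 1} \<subseteq> D)"


subsection \<open>Domino tilings\<close>

definition corner :: "cube \<Rightarrow> real^3" where
  "corner = (\<lambda>(i, j, k). vector [of_int i, of_int j, of_int k])"

definition unit_cube :: "cube \<Rightarrow> (real^3) set" where
  "unit_cube p = cbox (corner p) (corner p + 1)"

definition center :: "cube \<Rightarrow> real^3" where
  "center p = corner p + (1 / 2) *\<^sub>R 1"

definition body :: "cube set \<Rightarrow> (real^3) set" where
  "body A = (\<Union>p\<in>A. unit_cube p)"

definition axes :: "cube set" where
  "axes = {(1, 0, 0), (0, 1, 0), (0, 0, 1)}"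

definition is_domino :: "domino \<Rightarrow> bool" where
  "is_domino d \<longleftrightarrow> (\<exists>p. \<exists>a\<in>axes. d = {p, p + a})"

definition tilings_of :: "cube set \<Rightarrow> tiling set" where
  "tilings_of R = {t. partition_on R t \<and> (\<forall>d\<in>t. is_domino d)}"

text \<open>
  In terms of subsets of space, \<open>tilings_of R\<close> consists of the sets of dominoes with disjoint
  interiors whose union is \<open>body R\<close>.
\<close>

lemma unit_cube_nth:
  "x \<in> unit_cube p \<longleftrightarrow> (\<forall>i. corner p $ i \<le> x $ i \<and> x $ i \<le> corner p $ i + 1)"
  by (auto simp: unit_cube_def mem_box_cart)

lemma center_in_unit_cube: "center q \<in> unit_cube p \<longleftrightarrow> p = q"
proof -
  obtain i j k where p: "p = (i, j, k)" by (cases p) auto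
  obtain i' j' k' where q: "q = (i', j', k')" by (cases q) auto
  have *: "of_int a \<le> (of_int b :: real) + 1 / 2 \<and> of_int b + 1 / 2 \<le> (of_int a :: real) + 1
             \<longleftrightarrow> a = b" for a b :: int
    by linarith
  show ?thesis
    unfolding unit_cube_nth forall_3 p q
    using *[of i i'] *[of j j'] *[of k k'] by (auto simp: center_def corner_def)
qed

lemma center_in_body: "center p \<in> body A \<longleftrightarrow> p \<in> A"
  by (auto simp: body_def center_in_unit_cube)

lemma body_eq_iff: "body A = body B \<longleftrightarrow> A = B"
  by (metis center_in_body subsetI subset_antisym)

lemma center_in_interior: "p \<in> A \<Longrightarrow> center p \<in> interior (body A)"
proof -
  assume "p \<in> A"
  have "center p \<in> box (corner p) (corner p + 1)"
    by (auto simp: mem_box_cart center_def)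
  moreover have "box (corner p) (corner p + 1) \<subseteq> body A"
    using \<open>p \<in> A\<close> box_subset_cbox unfolding body_def unit_cube_def by fastforce
  ultimately show ?thesis
    using open_box by (meson interiorI)
qed

lemma interior_unit_cube_Int: "p \<noteq> q \<Longrightarrow> interior (unit_cube p \<inter> unit_cube q) = {}"
proof (rule ccontr)
  assume "p \<noteq> q" and "interior (unit_cube p \<inter> unit_cube q) \<noteq> {}"
  then obtain x where "x \<in> box (corner p) (corner p + 1)" "x \<in> box (corner q) (corner q + 1)"
    by (auto simp: interior_Int unit_cube_def interior_cbox)
  then have x: "corner p $ i < x $ i" "x $ i < corner p $ i + 1"
               "corner q $ i < x $ i" "x $ i < corner q $ i + 1" for i
    by (auto simp: mem_box_cart)
  obtain i j k where p: "p = (i, j, k)" by (cases p) auto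
  obtain i' j' k' where q: "q = (i', j', k')" by (cases q) auto
  have *: "a = b" if "of_int a < y" "y < of_int a + 1" "of_int b < y" "y < of_int b + 1"
    for a b :: int and y :: real
    using that by linarith
  have "i = i'" "j = j'" "k = k'"
    using x[of 1] x[of 2] x[of 3] by (auto simp: p q corner_def intro: *)
  then show False using \<open>p \<noteq> q\<close> p q by simp
qed

lemma interior_body_disjoint:
  assumes "finite A" "finite B"
  shows "interior (body A) \<inter> interior (body B) = {} \<longleftrightarrow> A \<inter> B = {}"
proof
  assume "interior (body A) \<inter> interior (body B) = {}"
  then show "A \<inter> B = {}" using center_in_interior by blast
next
  assume disj: "A \<inter> B = {}"
  have empty_interior: "interior (\<Union>F) = {}"
    if "finite F" "\<forall>S\<in>F. closed S \<and> interior S = {}" for F :: "(real^3) set set"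
    using that by (induction F) (auto simp: interior_closed_Un_empty_interior)
  let ?F = "(\<lambda>(p, q). unit_cube p \<inter> unit_cube q) ` (A \<times> B)"
  have "body A \<inter> body B = \<Union>?F" by (auto simp: body_def)
  moreover have "\<forall>S\<in>?F. closed S \<and> interior S = {}"
  proof (clarify)
    fix p q assume "p \<in> A" "q \<in> B"
    then have "p \<noteq> q" using disj by blast
    then show "closed (unit_cube p \<inter> unit_cube q) \<and> interior (unit_cube p \<inter> unit_cube q) = {}"
      using interior_unit_cube_Int by (auto simp: unit_cube_def closed_cbox)
  qed
  ultimately have "interior (body A \<inter> body B) = {}"
    using empty_interior[of ?F] assms by auto
  then show "interior (body A) \<inter> interior (body B) = {}" by (simp add: interior_Int)
qed

lemma tilings_of_geometric:
  "t \<in> tilings_of R \<longleftrightarrow>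
     (\<forall>d\<in>t. is_domino d) \<and>
     pairwise (\<lambda>d e. interior (body d) \<inter> interior (body e) = {}) t \<and>
     (\<Union>d\<in>t. body d) = body R"
proof (cases "\<forall>d\<in>t. is_domino d")
  case True
  then have fin: "finite d" and ne: "d \<noteq> {}" if "d \<in> t" for d
    using that by (auto simp: is_domino_def)
  have "(\<Union>d\<in>t. body d) = body (\<Union>t)" by (auto simp: body_def)
  moreover have "pairwise (\<lambda>d e. interior (body d) \<inter> interior (body e) = {}) t \<longleftrightarrow> disjoint t"
    unfolding pairwise_def disjnt_def using interior_body_disjoint fin by metis
  ultimately show ?thesis
    using True ne by (auto simp: tilings_of_def partition_on_def body_eq_iff)
qed (auto simp: tilings_of_def)

definition cylinder :: "square set \<Rightarrow> nat \<Rightarrow> cube set" where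
  "cylinder D N = {(i, j, k). (i, j) \<in> D \<and> 0 \<le> k \<and> k < int N}"

definition tilings :: "square set \<Rightarrow> nat \<Rightarrow> tiling set" where
  "tilings D N = tilings_of (cylinder D N)"

definition vertical :: "domino \<Rightarrow> bool" where
  "vertical d \<longleftrightarrow> (\<exists>p. d = {p, p + (0, 0, 1)})"

text \<open>Floors are numbered from 1: floor \<open>k\<close> consists of the cubes at height \<open>k - 1\<close> to \<open>k\<close>.\<close>

definition vertical_floor :: "tiling \<Rightarrow> nat \<Rightarrow> bool" where
  "vertical_floor t k \<longleftrightarrow> (\<forall>d\<in>t. (\<exists>i j. (i, j, int k - 1) \<in> d) \<longrightarrow> vertical d)"

definition num_vertical_floors :: "nat \<Rightarrow> tiling \<Rightarrow> nat" where
  "num_vertical_floors N t = card {k \<in> {1..N}. vertical_floor t k}"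

text \<open>Only meaningful for even \<open>N\<close>.\<close>

definition t_vert :: "square set \<Rightarrow> nat \<Rightarrow> tiling" where
  "t_vert D N = {{(i, j, 2 * int m), (i, j, 2 * int m + 1)} | i j m. (i, j) \<in> D \<and> m < N div 2}"

text \<open>\<open>stack N0 t0 t1\<close> is the concatenation of a tiling \<open>t0\<close> of height \<open>N0\<close> with \<open>t1\<close>.\<close>

definition stack :: "nat \<Rightarrow> tiling \<Rightarrow> tiling \<Rightarrow> tiling" where
  "stack N0 t0 t1 = t0 \<union> (\<lambda>d. (\<lambda>p. p + (0, 0, int N0)) ` d) ` t1"


subsection \<open>Flips and trits\<close>

text \<open>Remove the dominoes of \<open>t\<close> that tile \<open>R\<close> and tile \<open>R\<close> in a different way.\<close>

definition retile :: "cube set \<Rightarrow> tiling \<Rightarrow> tiling \<Rightarrow> bool" where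
  "retile R t t' \<longleftrightarrow>
     (\<exists>T\<in>tilings_of R. \<exists>T'\<in>tilings_of R. T \<subseteq> t \<and> T' \<noteq> T \<and> t' = (t - T) \<union> T')"

text \<open>A $2 \times 2 \times 1$ block has exactly two tilings, both by two parallel dominoes.\<close>

definition flip_regions :: "cube set set" where
  "flip_regions = {{p, p + a, p + b, p + a + b} | p a b. a \<in> axes \<and> b \<in> axes \<and> a \<noteq> b}"

definition flip :: "tiling \<Rightarrow> tiling \<Rightarrow> bool" where
  "flip t t' \<longleftrightarrow> (\<exists>R\<in>flip_regions. retile R t t')"

text \<open>
  The six cubes that remain in a $2 \times 2 \times 2$ cube after removing two opposite ones form a
  cycle in which neighbours share a face.  Hence there are exactly two tilings, and each of them has
  one domino in each of the three directions.
\<close>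

definition trit_regions :: "cube set set" where
  "trit_regions =
     {(\<lambda>v. p + v) ` ({0, 1} \<times> {0, 1} \<times> {0, 1} - {w, (1, 1, 1) - w}) | p w.
        w \<in> {0, 1} \<times> {0, 1} \<times> {0, 1}}"

definition trit :: "tiling \<Rightarrow> tiling \<Rightarrow> bool" where
  "trit t t' \<longleftrightarrow> (\<exists>R\<in>trit_regions. retile R t t')"

abbreviation flip_connected :: "tiling \<Rightarrow> tiling \<Rightarrow> bool" where
  "flip_connected \<equiv> flip\<^sup>*\<^sup>*"

abbreviation flip_trit_connected :: "tiling \<Rightarrow> tiling \<Rightarrow> bool" where
  "flip_trit_connected \<equiv> (\<lambda>t t'. flip t t' \<or> trit t t')\<^sup>*\<^sup>*"

definition flip_components :: "square set \<Rightarrow> nat \<Rightarrow> tiling set set" where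
  "flip_components D N =
     tilings D N // {(t, t'). t \<in> tilings D N \<and> t' \<in> tilings D N \<and> flip_connected t t'}"

definition flip_trit_components :: "square set \<Rightarrow> nat \<Rightarrow> tiling set set" where
  "flip_trit_components D N =
     tilings D N // {(t, t'). t \<in> tilings D N \<and> t' \<in> tilings D N \<and> flip_trit_connected t t'}"

text \<open>The relation written $t_0 \sim t_1$, for tilings of heights \<open>N0\<close> and \<open>N1\<close>.\<close>

definition stably_connected :: "square set \<Rightarrow> nat \<Rightarrow> tiling \<Rightarrow> nat \<Rightarrow> tiling \<Rightarrow> bool" where
  "stably_connected D N0 t0 N1 t1 \<longleftrightarrow>
     even N0 = even N1 \<and>
     (\<exists>N. even N = even N0 \<and> N \<ge> max N0 N1 \<and>
          flip_connected (stack N0 t0 (t_vert D (N - N0))) (stack N1 t1 (t_vert D (N - N1))))"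


subsection \<open>Twist\<close>

text \<open>The twist does not change if the two colours are exchanged.\<close>

definition black :: "cube \<Rightarrow> bool" where
  "black = (\<lambda>(i, j, k). even (i + j + k))"

definition domino_vector :: "domino \<Rightarrow> real^3" where
  "domino_vector d = center (THE p. p \<in> d \<and> black p) - center (THE p. p \<in> d \<and> \<not> black p)"

definition shade :: "real^3 \<Rightarrow> domino \<Rightarrow> (real^3) set" where
  "shade u d = interior ((\<Union>s\<in>{0..}. (\<lambda>x. x + s *\<^sub>R u) ` body d) - body d)"

definition tau :: "real^3 \<Rightarrow> domino \<Rightarrow> domino \<Rightarrow> real" where
  "tau u d0 d1 =
     (if body d1 \<inter> shade u d0 \<noteq> {}
      then 1 / 4 * det (vector [domino_vector d1, domino_vector d0, u] :: real^3^3)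
      else 0)"

definition twist :: "real^3 \<Rightarrow> tiling \<Rightarrow> real" where
  "twist u t = (\<Sum>d0\<in>t. \<Sum>d1\<in>t. tau u d0 d1)"

text \<open>The directions \<open>u\<close> with respect to which the twist is defined; its value is the same for all.\<close>

definition horizontal_directions :: "(real^3) set" where
  "horizontal_directions = {axis 1 1, - axis 1 1, axis 2 1, - axis 2 1}"

text \<open>The twist is invariant under flips, so the choice of a tiling in the component is immaterial.\<close>

definition component_twist :: "real^3 \<Rightarrow> tiling set \<Rightarrow> real" where
  "component_twist u C = twist u (SOME t. t \<in> C)"

definition regular :: "real^3 \<Rightarrow> square set \<Rightarrow> bool" where
  "regular u D \<longleftrightarrow>
     (\<forall>N. \<forall>t0\<in>tilings D N. \<forall>t1\<in>tilings D N.
        twist u t0 = twist u t1 \<longrightarrow> stably_connected D N t0 N t1)"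


subsection \<open>Fat components\<close>

definition fat_components :: "square set \<Rightarrow> nat \<Rightarrow> nat \<Rightarrow> tiling set set" where
  "fat_components D M N =
     {C \<in> flip_components D N. \<exists>t\<in>C. num_vertical_floors N t \<ge> M}"

text \<open>The component written $\mathcal{F}_{N,t}$; used only where it exists and is unique.\<close>

definition fat_component :: "real^3 \<Rightarrow> square set \<Rightarrow> nat \<Rightarrow> nat \<Rightarrow> int \<Rightarrow> tiling set" where
  "fat_component u D M N t =
     (THE C. C \<in> fat_components D M N \<and> component_twist u C = of_int t)"

end

theory Submission
  imports Defs
begin

text \<open>
  A tiling is the same thing as a direction field, which sends every cube to the step that leads to
  the other cube of its domino.  Multiplying that step by the colour of the cube gives the domino
  vector, so the twist becomes a bilinear sum over the pairs of cubes that lie on a common line in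
  the direction \<open>u\<close> (\<open>twist_eq\<close>).  Such lines are horizontal.  Hence the twist is a sum
  of contributions of the floors (\<open>twist_floors\<close>) and is additive under stacking
  (\<open>twist_stack\<close>).  A conservation law for the domino vectors in four neighbouring rows shows
  that flips preserve it (\<open>twist_flip\<close>).  Evaluating the sum modulo 4 row by row shows that it
  is an integer if the number of squares is even (\<open>twist_Ints\<close>).

  For (a), a box of height 4 over the \<open>2 \<times> 3\<close> rectangle, completed by vertical dominoes,
  has two tilings that differ by one trit and whose twists differ by 1
  (\<open>trit_changing_twist\<close>).  Stack on both of them the same tiling of the right twist, which
  exists because the fat components of a lower cylinder take all twists in a long interval, and then
  \<open>M\<close> vertical floors.  The two results are joined by a trit, and they lie in the prescribed
  components because they are fat and their twists are known.

  For (b), call the set of squares where vertical dominoes cross from one floor to the next a plug.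
  Tilings correspond to closed walks from the empty plug to itself in a finite graph whose vertices
  are the plugs and whose edges are the floors.  Cut the walks into blocks of a large fixed length.
  A block revisits some plug after a long even time, and the part in between can be exchanged for a
  way to the empty plug, an arbitrary tiling of height 4, and the way back
  (\<open>block_insertion\<close>).  So between any two plugs that a block can join there is a block with a
  vertical floor, and there are two blocks of different twist.  Given the plugs at the ends of the
  blocks, the blocks can be chosen independently.  Hence the proportion of tilings with a bounded
  number of blocks of some unavoidable kind decays geometrically (\<open>few_good_blocks\<close>).  This
  applies to the blocks with a vertical floor, and also to the blocks whose twist can be increased: a
  tiling with twist at least \<open>c * N - b\<close> has a bounded number of them, because increasing all
  of them cannot bring the twist above \<open>c * N\<close>.  So all but a geometrically small proportion of
  the tilings are fat and have a twist in the interval of (a) (\<open>rare_tilings\<close>), and the trits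
  of (a) join the components of those tilings.
\<close>

section \<open>Tilings as direction fields\<close>

definition steps :: "cube set" where
  "steps = axes \<union> uminus ` axes"

definition field_on :: "cube set \<Rightarrow> (cube \<Rightarrow> cube) \<Rightarrow> bool" where
  "field_on R f \<longleftrightarrow>
     (\<forall>p\<in>R. f p \<in> steps \<and> p + f p \<in> R \<and> f (p + f p) = - f p) \<and> (\<forall>p. p \<notin> R \<longrightarrow> f p = 0)"

text \<open>
  The value 0 outside the tiled region makes \<open>dir\<close> injective on tilings; see
  \<open>bij_betw_dir\<close>.
\<close>

definition dir :: "tiling \<Rightarrow> cube \<Rightarrow> cube" where
  "dir t p = (if p \<in> \<Union>t then (THE q. q \<noteq> p \<and> {p, q} \<in> t) - p else 0)"

definition dominoes :: "cube set \<Rightarrow> (cube \<Rightarrow> cube) \<Rightarrow> tiling" where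
  "dominoes R f = (\<lambda>p. {p, p + f p}) ` R"

lemma field_onD:
  assumes "field_on R f"
  shows "p \<in> R \<Longrightarrow> f p \<in> steps" "p \<in> R \<Longrightarrow> p + f p \<in> R"
    "p \<in> R \<Longrightarrow> f (p + f p) = - f p" "p \<notin> R \<Longrightarrow> f p = 0"
  using assms unfolding field_on_def by blast+

lemma axes_cases: "a \<in> axes \<Longrightarrow> a = (1,0,0) \<or> a = (0,1,0) \<or> a = (0,0,1)"
  by (auto simp: axes_def)

lemma steps_eq: "steps = {(1,0,0), (0,1,0), (0,0,1), (-1,0,0), (0,-1,0), (0,0,-1)}"
  by (auto simp: steps_def axes_def)

lemma zero_notin_steps [simp]: "0 \<notin> steps" "(0,0,0) \<notin> steps"
  by (auto simp: steps_eq zero_prod_def)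

lemma uminus_steps [simp]: "- a \<in> steps \<longleftrightarrow> a \<in> steps"
  by (cases a) (auto simp: steps_eq)

lemma is_domino_step: "is_domino d \<Longrightarrow> p \<in> d \<Longrightarrow> \<exists>a\<in>steps. d = {p, p + a}"
proof -
  assume d: "is_domino d" and p: "p \<in> d"
  then obtain q a where a: "a \<in> axes" "d = {q, q + a}" by (auto simp: is_domino_def)
  show ?thesis
  proof (cases "p = q")
    case True
    with a show ?thesis by (auto simp: steps_def)
  next
    case False
    with a p have "d = {p, p + - a}" by (auto simp: insert_commute)
    moreover have "- a \<in> steps" using a by (auto simp: steps_def)
    ultimately show ?thesis by blast
  qed
qed

lemma is_domino_pair: "a \<in> steps \<Longrightarrow> is_domino {p, p + a}"
proof -
  assume "a \<in> steps"
  then consider "a \<in> axes" | "- a \<in> axes" by (auto simp: steps_def)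
  then show ?thesis
  proof cases
    case 2
    have "{p, p + a} = {p + a, (p + a) + - a}" by (simp add: insert_commute)
    with 2 show ?thesis unfolding is_domino_def by blast
  next
    case 1
    then show ?thesis unfolding is_domino_def by blast
  qed
qed

lemma tiling_block:
  assumes "t \<in> tilings_of R" "d \<in> t" "e \<in> t" "p \<in> d" "p \<in> e"
  shows "d = e"
  using assms by (auto simp: tilings_of_def partition_on_def disjoint_def)

lemma tiling_block_nonempty: "t \<in> tilings_of R \<Longrightarrow> d \<in> t \<Longrightarrow> d \<noteq> {}"
  unfolding tilings_of_def partition_on_def by blast

lemma dir_eqI:
  assumes t: "t \<in> tilings_of R" and d: "{p, p + a} \<in> t" and a: "a \<noteq> 0"
  shows "dir t p = a"
proof -
  have "(THE q. q \<noteq> p \<and> {p, q} \<in> t) = p + a"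
  proof (rule the_equality)
    show "p + a \<noteq> p \<and> {p, p + a} \<in> t" using d a by simp
  next
    fix q assume q: "q \<noteq> p \<and> {p, q} \<in> t"
    then have "{p, q} = {p, p + a}"
      using tiling_block[OF t _ d] by blast
    with q show "q = p + a" by (auto simp: doubleton_eq_iff)
  qed
  with d show ?thesis by (auto simp: dir_def)
qed

lemma dir_domino:
  assumes t: "t \<in> tilings_of R" and p: "p \<in> R"
  shows "dir t p \<in> steps" "{p, p + dir t p} \<in> t"
proof -
  obtain d where d: "d \<in> t" "p \<in> d"
    using t p by (auto simp: tilings_of_def partition_on_def)
  then have "is_domino d" using t unfolding tilings_of_def by blast
  from is_domino_step[OF this d(2)] obtain a where a: "a \<in> steps" "d = {p, p + a}" by blast
  then have "a \<noteq> 0" using zero_notin_steps(1) by blast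
  then have "dir t p = a"
    using dir_eqI[OF t] d a by blast
  with a d show "dir t p \<in> steps" "{p, p + dir t p} \<in> t" by auto
qed

lemma Union_tiling: "t \<in> tilings_of R \<Longrightarrow> \<Union>t = R"
  by (auto simp: tilings_of_def partition_on_def)

lemma dir_in_block:
  assumes t: "t \<in> tilings_of R" and d: "d \<in> t" and p: "p \<in> d"
  shows "d = {p, p + dir t p}"
proof -
  have "p \<in> R" unfolding Union_tiling[OF t, symmetric] using d p by (rule UnionI)
  from dir_domino(2)[OF t this] show ?thesis
    by (rule tiling_block[OF t d _ p]) (rule insertI1)
qed

lemma field_dir: 
  assumes t: "t \<in> tilings_of R"
  shows "field_on R (dir t)"
  unfolding field_on_def
proof (intro conjI ballI allI impI)
  fix p assume p: "p \<in> R"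
  note D = dir_domino[OF t p]
  show "dir t p \<in> steps" by (rule D)
  show "p + dir t p \<in> R" using D(2) Union_tiling[OF t] by auto
  have "{p + dir t p, (p + dir t p) + - dir t p} \<in> t" using D(2) by (simp add: insert_commute)
  moreover have "- dir t p \<noteq> 0" using D(1) by (metis uminus_steps zero_notin_steps(1))
  ultimately show "dir t (p + dir t p) = - dir t p" using dir_eqI[OF t] by blast
next
  fix p assume "p \<notin> R"
  with t show "dir t p = 0" by (simp add: dir_def Union_tiling)
qed

lemma dominoes_dir:
  assumes t: "t \<in> tilings_of R"
  shows "dominoes R (dir t) = t"
proof
  show "dominoes R (dir t) \<subseteq> t" using dir_domino[OF t] by (auto simp: dominoes_def)
  show "t \<subseteq> dominoes R (dir t)"
  proof
    fix d assume d: "d \<in> t"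
    then have "is_domino d" using t unfolding tilings_of_def by simp
    then obtain p where p: "p \<in> d" unfolding is_domino_def by blast
    with d have "p \<in> R" using Union_tiling[OF t] by auto
    with dir_in_block[OF t d p] show "d \<in> dominoes R (dir t)" by (auto simp: dominoes_def)
  qed
qed

lemma dominoes_tiling:
  assumes f: "field_on R f"
  shows "dominoes R f \<in> tilings_of R"
proof -
  have F: "f p \<in> steps" "p + f p \<in> R" "f (p + f p) = - f p" if "p \<in> R" for p
    using f that by (auto simp: field_on_def)
  have eq: "{p, p + f p} = {q, q + f q}" if pq: "p \<in> R" "q \<in> R" and ne: "{p, p + f p} \<inter> {q, q + f q} \<noteq> {}" for p q
  proof -
    have swap: "{p + f p, p + f p + f (p + f p)} = {p, p + f p}" if "p \<in> R" for p
      using F(3)[OF that] by (simp add: insert_commute)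
    consider "p = q" | "p = q + f q" | "p + f p = q" | "p + f p = q + f q" using ne by blast
    then show ?thesis
    proof cases
      case 2 then show ?thesis using swap[OF pq(2)] by simp
    next
      case 3 then show ?thesis using swap[OF pq(1)] by simp
    next
      case 4 then show ?thesis using swap[OF pq(1)] swap[OF pq(2)] by simp
    qed simp
  qed
  have "\<forall>d\<in>dominoes R f. is_domino d"
    using F(1) is_domino_pair by (auto simp: dominoes_def)
  moreover have "\<Union>(dominoes R f) = R" using F(2) by (auto simp: dominoes_def)
  moreover have "disjoint (dominoes R f)"
    unfolding disjoint_def dominoes_def using eq by blast
  moreover have "{} \<notin> dominoes R f" by (auto simp: dominoes_def)
  ultimately show ?thesis by (simp add: tilings_of_def partition_on_def)
qed

lemma dir_dominoes:
  assumes f: "field_on R f"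
  shows "dir (dominoes R f) = f"
proof
  fix p
  show "dir (dominoes R f) p = f p"
  proof (cases "p \<in> R")
    case True
    then have "{p, p + f p} \<in> dominoes R f" "f p \<noteq> 0"
      using f by (auto simp: dominoes_def field_on_def)
    then show ?thesis using dir_eqI[OF dominoes_tiling[OF f]] by blast
  next
    case False
    then show ?thesis
      using field_onD(4)[OF f False] Union_tiling[OF dominoes_tiling[OF f]] by (simp add: dir_def)
  qed
qed

lemma bij_betw_dir: "bij_betw dir (tilings_of R) (Collect (field_on R))"
  by (rule bij_betw_byWitness[where f' = "dominoes R"])
     (auto simp: dominoes_dir dir_dominoes field_dir dominoes_tiling)

lemma dir_subset:
  assumes "T \<in> tilings_of R" "t \<in> tilings_of R'" "T \<subseteq> t" "p \<in> R"
  shows "dir t p = dir T p"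
  using dir_eqI[OF assms(2)] dir_domino[OF assms(1,4)] assms(3)
  by (metis subsetD zero_notin_steps(1))

lemma retile_tiling:
  assumes t: "t \<in> tilings_of R" and T: "T \<in> tilings_of A" "T' \<in> tilings_of A" "T \<subseteq> t"
  shows "(t - T) \<union> T' \<in> tilings_of R"
proof -
  note U = Union_tiling[OF t] Union_tiling[OF T(1)] Union_tiling[OF T(2)]
  have dj: "d \<inter> e = {}" if "d \<in> t - T" "e \<in> T'" for d e
  proof -
    have "d \<inter> \<Union>T = {}" using that(1) t T(3) by (fastforce simp: tilings_of_def partition_on_def disjoint_def)
    with that(2) U show ?thesis by auto
  qed
  have "A \<subseteq> R" using U T(3) by auto
  moreover have "\<Union>(t - T) = R - A"
  proof
    show "\<Union>(t - T) \<subseteq> R - A"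
    proof
      fix x assume "x \<in> \<Union>(t - T)"
      then obtain d where d: "d \<in> t - T" "x \<in> d" by auto
      have "x \<notin> A"
      proof
        assume "x \<in> A"
        then obtain e where "e \<in> T" "x \<in> e" using U by auto
        with d T(3) tiling_block[OF t, of d e x] show False by auto
      qed
      with d U show "x \<in> R - A" by auto
    qed
    show "R - A \<subseteq> \<Union>(t - T)" using U by auto
  qed
  ultimately have "\<Union>((t - T) \<union> T') = R" using U by auto
  moreover have "disjoint ((t - T) \<union> T')"
  proof (rule disjointI)
    fix d e assume de: "d \<in> (t - T) \<union> T'" "e \<in> (t - T) \<union> T'" "d \<noteq> e"
    show "d \<inter> e = {}"
    proof (rule ccontr)
      assume "d \<inter> e \<noteq> {}"
      then obtain x where x: "x \<in> d" "x \<in> e" by blast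
      then show False
        using de tiling_block[OF t, of d e x] tiling_block[OF T(2), of d e x] dj[of d e] dj[of e d]
        by blast
    qed
  qed
  ultimately show ?thesis using t T(2) by (auto simp: tilings_of_def partition_on_def)
qed

lemma retile_closed: "t \<in> tilings_of R \<Longrightarrow> retile A t t' \<Longrightarrow> t' \<in> tilings_of R"
  unfolding retile_def using retile_tiling by blast

text \<open>
  This makes retiling reversible: removing \<open>T'\<close> again does not remove any domino that was kept.
\<close>

lemma retile_disjoint:
  assumes t: "t \<in> tilings_of R" and T: "T \<in> tilings_of A" "T' \<in> tilings_of A" "T \<subseteq> t"
  shows "(t - T) \<inter> T' = {}"
proof (rule ccontr)
  assume "(t - T) \<inter> T' \<noteq> {}"
  then obtain d where d: "d \<in> t" "d \<notin> T" "d \<in> T'" by auto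
  then have "is_domino d" using T(2) unfolding tilings_of_def by simp
  then obtain p where p: "p \<in> d" unfolding is_domino_def by blast
  then have "p \<in> A" using d Union_tiling[OF T(2)] by auto
  then obtain e where "e \<in> T" "p \<in> e" using Union_tiling[OF T(1)] by auto
  then show False using tiling_block[OF t, of d e p] d p T(3) by auto
qed

lemma retile_sym:
  assumes t: "t \<in> tilings_of R" and r: "retile A t t'"
  shows "retile A t' t"
proof -
  obtain T T' where T: "T \<in> tilings_of A" "T' \<in> tilings_of A" "T \<subseteq> t" "T' \<noteq> T" "t' = (t - T) \<union> T'"
    using r by (auto simp: retile_def)
  have "(t - T) \<inter> T' = {}" using retile_disjoint[OF t T(1-3)] .
  then have "t = (t' - T') \<union> T" using T by auto
  with T show ?thesis unfolding retile_def by (metis Un_upper2)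
qed

lemma flip_closed: "t \<in> tilings_of R \<Longrightarrow> flip t t' \<Longrightarrow> t' \<in> tilings_of R"
  by (auto simp: flip_def intro: retile_closed)
lemma trit_closed: "t \<in> tilings_of R \<Longrightarrow> trit t t' \<Longrightarrow> t' \<in> tilings_of R"
  by (auto simp: trit_def intro: retile_closed)
lemma flip_sym: "t \<in> tilings_of R \<Longrightarrow> flip t t' \<Longrightarrow> flip t' t"
  by (auto simp: flip_def intro: retile_sym)
lemma trit_sym: "t \<in> tilings_of R \<Longrightarrow> trit t t' \<Longrightarrow> trit t' t"
  by (auto simp: trit_def intro: retile_sym)

lemma dir_retile_outside:
  assumes t: "t \<in> tilings_of R" and r: "t' = (t - T) \<union> T'" and T: "T \<in> tilings_of A" "T' \<in> tilings_of A" "T \<subseteq> t"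
    and p: "p \<notin> A"
  shows "dir t' p = dir t p"
proof -
  have t': "t' \<in> tilings_of R" using retile_tiling[OF t T] r by simp
  show ?thesis
  proof (cases "p \<in> R")
    case True
    note D = dir_domino[OF t True]
    have "{p, p + dir t p} \<notin> T" using p Union_tiling[OF T(1)] by auto
    then have "{p, p + dir t p} \<in> t'" using D r by auto
    then show ?thesis using dir_eqI[OF t'] D by (metis zero_notin_steps(1))
  next
    case False
    then show ?thesis
      using field_onD(4)[OF field_dir[OF t] False] field_onD(4)[OF field_dir[OF t'] False] by simp
  qed
qed

section \<open>The twist as a sum over pairs of cubes\<close>

text \<open>
  The sign for which \<open>eps p\<close> times the step from \<open>p\<close> to its partner is the vector of
  the domino, black minus white, for both cubes \<open>p\<close> of the domino.
\<close>

definition eps :: "cube \<Rightarrow> int" where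
  "eps p = (if black p then - 1 else 1)"

definition scale :: "int \<Rightarrow> cube \<Rightarrow> cube" where
  "scale n = (\<lambda>(i, j, k). (n * i, n * j, n * k))"

text \<open>
  The discrete form of the shade: for a domino across the direction \<open>U\<close>, its shade consists of
  the cubes ahead of its cubes (\<open>shade_iff\<close>).
\<close>

definition ahead :: "cube \<Rightarrow> cube \<Rightarrow> cube \<Rightarrow> bool" where
  "ahead U p q \<longleftrightarrow> (\<exists>n>0. q = p + scale n U)"

definition horizontals :: "cube set" where
  "horizontals = {(1,0,0), (-1,0,0), (0,1,0), (0,-1,0)}"

fun det3 :: "cube \<Rightarrow> cube \<Rightarrow> cube \<Rightarrow> int" where
  "det3 (a1, a2, a3) (b1, b2, b3) (c1, c2, c3) =
     a1 * (b2 * c3 - b3 * c2) - a2 * (b1 * c3 - b3 * c1) + a3 * (b1 * c2 - b2 * c1)"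

lemma eps_add_step: "a \<in> steps \<Longrightarrow> eps (p + a) = - eps p"
  by (cases p) (auto simp: steps_eq eps_def black_def)

lemma eps_square [simp]: "eps p * eps p = 1"
  by (simp add: eps_def)

lemma ahead_horizontals:
  "ahead (1,0,0) (i,j,k) (i',j',k') \<longleftrightarrow> i < i' \<and> j' = j \<and> k' = k"
  "ahead (-1,0,0) (i,j,k) (i',j',k') \<longleftrightarrow> i' < i \<and> j' = j \<and> k' = k"
  "ahead (0,1,0) (i,j,k) (i',j',k') \<longleftrightarrow> i' = i \<and> j < j' \<and> k' = k"
  "ahead (0,-1,0) (i,j,k) (i',j',k') \<longleftrightarrow> i' = i \<and> j' < j \<and> k' = k"
  unfolding ahead_def scale_def
  by (auto intro: exI[of _ "i' - i"] exI[of _ "i - i'"] exI[of _ "j' - j"] exI[of _ "j - j'"])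

lemma corner_nth [simp]:
  "corner (i,j,k) $ 1 = of_int i" "corner (i,j,k) $ 2 = of_int j" "corner (i,j,k) $ 3 = of_int k"
  by (simp_all add: corner_def)

lemma corner_diff: "corner p - corner q = corner (p - q)"
  by (cases p, cases q) (simp add: vec_eq_iff forall_3)

lemma corner_det:
  "det (vector [corner a, corner b, corner c] :: real^3^3) = of_int (det3 a b c)"
  by (cases a, cases b, cases c) (simp add: det_3 algebra_simps)

lemma domino_vector_eq:
  assumes a: "a \<in> steps"
  shows "domino_vector {p, p + a} = corner (scale (eps p) a)"
proof -
  have b: "black (p + a) \<longleftrightarrow> \<not> black p"
    using a by (cases p) (auto simp: steps_eq black_def)
  have T: "(THE q. q \<in> {p, p + a} \<and> black q) = (if black p then p else p + a)"
     "(THE q. q \<in> {p, p + a} \<and> \<not> black q) = (if black p then p + a else p)"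
    using b by (auto intro!: the_equality)
  show ?thesis
    unfolding domino_vector_def T center_def
    by (cases p, cases a) (auto simp: eps_def corner_diff scale_def)
qed

lemma horizontal_directions_eq: "horizontal_directions = corner ` horizontals"
proof -
  have "corner (1,0,0) = axis 1 1" "corner (-1,0,0) = - axis 1 1"
       "corner (0,1,0) = axis 2 1" "corner (0,-1,0) = - axis 2 1"
    by (auto simp: vec_eq_iff forall_3 axis_def)
  then show ?thesis by (simp add: horizontal_directions_def horizontals_def)
qed

lemma open_cube_unique:
  assumes "x \<in> box (corner q) (corner q + 1)" "x \<in> unit_cube p"
  shows "p = q"
proof -
  obtain i j k i' j' k' where pq: "p = (i,j,k)" "q = (i',j',k')" by (cases p, cases q) auto
  show ?thesis
    using assms unfolding pq by (simp add: mem_box_cart unit_cube_nth forall_3)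
qed

lemma ex_3: "(\<exists>n::3. P n) \<longleftrightarrow> P 1 \<or> P 2 \<or> P 3"
  using forall_3[of "\<lambda>n. \<not> P n"] by blast

text \<open>
  These three lemmas compare the coordinates of a cube \<open>i\<close> and a cube \<open>j\<close>, given a point
  of the open cube \<open>j\<close>: in a coordinate across the direction of projection, and in the
  coordinate along it, where the cube \<open>i\<close> has been moved by \<open>s\<close> upwards or downwards.
\<close>

lemma equal_coordinate:
  fixes i j :: int and z :: real
  assumes "of_int i \<le> z" "z \<le> of_int i + 1" "of_int j < z" "z < of_int j + 1"
  shows "j = i"
  using assms by linarith

lemma smaller_coordinate:
  fixes i j :: int and z s :: real
  assumes "0 \<le> s" "of_int i \<le> z - s" "of_int j < z" "z < of_int j + 1"
    "of_int i \<le> z \<longrightarrow> \<not> z \<le> of_int i + 1"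
  shows "i < j"
  using assms by linarith

lemma larger_coordinate:
  fixes i j :: int and z s :: real
  assumes "0 \<le> s" "z + s \<le> of_int i + 1" "of_int j < z" "z < of_int j + 1"
    "of_int i \<le> z \<longrightarrow> \<not> z \<le> of_int i + 1"
  shows "j < i"
  using assms by linarith

text \<open>
  The shade is open, so if it meets a closed cube then it meets the open cube, and there the integer
  coordinates can be compared.  Conversely, the whole open cube \<open>q\<close> lies in the swept region.
  The second assumption keeps it from meeting \<open>d\<close>; it fails only for dominoes parallel to the
  direction of projection.
\<close>

lemma shade_iff:
  assumes U: "U \<in> horizontals"
    and no: "\<And>p p'. p \<in> d \<Longrightarrow> p' \<in> d \<Longrightarrow> \<not> ahead U p p'"
  shows "body e \<inter> shade (corner U) d \<noteq> {} \<longleftrightarrow> (\<exists>p\<in>d. \<exists>q\<in>e. ahead U p q)"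
proof
  define S where "S = (\<Union>s\<in>{0..}. (\<lambda>x. x + s *\<^sub>R corner U) ` body d) - body d"
  assume "body e \<inter> shade (corner U) d \<noteq> {}"
  then obtain y where y: "y \<in> body e" "y \<in> interior S" unfolding shade_def S_def by blast
  then obtain q where q: "q \<in> e" "y \<in> unit_cube q" unfolding body_def by blast
  define B where "B = box (corner q) (corner q + 1)"
  have "corner q + (1/2) *\<^sub>R 1 \<in> B" by (simp add: mem_box_cart B_def)
  then have "B \<noteq> {}" by blast
  then have "closure B = unit_cube q"
    unfolding unit_cube_def B_def by (rule closure_box)
  then have "interior S \<inter> closure B \<noteq> {}" using y(2) q(2) by blast
  then have "interior S \<inter> B \<noteq> {}"
    by (simp add: open_Int_closure_eq_empty)
  then obtain z where z: "z \<in> box (corner q) (corner q + 1)" "z \<in> S"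
    using interior_subset B_def by blast
  obtain s w where s: "s \<ge> 0" "w \<in> body d" "z = w + s *\<^sub>R corner U" "z \<notin> body d"
    using z(2) unfolding S_def by blast
  obtain p where p: "p \<in> d" "w \<in> unit_cube p" "z \<notin> unit_cube p"
    using s(2,4) unfolding body_def by blast
  have w: "w = z - s *\<^sub>R corner U" using s(3) by simp
  obtain i j k i' j' k' where pq: "p = (i,j,k)" "q = (i',j',k')" by (cases p, cases q) auto
  have "ahead U p q"
  proof -
    have I: "of_int a \<le> z $ n" "z $ n \<le> of_int a + 1" "of_int b < z $ n" "z $ n < of_int b + 1"
      if "corner p $ n = of_int a" "corner q $ n = of_int b" "corner U $ n = 0" for a b n
      using that s(1) p(2) z(1) unfolding w mem_box_cart unit_cube_nth
      by (auto dest!: spec[of _ n])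
    have J: "of_int b < z $ n" "z $ n < of_int b + 1" "of_int a \<le> z $ n - s * corner U $ n"
        "z $ n - s * corner U $ n \<le> of_int a + 1"
      if "corner p $ n = of_int a" "corner q $ n = of_int b" for a b n
      using that s(1) p(2) z(1) unfolding w mem_box_cart unit_cube_nth
      by (auto dest!: spec[of _ n])
    have K: "\<exists>n. \<not> (corner p $ n \<le> z $ n \<and> z $ n \<le> corner p $ n + 1)"
      using p(3) by (simp add: unit_cube_nth)
    show ?thesis
      using U unfolding horizontals_def
    proof (elim insertE emptyE)
      assume u: "U = (1,0,0)"
      have "j' = j" "k' = k" using equal_coordinate[OF I[of 2 j j']] equal_coordinate[OF I[of 3 k k']] by (simp_all add: u pq)
      moreover have "i < i'" 
        using smaller_coordinate[OF s(1), of i "z $ 1" i'] J[of 1 i i'] K I[of 2 j j'] I[of 3 k k'] by (auto simp: u pq ex_3)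
      ultimately show ?thesis by (simp add: u pq ahead_horizontals)
    next
      assume u: "U = (-1,0,0)"
      have "j' = j" "k' = k" using equal_coordinate[OF I[of 2 j j']] equal_coordinate[OF I[of 3 k k']] by (simp_all add: u pq)
      moreover have "i' < i"
        using larger_coordinate[OF s(1), of "z $ 1" i i'] J[of 1 i i'] K I[of 2 j j'] I[of 3 k k'] by (auto simp: u pq ex_3)
      ultimately show ?thesis by (simp add: u pq ahead_horizontals)
    next
      assume u: "U = (0,1,0)"
      have "i' = i" "k' = k" using equal_coordinate[OF I[of 1 i i']] equal_coordinate[OF I[of 3 k k']] by (simp_all add: u pq)
      moreover have "j < j'" 
        using smaller_coordinate[OF s(1), of j "z $ 2" j'] J[of 2 j j'] K I[of 1 i i'] I[of 3 k k'] by (auto simp: u pq ex_3)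
      ultimately show ?thesis by (simp add: u pq ahead_horizontals)
    next
      assume u: "U = (0,-1,0)"
      have "i' = i" "k' = k" using equal_coordinate[OF I[of 1 i i']] equal_coordinate[OF I[of 3 k k']] by (simp_all add: u pq)
      moreover have "j' < j"
        using larger_coordinate[OF s(1), of "z $ 2" j j'] J[of 2 j j'] K I[of 1 i i'] I[of 3 k k'] by (auto simp: u pq ex_3)
      ultimately show ?thesis by (simp add: u pq ahead_horizontals)
    qed
  qed
  with p q show "\<exists>p\<in>d. \<exists>q\<in>e. ahead U p q" by blast
next
  define S where "S = (\<Union>s\<in>{0..}. (\<lambda>x. x + s *\<^sub>R corner U) ` body d) - body d"
  assume "\<exists>p\<in>d. \<exists>q\<in>e. ahead U p q"
  then obtain p q where pq: "p \<in> d" "q \<in> e" "ahead U p q" by blast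
  obtain n where n: "n > 0" "q = p + scale n U" using pq(3) unfolding ahead_def by blast
  let ?B = "box (corner q) (corner q + 1)"
  have cq: "corner q = corner p + of_int n *\<^sub>R corner U"
    unfolding n(2) by (cases p, cases U) (simp add: scale_def vec_eq_iff forall_3)
  have "?B \<subseteq> S"
  proof
    fix x assume x: "x \<in> ?B"
    have "x - of_int n *\<^sub>R corner U \<in> unit_cube p"
      using x unfolding cq by (simp add: mem_box_cart unit_cube_nth) (smt (verit))
    then have "x - of_int n *\<^sub>R corner U \<in> body d" using pq(1) by (auto simp: body_def)
    moreover have "x = (x - of_int n *\<^sub>R corner U) + of_int n *\<^sub>R corner U" by simp
    moreover have "(of_int n :: real) \<in> {0..}" using n(1) by simp
    ultimately have "x \<in> (\<Union>s\<in>{0..}. (\<lambda>x. x + s *\<^sub>R corner U) ` body d)" by blast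
    moreover have "x \<notin> body d"
      using open_cube_unique[OF x] no[OF pq(1)] pq(3) unfolding body_def by blast
    ultimately show "x \<in> S" unfolding S_def by blast
  qed
  then have "?B \<subseteq> interior S" by (intro interior_maximal) auto
  moreover have "center q \<in> ?B" by (simp add: mem_box_cart center_def)
  moreover have "center q \<in> body e" using pq(2) by (auto simp: center_in_body)
  ultimately show "body e \<inter> shade (corner U) d \<noteq> {}" unfolding shade_def S_def[symmetric] by blast
qed

text \<open>
  The contribution to four times the twist of a cube \<open>p\<close> of the domino that casts the shade and
  a cube \<open>q\<close> of the domino that meets it, in terms of the direction field \<open>f\<close>.
\<close>

definition pair_term :: "cube \<Rightarrow> (cube \<Rightarrow> cube) \<Rightarrow> cube \<Rightarrow> cube \<Rightarrow> int" where
  "pair_term U f p q = (if ahead U p q then eps p * eps q * det3 (f q) (f p) U else 0)"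

lemma det3_scale: "det3 (scale m a) (scale n b) c = m * n * det3 a b c"
  by (cases a, cases b, cases c) (simp add: scale_def algebra_simps)

lemma det3_uminus: "det3 (- a) b c = - det3 a b c" "det3 a (- b) c = - det3 a b c"
  by (cases a, cases b, cases c, simp add: algebra_simps)+

lemma det3_nonzero:
  assumes "det3 b a U \<noteq> 0" "U \<in> horizontals" "a \<in> steps" "b \<in> steps" 
  shows "(U \<in> {(1,0,0),(-1,0,0)} \<and> a \<in> {(0,1,0),(0,-1,0)} \<and> b \<in> {(0,0,1),(0,0,-1)})
    \<or> (U \<in> {(1,0,0),(-1,0,0)} \<and> b \<in> {(0,1,0),(0,-1,0)} \<and> a \<in> {(0,0,1),(0,0,-1)})
    \<or> (U \<in> {(0,1,0),(0,-1,0)} \<and> a \<in> {(1,0,0),(-1,0,0)} \<and> b \<in> {(0,0,1),(0,0,-1)})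
    \<or> (U \<in> {(0,1,0),(0,-1,0)} \<and> b \<in> {(1,0,0),(-1,0,0)} \<and> a \<in> {(0,0,1),(0,0,-1)})"
  using assms(2-4,1) unfolding steps_eq horizontals_def
  by (elim insertE emptyE; hypsubst; simp)

text \<open>
  If the two dominoes and \<open>U\<close> point in three different directions, then the projections of the
  dominoes along \<open>U\<close> are perpendicular rectangles, which have at most one square in common.
\<close>

lemma ahead_count:
  assumes U: "U \<in> horizontals" and a: "a \<in> steps" and b: "b \<in> steps" and d: "det3 b a U \<noteq> 0"
  shows "\<not> ahead U p (p + a)" "\<not> ahead U (p + a) p" "\<not> ahead U p p"
    "of_bool (ahead U p q) + of_bool (ahead U (p + a) q) + of_bool (ahead U p (q + b))
     + of_bool (ahead U (p + a) (q + b))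
     = (of_bool (\<exists>p'\<in>{p, p + a}. \<exists>q'\<in>{q, q + b}. ahead U p' q') :: int)"
proof -
  obtain i j k i' j' k' where pq: "p = (i,j,k)" "q = (i',j',k')" by (cases p, cases q) auto
  show "\<not> ahead U p (p + a)" "\<not> ahead U (p + a) p" "\<not> ahead U p p"
    using det3_nonzero[OF d U a b] unfolding pq
    by (elim disjE conjE insertE emptyE; hypsubst; simp add: ahead_horizontals)+
  show "of_bool (ahead U p q) + of_bool (ahead U (p + a) q) + of_bool (ahead U p (q + b))
     + of_bool (ahead U (p + a) (q + b))
     = (of_bool (\<exists>p'\<in>{p, p + a}. \<exists>q'\<in>{q, q + b}. ahead U p' q') :: int)"
  proof -
    have "\<not> (ahead U p q \<and> ahead U (p + a) q)" "\<not> (ahead U p q \<and> ahead U p (q + b))"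
      "\<not> (ahead U p q \<and> ahead U (p + a) (q + b))" "\<not> (ahead U (p + a) q \<and> ahead U p (q + b))"
      "\<not> (ahead U (p + a) q \<and> ahead U (p + a) (q + b))"
      "\<not> (ahead U p (q + b) \<and> ahead U (p + a) (q + b))"
      using det3_nonzero[OF d U a b] unfolding pq
      by (elim disjE conjE insertE emptyE; hypsubst; simp add: ahead_horizontals)+
    then show ?thesis by auto
  qed
qed

text \<open>
  The determinant vanishes unless the two dominoes and \<open>U\<close> have three different directions.  In
  that case at most one of the four pairs of cubes contributes, by \<open>ahead_count\<close>.
\<close>

lemma tau_eq:
  assumes U: "U \<in> horizontals" and t: "t \<in> tilings_of R" and d: "d \<in> t" and e: "e \<in> t"
  shows "4 * tau (corner U) d e = of_int (\<Sum>p\<in>d. \<Sum>q\<in>e. pair_term U (dir t) p q)"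
proof -
  obtain p where p: "p \<in> d" using tiling_block_nonempty[OF t d] by blast
  obtain q where q: "q \<in> e" using tiling_block_nonempty[OF t e] by blast
  have pR: "p \<in> R" "q \<in> R" unfolding Union_tiling[OF t, symmetric] using p q d e by blast+
  define a where "a = dir t p"
  define b where "b = dir t q"
  have ab: "a \<in> steps" "b \<in> steps" using dir_domino[OF t] pR by (auto simp: a_def b_def)
  then have nz: "a \<noteq> 0" "b \<noteq> 0" using zero_notin_steps by blast+
  have d': "d = {p, p + a}" and e': "e = {q, q + b}"
    using dir_in_block[OF t d p] dir_in_block[OF t e q] unfolding a_def b_def by blast+
  have dirs: "dir t p = a" "dir t q = b" "dir t (p + a) = - a" "dir t (q + b) = - b"
    using field_onD[OF field_dir[OF t]] pR by (simp_all add: a_def b_def)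
  let ?D = "eps p * eps q * det3 b a U"
  let ?n = "of_bool (ahead U p q) + of_bool (ahead U (p + a) q) + of_bool (ahead U p (q + b))
     + of_bool (ahead U (p + a) (q + b)) :: int"
  have sum: "(\<Sum>p\<in>d. \<Sum>q\<in>e. pair_term U (dir t) p q) = ?D * ?n"
    unfolding d' e' using nz ab
    by (simp add: pair_term_def dirs eps_add_step det3_uminus)
  have det: "det (vector [domino_vector e, domino_vector d, corner U] :: real^3^3) = of_int ?D"
    unfolding d' e' domino_vector_eq[OF ab(1)] domino_vector_eq[OF ab(2)] corner_det det3_scale
    by (simp add: mult.commute)
  show ?thesis
  proof (cases "det3 b a U = 0")
    case True
    then show ?thesis unfolding sum tau_def det by simp
  next
    case False
    note ac = ahead_count[OF U ab False]
    have no: "\<not> ahead U p1 p2" if "p1 \<in> d" "p2 \<in> d" for p1 p2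
      using that ac(1-2)[of p] ac(3)[of p] ac(3)[of "p + a"] unfolding d' by blast
    have "body e \<inter> shade (corner U) d \<noteq> {} \<longleftrightarrow> (\<exists>p'\<in>{p, p + a}. \<exists>q'\<in>{q, q + b}. ahead U p' q')"
      using shade_iff[OF U, of d e] no unfolding d' e' by blast
    then show ?thesis
      unfolding sum ac(4) tau_def det by simp
  qed
qed

theorem twist_eq:
  assumes U: "U \<in> horizontals" and t: "t \<in> tilings_of R" and R: "finite R"
  shows "4 * twist (corner U) t = of_int (\<Sum>p\<in>R. \<Sum>q\<in>R. pair_term U (dir t) p q)"
proof -
  have fin: "\<forall>d\<in>t. finite d" 
  proof
    fix d assume "d \<in> t"
    then have "d \<subseteq> R" unfolding Union_tiling[OF t, symmetric] by (rule Union_upper)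
    then show "finite d" using R by (rule finite_subset)
  qed
  have dj: "\<forall>d\<in>t. \<forall>e\<in>t. d \<noteq> e \<longrightarrow> d \<inter> e = {}"
    using tiling_block[OF t] by blast
  have SU: "(\<Sum>p\<in>R. g p) = (\<Sum>d\<in>t. \<Sum>p\<in>d. g p)" for g :: "cube \<Rightarrow> int"
    using sum.Union_disjoint[OF fin dj, of g] Union_tiling[OF t] by simp
  have "4 * twist (corner U) t = (\<Sum>d\<in>t. \<Sum>e\<in>t. 4 * tau (corner U) d e)"
    by (simp add: twist_def sum_distrib_left)
  also have "\<dots> = of_int (\<Sum>d\<in>t. \<Sum>e\<in>t. \<Sum>p\<in>d. \<Sum>q\<in>e. pair_term U (dir t) p q)"
    by (simp add: tau_eq[OF U t])
  also have "(\<Sum>d\<in>t. \<Sum>e\<in>t. \<Sum>p\<in>d. \<Sum>q\<in>e. pair_term U (dir t) p q)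
     = (\<Sum>d\<in>t. \<Sum>p\<in>d. \<Sum>e\<in>t. \<Sum>q\<in>e. pair_term U (dir t) p q)"
    by (intro sum.cong sum.swap refl)
  also have "\<dots> = (\<Sum>p\<in>R. \<Sum>q\<in>R. pair_term U (dir t) p q)"
    by (simp only: SU)
  finally show ?thesis .
qed

section \<open>Flips preserve the twist\<close>

text \<open>
  The components of the domino vector at \<open>p\<close> across the first axis.  The twist in the direction of
  the first axis depends only on them.
\<close>

definition w2 :: "(cube \<Rightarrow> cube) \<Rightarrow> cube \<Rightarrow> int" where
  "w2 f p = eps p * fst (snd (f p))"

definition w3 :: "(cube \<Rightarrow> cube) \<Rightarrow> cube \<Rightarrow> int" where
  "w3 f p = eps p * snd (snd (f p))"

text \<open>
  Antisymmetry of the determinant allows each pair of cubes in a row to be counted with the sign of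
  their order, with the second component taken from one cube and the third from the other.
\<close>

definition row_sign :: "cube \<Rightarrow> cube \<Rightarrow> int" where
  "row_sign p q = (if snd p = snd q then sgn (fst q - fst p) else 0)"

definition twist_form :: "cube set \<Rightarrow> (cube \<Rightarrow> cube) \<Rightarrow> int" where
  "twist_form R f = (\<Sum>p\<in>R. \<Sum>q\<in>R. row_sign p q * w2 f q * w3 f p)"

lemma pair_term_e1:
  "pair_term (1,0,0) f p q =
     of_bool (ahead (1,0,0) p q) * w2 f q * w3 f p - of_bool (ahead (1,0,0) p q) * w2 f p * w3 f q"
  by (cases "f p", cases "f q") (simp add: pair_term_def w2_def w3_def algebra_simps)

lemma row_sign_ahead:
  "row_sign p q = of_bool (ahead (1,0,0) p q) - of_bool (ahead (1,0,0) q p)"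
  by (cases p, cases q) (auto simp: row_sign_def ahead_horizontals sgn_if)

lemma sum_pair_term_e1: "(\<Sum>p\<in>R. \<Sum>q\<in>R. pair_term (1,0,0) f p q) = twist_form R f"
proof -
  have "(\<Sum>p\<in>R. \<Sum>q\<in>R. of_bool (ahead (1,0,0) p q) * w2 f p * w3 f q)
      = (\<Sum>p\<in>R. \<Sum>q\<in>R. of_bool (ahead (1,0,0) q p) * w2 f q * w3 f p)"
    by (rule sum.swap)
  then show ?thesis
    by (simp add: twist_form_def pair_term_e1 row_sign_ahead sum_subtractf left_diff_distrib)
qed

lemma twist_e1:
  "t \<in> tilings_of R \<Longrightarrow> finite R \<Longrightarrow> 4 * twist (corner (1,0,0)) t = of_int (twist_form R (dir t))"
  by (simp add: twist_eq horizontals_def sum_pair_term_e1)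

lemma pair_term_uminus: "pair_term (- U) f p q = pair_term U f q p"
proof -
  have "ahead (- U) p q \<longleftrightarrow> ahead U q p"
    by (cases p, cases q, cases U) (auto simp: ahead_def scale_def)
  moreover have "det3 (f q) (f p) (- U) = det3 (f p) (f q) U"
    by (cases "f p", cases "f q", cases U) (simp add: algebra_simps)
  ultimately show ?thesis by (simp add: pair_term_def mult.commute)
qed

text \<open>
  Reversing the direction of projection exchanges the two dominoes of a pair, and the determinant
  changes its sign twice.
\<close>

lemma twist_uminus:
  assumes U: "U \<in> horizontals" and t: "t \<in> tilings_of R" and R: "finite R"
  shows "twist (corner (- U)) t = twist (corner U) t"
proof -
  have U': "- U \<in> horizontals" using U by (auto simp: horizontals_def)
  have "(\<Sum>p\<in>R. \<Sum>q\<in>R. pair_term (- U) (dir t) p q) = (\<Sum>p\<in>R. \<Sum>q\<in>R. pair_term U (dir t) p q)"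
    unfolding pair_term_uminus by (rule sum.swap)
  with twist_eq[OF U t R] twist_eq[OF U' t R] show ?thesis by simp
qed

text \<open>
  The reflection that exchanges the two horizontal axes.  It reverses orientation, hence the sign of
  the twist, and it turns the direction of the second axis into that of the first.
\<close>

definition swap_xy :: "cube \<Rightarrow> cube" where
  "swap_xy = (\<lambda>(i, j, k). (j, i, k))"

definition transpose_tiling :: "tiling \<Rightarrow> tiling" where
  "transpose_tiling t = (\<lambda>d. swap_xy ` d) ` t"

lemma swap_xy_swap_xy [simp]: "swap_xy (swap_xy p) = p" by (cases p) (simp add: swap_xy_def)
lemma swap_xy_add [simp]: "swap_xy (p + q) = swap_xy p + swap_xy q" by (cases p, cases q) (simp add: swap_xy_def)
lemma swap_xy_diff [simp]: "swap_xy (p - q) = swap_xy p - swap_xy q" by (cases p, cases q) (simp add: swap_xy_def)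
lemma swap_xy_simp [simp]: "swap_xy (i,j,k) = (j,i,k)" by (simp add: swap_xy_def)
lemma inj_swap_xy: "inj swap_xy" by (metis injI swap_xy_swap_xy)
lemma transpose_transpose_tiling [simp]: "transpose_tiling (transpose_tiling t) = t"
  by (simp add: transpose_tiling_def image_image)
lemma swap_xy_image_image [simp]: "swap_xy ` swap_xy ` A = A" by (simp add: image_image)

lemma swap_xy_axes: "swap_xy a \<in> axes \<longleftrightarrow> a \<in> axes"
  by (cases a) (auto simp: axes_def)

lemma is_domino_swap_xy: "is_domino d \<Longrightarrow> is_domino (swap_xy ` d)"
  unfolding is_domino_def using swap_xy_axes by (metis image_empty image_insert swap_xy_add)

lemma transpose_tilings:
  assumes t: "t \<in> tilings_of R"
  shows "transpose_tiling t \<in> tilings_of (swap_xy ` R)"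
proof -
  have "\<Union>(transpose_tiling t) = swap_xy ` R" using Union_tiling[OF t] by (auto simp: transpose_tiling_def)
  moreover have "disjoint (transpose_tiling t)"
    unfolding transpose_tiling_def
  proof (rule disjoint_image)
    show "inj_on swap_xy (\<Union>t)" using inj_swap_xy by (rule inj_on_subset) simp
    show "disjoint t" using t by (simp add: tilings_of_def partition_on_def)
  qed
  moreover have "{} \<notin> transpose_tiling t" using tiling_block_nonempty[OF t] by (auto simp: transpose_tiling_def)
  moreover have "\<forall>d\<in>transpose_tiling t. is_domino d"
    using t is_domino_swap_xy unfolding tilings_of_def transpose_tiling_def by blast
  ultimately show ?thesis by (simp add: tilings_of_def partition_on_def)
qed

lemma dir_transpose:
  assumes t: "t \<in> tilings_of R" and p: "p \<in> R"
  shows "dir (transpose_tiling t) (swap_xy p) = swap_xy (dir t p)"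
proof (rule dir_eqI[OF transpose_tilings[OF t]])
  note D = dir_domino[OF t p]
  have "swap_xy ` {p, p + dir t p} \<in> transpose_tiling t" using D(2) unfolding transpose_tiling_def by (rule imageI)
  then show "{swap_xy p, swap_xy p + swap_xy (dir t p)} \<in> transpose_tiling t" by simp
  show "swap_xy (dir t p) \<noteq> 0"
    using D(1) zero_notin_steps by (cases "dir t p") (auto simp: zero_prod_def)
qed

lemma twist_transpose:
  assumes t: "t \<in> tilings_of R" and R: "finite R"
  shows "twist (corner (0,1,0)) t = - twist (corner (1,0,0)) (transpose_tiling t)"
proof -
  have E: "eps (swap_xy p) = eps p" for p by (cases p) (auto simp: eps_def black_def)
  have A: "ahead (1,0,0) (swap_xy p) (swap_xy q) \<longleftrightarrow> ahead (0,1,0) p q" for p q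
    by (cases p, cases q) (auto simp: ahead_horizontals)
  have D: "det3 (swap_xy a) (swap_xy b) (1,0,0) = - det3 a b (0,1,0)" for a b
    by (cases a, cases b) simp
  have "(\<Sum>p\<in>swap_xy ` R. \<Sum>q\<in>swap_xy ` R. pair_term (1,0,0) (dir (transpose_tiling t)) p q)
      = (\<Sum>p\<in>R. \<Sum>q\<in>R. pair_term (1,0,0) (dir (transpose_tiling t)) (swap_xy p) (swap_xy q))"
    using inj_on_subset[OF inj_swap_xy subset_UNIV, of R] by (simp add: sum.reindex)
  also have "\<dots> = (\<Sum>p\<in>R. \<Sum>q\<in>R. - pair_term (0,1,0) (dir t) p q)"
    by (intro sum.cong refl) (simp add: pair_term_def E A dir_transpose[OF t] D)
  also have "\<dots> = - (\<Sum>p\<in>R. \<Sum>q\<in>R. pair_term (0,1,0) (dir t) p q)"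
    by (simp add: sum_negf)
  finally have "4 * twist (corner (1,0,0)) (transpose_tiling t) = - (4 * twist (corner (0,1,0)) t)"
    using twist_eq[OF _ t R, of "(0,1,0)"] twist_eq[OF _ transpose_tilings[OF t] finite_imageI[OF R], of "(1,0,0)"]
    by (simp add: horizontals_def)
  then show ?thesis by simp
qed

lemma retile_transpose:
  assumes r: "retile A t t'"
  shows "retile (swap_xy ` A) (transpose_tiling t) (transpose_tiling t')"
proof -
  obtain T T' where T: "T \<in> tilings_of A" "T' \<in> tilings_of A" "T \<subseteq> t" "T' \<noteq> T" "t' = (t - T) \<union> T'"
    using r by (auto simp: retile_def)
  have inj: "inj (\<lambda>d. swap_xy ` d)" by (metis injI swap_xy_image_image)
  have "transpose_tiling T' \<noteq> transpose_tiling T" using T(4) by (metis transpose_transpose_tiling)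
  moreover have "transpose_tiling t' = (transpose_tiling t - transpose_tiling T) \<union> transpose_tiling T'"
    unfolding T(5) transpose_tiling_def image_Un image_set_diff[OF inj] ..
  moreover have "transpose_tiling T \<subseteq> transpose_tiling t" using T(3) by (auto simp: transpose_tiling_def)
  ultimately show ?thesis unfolding retile_def using transpose_tilings[OF T(1)] transpose_tilings[OF T(2)] by blast
qed

lemma flip_transpose: "flip t t' \<Longrightarrow> flip (transpose_tiling t) (transpose_tiling t')"
proof -
  assume "flip t t'"
  then obtain p a b where ab: "a \<in> axes" "b \<in> axes" "a \<noteq> b" and r: "retile {p, p + a, p + b, p + a + b} t t'"
    unfolding flip_def flip_regions_def by blast
  have ne: "swap_xy a \<noteq> swap_xy b" using ab(3) by (metis swap_xy_swap_xy)
  have "swap_xy ` {p, p + a, p + b, p + a + b} = {swap_xy p, swap_xy p + swap_xy a, swap_xy p + swap_xy b, swap_xy p + swap_xy a + swap_xy b}"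
    by simp
  then have "swap_xy ` {p, p + a, p + b, p + a + b} \<in> flip_regions"
    using ab(1,2)[folded swap_xy_axes[of a] swap_xy_axes[of b]] ne unfolding flip_regions_def by blast
  then show ?thesis using retile_transpose[OF r] unfolding flip_def by blast
qed

lemma trit_transpose: "trit t t' \<Longrightarrow> trit (transpose_tiling t) (transpose_tiling t')"
proof -
  assume "trit t t'"
  then obtain p w where w: "w \<in> {0, 1} \<times> {0, 1} \<times> {0, 1}"
    and r: "retile ((\<lambda>v. p + v) ` ({0, 1} \<times> {0, 1} \<times> {0, 1} - {w, (1, 1, 1) - w})) t t'"
    unfolding trit_def trit_regions_def by blast
  let ?C = "{0, 1} \<times> {0, 1} \<times> {0, 1} :: cube set"
  have C: "swap_xy ` ?C = ?C" by (simp add: Sigma_def) auto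
  have "swap_xy ` (\<lambda>v. p + v) ` (?C - {w, (1, 1, 1) - w}) = (\<lambda>v. swap_xy p + v) ` swap_xy ` (?C - {w, (1, 1, 1) - w})"
    unfolding image_image swap_xy_add ..
  also have "swap_xy ` (?C - {w, (1, 1, 1) - w}) = ?C - {swap_xy w, (1,1,1) - swap_xy w}"
    unfolding image_set_diff[OF inj_swap_xy] C by simp
  finally have "swap_xy ` (\<lambda>v. p + v) ` (?C - {w, (1, 1, 1) - w}) = (\<lambda>v. swap_xy p + v) ` (?C - {swap_xy w, (1,1,1) - swap_xy w})"
    .
  moreover have "swap_xy w \<in> ?C" using w C by blast
  ultimately have "swap_xy ` (\<lambda>v. p + v) ` (?C - {w, (1, 1, 1) - w}) \<in> trit_regions"
    unfolding trit_regions_def by (intro CollectI exI conjI)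
  then show ?thesis using retile_transpose[OF r] unfolding trit_def by (rule bexI[rotated])
qed

lemma block_neighbour:
  fixes p :: cube
  assumes "p + b + c \<in> {p, p + a, p + b, p + a + b}"
  shows "c = - b \<or> c = a - b \<or> c = 0 \<or> c = a"
  using assms by (cases p, cases a, cases b, cases c) (auto simp: zero_prod_def)

text \<open>
  The partner of \<open>p\<close> determines the partners of the other three cubes.
\<close>

lemma block_tilings:
  assumes T: "T \<in> tilings_of {p, p + a, p + b, p + a + b}" and ab: "a \<in> axes" "b \<in> axes" "a \<noteq> b"
  defines "f \<equiv> dir T"
  shows "(f p = a \<and> f (p + a) = - a \<and> f (p + b) = a \<and> f (p + a + b) = - a)
       \<or> (f p = b \<and> f (p + b) = - b \<and> f (p + a) = b \<and> f (p + a + b) = - b)"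
proof -
  note F = field_onD[OF field_dir[OF T], folded f_def]
  (* The diagonal cube of the block is not a possible partner. *)
  have ns: "a + b \<notin> steps" "a - b \<notin> steps" "b - a \<notin> steps"
    using ab by (auto simp: axes_def steps_eq)
  have "f p \<in> {a, b}"
    using F(1)[of p] F(2)[of p] ns(1) zero_notin_steps(1) by (auto simp: add.assoc)
  then show ?thesis
  proof
    assume p: "f p = a"
    have pa: "f (p + a) = - a" using F(3)[of p] p by simp
    have "f (p + b) \<in> {- b, a}"
    proof -
      have "p + b + f (p + b) \<in> {p, p + a, p + b, p + a + b}" using F(2)[of "p + b"] by simp
      then have "f (p + b) = - b \<or> f (p + b) = a - b \<or> f (p + b) = 0 \<or> f (p + b) = a"
        by (rule block_neighbour)
      then show ?thesis using F(1)[of "p + b"] ns zero_notin_steps(1) by auto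
    qed
    moreover have "f (p + b) \<noteq> - b" using F(3)[of "p + b"] p ab(3) by auto
    ultimately have pb: "f (p + b) = a" by simp
    then have "f (p + a + b) = - a" using F(3)[of "p + b"] by (simp add: algebra_simps)
    with p pa pb show ?thesis by simp
  next
    assume "f p \<in> {b}"
    then have p: "f p = b" by simp
    have pa: "f (p + b) = - b" using F(3)[of p] p by simp
    have "f (p + a) \<in> {- a, b}"
    proof -
      have "p + a + f (p + a) \<in> {p, p + b, p + a, p + b + a}" using F(2)[of "p + a"] by (auto simp: ac_simps)
      then have "f (p + a) = - a \<or> f (p + a) = b - a \<or> f (p + a) = 0 \<or> f (p + a) = b"
        by (rule block_neighbour)
      then show ?thesis using F(1)[of "p + a"] ns zero_notin_steps(1) by auto
    qed
    moreover have "f (p + a) \<noteq> - a" using F(3)[of "p + a"] p ab(3) by auto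
    ultimately have pb: "f (p + a) = b" by simp
    then have "f (p + a + b) = - b" using F(3)[of "p + a"] by (simp add: algebra_simps)
    with p pa pb show ?thesis by simp
  qed
qed

text \<open>
  A flip, seen on direction fields: two dominoes in the direction \<open>a\<close> become two dominoes in the
  direction \<open>b\<close>.
\<close>

definition flip_fields :: "cube \<Rightarrow> cube \<Rightarrow> cube \<Rightarrow> (cube \<Rightarrow> cube) \<Rightarrow> (cube \<Rightarrow> cube) \<Rightarrow> bool" where
  "flip_fields p a b f g \<longleftrightarrow>
     f p = a \<and> f (p + a) = - a \<and> f (p + b) = a \<and> f (p + a + b) = - a \<and>
     g p = b \<and> g (p + b) = - b \<and> g (p + a) = b \<and> g (p + a + b) = - b \<and>
     (\<forall>q. q \<notin> {p, p + a, p + b, p + a + b} \<longrightarrow> g q = f q)"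

lemma flip_dir:
  assumes t: "t \<in> tilings_of R" and fl: "flip t t'"
  shows "\<exists>p a b. a \<in> axes \<and> b \<in> axes \<and> a \<noteq> b \<and> {p, p + a, p + b, p + a + b} \<subseteq> R \<and>
           flip_fields p a b (dir t) (dir t')"
proof -
  obtain p a b where ab: "a \<in> axes" "b \<in> axes" "a \<noteq> b" and r: "retile {p, p + a, p + b, p + a + b} t t'"
    using fl unfolding flip_def flip_regions_def by blast
  define B where "B = {p, p + a, p + b, p + a + b}"
  obtain T T' where T: "T \<in> tilings_of B" "T' \<in> tilings_of B" "T \<subseteq> t" "T' \<noteq> T" "t' = (t - T) \<union> T'"
    using r by (auto simp: retile_def B_def)
  have t': "t' \<in> tilings_of R" using retile_tiling[OF t T(1-3)] T(5) by simp
  have sub: "B \<subseteq> R"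
    unfolding Union_tiling[OF T(1), symmetric] Union_tiling[OF t, symmetric] using T(3) by blast
  have d: "dir t q = dir T q" "dir t' q = dir T' q" if "q \<in> B" for q
    using dir_subset[OF T(1) t T(3) that] dir_subset[OF T(2) t' _ that] T(5) by auto
  have o: "dir t' q = dir t q" if "q \<notin> B" for q
    by (rule dir_retile_outside[OF t T(5) T(1-3) that])
  then have o': "\<forall>q. q \<notin> B \<longrightarrow> dir t' q = dir t q" by blast
  have ne: "dir T \<noteq> dir T'" using T(4) dominoes_dir[OF T(1)] dominoes_dir[OF T(2)] by metis
  have z: "dir T q = dir T' q" if "q \<notin> B" for q
    using field_onD(4)[OF field_dir[OF T(1)] that] field_onD(4)[OF field_dir[OF T(2)] that] by simp
  have comm: "p + b + a = p + a + b" "{p, p + b, p + a, p + b + a} = B" "{p, p + b, p + a, p + a + b} = B" by (auto simp: B_def algebra_simps)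
  have x: "dir T p \<noteq> dir T' p \<or> dir T (p+a) \<noteq> dir T' (p+a) \<or> dir T (p+b) \<noteq> dir T' (p+b)
      \<or> dir T (p+a+b) \<noteq> dir T' (p+a+b)"
  proof (rule ccontr)
    assume "\<not> ?thesis"
    then have "dir T q = dir T' q" for q
      using z[of q] unfolding B_def by blast
    with ne show False by blast
  qed
  have inB: "p \<in> B" "p + a \<in> B" "p + b \<in> B" "p + a + b \<in> B" by (auto simp: B_def)
  have "flip_fields p a b (dir t) (dir t') \<or> flip_fields p b a (dir t) (dir t')"
    using block_tilings[OF T(1)[unfolded B_def] ab] block_tilings[OF T(2)[unfolded B_def] ab] x o'
    unfolding flip_fields_def comm(1) comm(3) B_def[symmetric] d[OF inB(1)] d[OF inB(2)] d[OF inB(3)] d[OF inB(4)]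
    by (elim disjE conjE; simp)
  then show ?thesis using ab sub comm(2) unfolding B_def by blast
qed

lemma sum_involution_zero:
  fixes g :: "'a \<Rightarrow> int"
  assumes S: "finite S"
    and inv: "\<And>r. r \<in> S \<Longrightarrow> g r \<noteq> 0 \<Longrightarrow> h r \<in> S \<and> h (h r) = r \<and> g (h r) = - g r"
  shows "sum g S = 0"
proof -
  let ?S = "{r \<in> S. g r \<noteq> 0}"
  have *: "sum g S = sum g ?S" using S by (intro sum.mono_neutral_right) auto
  have "sum g ?S = sum (\<lambda>r. g (h r)) ?S"
    using inv by (intro sum.reindex_bij_witness[of _ h h]) auto
  also have "\<dots> = - sum g ?S" using inv by (simp add: sum_negf)
  finally show ?thesis using * by simp
qed

text \<open>
  The two dominoes along the second axis occupy two neighbouring positions in each of two rows, with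
  opposite signs.  All other cubes of the row see both positions from the same side, so their
  contributions cancel.  The dominoes along the first axis do not contribute.
\<close>

lemma twist_form_flip_12:
  assumes R: "finite R" and B: "{p, p + (0,1,0), p + (1,0,0), p + (0,1,0) + (1,0,0)} \<subseteq> R"
    and ff: "flip_fields p (0,1,0) (1,0,0) f g"
  shows "twist_form R f = twist_form R g"
proof -
  let ?B = "{p, p + (0,1,0), p + (1,0,0), p + (0,1,0) + (1,0,0)}"
  obtain i j k where p: "p = (i,j,k)" by (cases p)
  have o: "g q = f q" if "q \<notin> ?B" for q using ff that unfolding flip_fields_def by blast
  have F: "f (i,j,k) = (0,1,0)" "f (i,j+1,k) = (0,-1,0)" "f (i+1,j,k) = (0,1,0)" "f (i+1,j+1,k) = (0,-1,0)"
       "g (i,j,k) = (1,0,0)" "g (i,j+1,k) = (1,0,0)" "g (i+1,j,k) = (-1,0,0)" "g (i+1,j+1,k) = (-1,0,0)"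
    using ff by (auto simp: flip_fields_def p)
  have same: "w3 g q = w3 f q" for q
  proof (cases "q \<in> ?B")
    case True
    then show ?thesis by (auto simp: p w3_def F)
  next
    case False
    then show ?thesis using o by (simp add: w3_def)
  qed
  have "twist_form R f - twist_form R g
      = (\<Sum>r\<in>R. w3 f r * (\<Sum>q\<in>R. row_sign r q * (w2 f q - w2 g q)))"
    unfolding twist_form_def same by (simp add: sum_subtractf[symmetric] sum_distrib_left algebra_simps)
  also have "\<dots> = 0"
  proof (intro sum.neutral ballI)
    fix r assume "r \<in> R"
    have "(\<Sum>q\<in>R. row_sign r q * (w2 f q - w2 g q)) = (\<Sum>q\<in>?B. row_sign r q * (w2 f q - w2 g q))"
      using R B o by (intro sum.mono_neutral_right) (auto simp: w2_def)
    also have "w3 f r * \<dots> = 0"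
      by (cases r) (auto simp: p w2_def w3_def F row_sign_def eps_def black_def sgn_if)
    finally show "w3 f r * (\<Sum>q\<in>R. row_sign r q * (w2 f q - w2 g q)) = 0" .
  qed
  finally show ?thesis by simp
qed

text \<open>
  The same cancellation, with the components \<open>w2\<close> and \<open>w3\<close> exchanged.
\<close>

lemma twist_form_flip_13:
  assumes R: "finite R" and B: "{p, p + (0,0,1), p + (1,0,0), p + (0,0,1) + (1,0,0)} \<subseteq> R"
    and ff: "flip_fields p (0,0,1) (1,0,0) f g"
  shows "twist_form R f = twist_form R g"
proof -
  let ?B = "{p, p + (0,0,1), p + (1,0,0), p + (0,0,1) + (1,0,0)}"
  obtain i j k where p: "p = (i,j,k)" by (cases p)
  have o: "g q = f q" if "q \<notin> ?B" for q using ff that unfolding flip_fields_def by blast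
  have F: "f (i,j,k) = (0,0,1)" "f (i,j,k+1) = (0,0,-1)" "f (i+1,j,k) = (0,0,1)" "f (i+1,j,k+1) = (0,0,-1)"
       "g (i,j,k) = (1,0,0)" "g (i,j,k+1) = (1,0,0)" "g (i+1,j,k) = (-1,0,0)" "g (i+1,j,k+1) = (-1,0,0)"
    using ff by (auto simp: flip_fields_def p)
  have same: "w2 g q = w2 f q" for q
  proof (cases "q \<in> ?B")
    case True
    then show ?thesis by (auto simp: p w2_def F)
  next
    case False
    then show ?thesis using o by (simp add: w2_def)
  qed
  have "twist_form R f - twist_form R g
      = (\<Sum>q\<in>R. \<Sum>r\<in>R. w2 f r * (row_sign q r * (w3 f q - w3 g q)))"
    unfolding twist_form_def same by (simp add: sum_subtractf[symmetric] algebra_simps)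
  also have "\<dots> = (\<Sum>r\<in>R. w2 f r * (\<Sum>q\<in>R. row_sign q r * (w3 f q - w3 g q)))"
    by (subst sum.swap) (simp add: sum_distrib_left)
  also have "\<dots> = 0"
  proof (intro sum.neutral ballI)
    fix r assume "r \<in> R"
    have "(\<Sum>q\<in>R. row_sign q r * (w3 f q - w3 g q)) = (\<Sum>q\<in>?B. row_sign q r * (w3 f q - w3 g q))"
      using R B o by (intro sum.mono_neutral_right) (auto simp: w3_def)
    also have "w2 f r * \<dots> = 0"
      by (cases r) (auto simp: p w2_def w3_def F row_sign_def eps_def black_def sgn_if)
    finally show "w2 f r * (\<Sum>q\<in>R. row_sign q r * (w3 f q - w3 g q)) = 0" .
  qed
  finally show ?thesis by simp
qed

lemma finite_cylinder: "finite D \<Longrightarrow> finite (cylinder D N)"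
proof -
  assume "finite D"
  then have "finite ((\<lambda>(s, k). (fst s, snd s, k)) ` (D \<times> {0..<int N}))" by blast
  moreover have "cylinder D N \<subseteq> (\<lambda>(s, k). (fst s, snd s, k)) ` (D \<times> {0..<int N})"
    by (force simp: cylinder_def)
  ultimately show ?thesis by (rule finite_subset[rotated])
qed

lemma mem_cylinder: "(i, j, k) \<in> cylinder D N \<longleftrightarrow> (i, j) \<in> D \<and> 0 \<le> k \<and> k < int N"
  by (simp add: cylinder_def)

lemma slab_step:
  fixes x y z x' y' z' j k :: int
  assumes "d \<in> steps" "y \<in> {j,j+1}" "z \<in> {k,k+1}" "y' \<in> {j,j+1}" "z' \<in> {k,k+1}"
    "(x,y,z) + d = (x',y',z')"
  shows "(if y' = j then 1 else - 1) * fst (snd d) + (if z' = k then 1 else - 1) * snd (snd d) - 1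
    = - ((if y = j then 1 else - 1) * fst (snd d) + (if z = k then 1 else - 1) * snd (snd d) + 1)"
  using assms unfolding steps_eq by (auto split: if_splits)

text \<open>
  A conservation law for the four rows through a \<open>2 \<times> 2\<close> square at \<open>x = i\<close> whose
  cubes are matched with each other.  Add the colour \<open>eps\<close> to each term.  Then a cube whose
  partner is outside of the four rows contributes 0, and the two cubes of a domino inside the rows
  cancel; no domino crosses \<open>x = i\<close>.  The colours that have been added have sum 0, because the
  four rows consist of two equal layers one above the other.
\<close>

lemma slab_conservation:
  assumes R: "finite D" and f: "field_on (cylinder D N) f"
    and B: "{(i,j,k), (i,j+1,k), (i,j,k+1), (i,j+1,k+1)} \<subseteq> cylinder D N"
    and F: "f (i,j,k) = (0,1,0)" "f (i,j+1,k) = (0,-1,0)" "f (i,j,k+1) = (0,1,0)" "f (i,j+1,k+1) = (0,-1,0)"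
  defines "S \<equiv> {(x,y,z) \<in> cylinder D N. x \<noteq> i \<and> y \<in> {j,j+1} \<and> z \<in> {k,k+1}}"
  shows "(\<Sum>(x,y,z)\<in>S. sgn (i - x) *
     ((if y = j then 1 else - 1) * w2 f (x,y,z) + (if z = k then 1 else - 1) * w3 f (x,y,z))) = 0"
proof -
  let ?g = "\<lambda>(x,y,z). sgn (i - x) *
     ((if y = j then 1 else - 1) * w2 f (x,y,z) + (if z = k then 1 else - 1) * w3 f (x,y,z))"
  let ?e = "\<lambda>(x,y,z). sgn (i - x) * eps (x,y,z)"
  have fin: "finite S" by (rule finite_subset[OF _ finite_cylinder[OF R, of N]]) (auto simp: S_def)
  (* Exchange the two layers. *)
  have e0: "sum ?e S = 0"
  proof (rule sum_involution_zero[OF fin, where h = "\<lambda>(x,y,z). (x,y,2*k+1-z)"])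
    fix r assume "r \<in> S"
    then show "(case r of (x,y,z) \<Rightarrow> (x,y,2*k+1-z)) \<in> S \<and>
      (case case r of (x,y,z) \<Rightarrow> (x,y,2*k+1-z) of (x,y,z) \<Rightarrow> (x,y,2*k+1-z)) = r \<and>
      ?e (case r of (x,y,z) \<Rightarrow> (x,y,2*k+1-z)) = - ?e r"
      using B by (cases r) (auto simp: S_def mem_cylinder eps_def black_def)
  qed
  (* Exchange the two cubes of each domino; cubes matched with the outside contribute 0. *)
  have "(\<Sum>r\<in>S. ?g r + ?e r) = 0"
  proof (rule sum_involution_zero[OF fin, where h = "\<lambda>r. r + f r"])
    fix r assume r: "r \<in> S" and nz: "?g r + ?e r \<noteq> 0"
    obtain x y z where xyz: "r = (x,y,z)" by (cases r)
    have rR: "r \<in> cylinder D N" and m: "x \<noteq> i" "y \<in> {j,j+1}" "z \<in> {k,k+1}"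
      using r xyz by (auto simp: S_def)
    have st: "f r \<in> steps" "r + f r \<in> cylinder D N" "f (r + f r) = - f r"
      using field_onD(1-3)[OF f rR] by auto
    have inS: "r + f r \<in> S"
    proof (rule ccontr)
      assume no: "r + f r \<notin> S"
      have "fst (r + f r) \<noteq> i \<or> f r \<notin> {(1,0,0),(-1,0,0)}"
      proof (rule ccontr)
        assume "\<not> ?thesis"
        then have a: "fst (r + f r) = i" "f r \<in> {(1,0,0),(-1,0,0)}" by auto
        then have "r + f r \<in> {(i,j,k), (i,j+1,k), (i,j,k+1), (i,j+1,k+1)}"
          using m xyz by auto
        then have "f (r + f r) \<in> {(0,1,0), (0,-1,0)}" using F by auto
        with st(3) a(2) show False by auto
      qed
      then show False
        using st(1,2) no nz m xyz unfolding steps_eq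
        by (auto simp: S_def w2_def w3_def)
    qed
    have "f r \<noteq> 0" using st(1) zero_notin_steps by auto
    have e: "eps (r + f r) = - eps r" using st(1) by (rule eps_add_step)
    define d where "d = f r"
    have d: "d \<in> steps" "f (r + d) = - d" using st by (simp_all add: d_def)
    have w: "w2 f (r + d) = w2 f r" "w3 f (r + d) = w3 f r"
      using e d(2) by (simp_all add: w2_def w3_def flip: d_def)
    obtain x' y' z' where x': "r + d = (x',y',z')" by (cases "r + d")
    have m': "x' \<noteq> i" "y' \<in> {j,j+1}" "z' \<in> {k,k+1}"
      using inS x' by (auto simp: S_def simp flip: d_def)
    have sg: "sgn (i - x') = sgn (i - x)"
      using d(1) m(1) m'(1) x' xyz unfolding steps_eq by (auto simp: sgn_if)
    have ww: "w2 f r = eps r * fst (snd d)" "w3 f r = eps r * snd (snd d)"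
      by (simp_all add: w2_def w3_def d_def)
    have "((if y' = j then 1 else - 1) * w2 f r + (if z' = k then 1 else - 1) * w3 f r) - eps r
        = eps r * ((if y' = j then 1 else - 1) * fst (snd d) + (if z' = k then 1 else - 1) * snd (snd d) - 1)"
      unfolding ww by (simp add: algebra_simps)
    also have "\<dots> = - (eps r * ((if y = j then 1 else - 1) * fst (snd d) + (if z = k then 1 else - 1) * snd (snd d) + 1))"
      unfolding slab_step[OF d(1) m(2,3) m'(2,3) x'[unfolded xyz]] by (rule mult_minus_right)
    also have "\<dots> = - (((if y = j then 1 else - 1) * w2 f r + (if z = k then 1 else - 1) * w3 f r) + eps r)"
      unfolding ww by (simp add: algebra_simps)
    finally have *: "((if y' = j then 1 else - 1) * w2 f r + (if z' = k then 1 else - 1) * w3 f r) - eps r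
        = - (((if y = j then 1 else - 1) * w2 f r + (if z = k then 1 else - 1) * w3 f r) + eps r)" .
    have "sgn (i - x) * (((if y' = j then 1 else - 1) * w2 f r + (if z' = k then 1 else - 1) * w3 f r) - eps r)
        = - (sgn (i - x) * (((if y = j then 1 else - 1) * w2 f r + (if z = k then 1 else - 1) * w3 f r) + eps r))"
      unfolding * by (rule mult_minus_right)
    then have "?g (r + f r) + ?e (r + f r) = - (?g r + ?e r)"
      using w e unfolding d_def[symmetric] x' unfolding xyz by (simp add: sg right_diff_distrib distrib_left)
    then show "r + f r \<in> S \<and> r + f r + f (r + f r) = r \<and> ?g (r + f r) + ?e (r + f r) = - (?g r + ?e r)"
      using inS st(3) by simp
  qed
  then show ?thesis using e0 by (simp add: sum.distrib)
qed

text \<open>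
  The two forms differ by the interaction of the four cubes of the flip with the rest of the four rows
  through them.  Collecting the terms of each other cube gives the sum in \<open>slab_conservation\<close>.
\<close>

lemma twist_form_flip_23:
  assumes D: "finite D" and f: "field_on (cylinder D N) f"
    and B: "{p, p + (0,1,0), p + (0,0,1), p + (0,1,0) + (0,0,1)} \<subseteq> cylinder D N"
    and ff: "flip_fields p (0,1,0) (0,0,1) f g"
  shows "twist_form (cylinder D N) f = twist_form (cylinder D N) g"
proof -
  let ?R = "cylinder D N"
  obtain i j k where p: "p = (i,j,k)" by (cases p)
  define B where "B = {(i,j,k), (i,j+1,k), (i,j,k+1), (i,j+1,k+1)}"
  have BR: "B \<subseteq> ?R" using B by (simp add: B_def p)
  have fin: "finite ?R" by (rule finite_cylinder[OF D])
  have Beq: "B = {p, p + (0,1,0), p + (0,0,1), p + (0,1,0) + (0,0,1)}" by (simp add: B_def p)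
  have o: "g q = f q" if "q \<notin> B" for q using ff that unfolding flip_fields_def Beq by blast
  have F: "f (i,j,k) = (0,1,0)" "f (i,j+1,k) = (0,-1,0)" "f (i,j,k+1) = (0,1,0)" "f (i,j+1,k+1) = (0,-1,0)"
       "g (i,j,k) = (0,0,1)" "g (i,j+1,k) = (0,0,1)" "g (i,j,k+1) = (0,0,-1)" "g (i,j+1,k+1) = (0,0,-1)"
    using ff by (auto simp: flip_fields_def p)
  have W: "w3 f q = 0" "w2 g q = 0" if "q \<in> B" for q
    using that F unfolding B_def by (auto simp: w2_def w3_def)
  have W': "w3 g q = w3 f q" "w2 g q = w2 f q" if "q \<notin> B" for q
    using o[OF that] by (auto simp: w2_def w3_def)
  have E: "eps (i,j,k) = eps p" "eps (i,j+1,k) = - eps p" "eps (i,j,k+1) = - eps p" "eps (i,j+1,k+1) = eps p"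
    by (auto simp: eps_def black_def p)
  define S where "S = {(x,y,z) \<in> ?R. x \<noteq> i \<and> y \<in> {j,j+1} \<and> z \<in> {k,k+1}}"
  let ?g = "\<lambda>(x,y,z). sgn (i - x) *
     ((if y = j then 1 else - 1) * w2 f (x,y,z) + (if z = k then 1 else - 1) * w3 f (x,y,z))"
  have split: "row_sign r q * w2 f q * w3 f r - row_sign r q * w2 g q * w3 g r
     = w3 f r * (row_sign r q * (w2 f q - w2 g q)) - w2 g q * (row_sign r q * (w3 g r - w3 f r))" for r q
    by (simp add: algebra_simps)
  have "twist_form ?R f - twist_form ?R g
      = (\<Sum>r\<in>?R. w3 f r * (\<Sum>q\<in>?R. row_sign r q * (w2 f q - w2 g q)))
      - (\<Sum>r\<in>?R. \<Sum>q\<in>?R. w2 g q * (row_sign r q * (w3 g r - w3 f r)))"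
    unfolding twist_form_def sum_subtractf[symmetric] split
    by (simp add: sum_subtractf sum_distrib_left)
  also have "(\<Sum>r\<in>?R. \<Sum>q\<in>?R. w2 g q * (row_sign r q * (w3 g r - w3 f r)))
      = (\<Sum>r\<in>?R. w2 g r * (\<Sum>q\<in>?R. row_sign q r * (w3 g q - w3 f q)))"
    by (subst sum.swap) (simp add: sum_distrib_left)
  finally have "twist_form ?R f - twist_form ?R g
      = (\<Sum>r\<in>?R. w3 f r * (\<Sum>q\<in>?R. row_sign r q * (w2 f q - w2 g q))
               - w2 g r * (\<Sum>q\<in>?R. row_sign q r * (w3 g q - w3 f q)))"
    by (simp add: sum_subtractf)
  also have "\<dots> = (\<Sum>r\<in>?R. if r \<in> S then eps p * ?g r else 0)"
  proof (rule sum.cong[OF refl])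
    fix r assume r: "r \<in> ?R"
    have 1: "(\<Sum>q\<in>?R. row_sign r q * (w2 f q - w2 g q)) = (\<Sum>q\<in>B. row_sign r q * (w2 f q - w2 g q))"
      using fin BR W' by (intro sum.mono_neutral_right) auto
    have 2: "(\<Sum>q\<in>?R. row_sign q r * (w3 g q - w3 f q)) = (\<Sum>q\<in>B. row_sign q r * (w3 g q - w3 f q))"
      using fin BR W' by (intro sum.mono_neutral_right) auto
    have 3: "(\<Sum>q\<in>B. row_sign r q * (w2 f q - w2 g q)) = 
        eps p * (row_sign r (i,j,k) + row_sign r (i,j+1,k) - row_sign r (i,j,k+1) - row_sign r (i,j+1,k+1))"
      unfolding B_def by (simp add: w2_def F E) (simp add: algebra_simps)?
    have 4: "(\<Sum>q\<in>B. row_sign q r * (w3 g q - w3 f q)) = 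
        eps p * (row_sign (i,j,k) r - row_sign (i,j+1,k) r + row_sign (i,j,k+1) r - row_sign (i,j+1,k+1) r)"
      unfolding B_def by (simp add: w3_def F E) (simp add: algebra_simps)?
    show "w3 f r * (\<Sum>q\<in>?R. row_sign r q * (w2 f q - w2 g q))
               - w2 g r * (\<Sum>q\<in>?R. row_sign q r * (w3 g q - w3 f q))
       = (if r \<in> S then eps p * ?g r else 0)"
    proof (cases "r \<in> B")
      case True
      then have "r \<notin> S" by (auto simp: S_def B_def)
      then show ?thesis using W[OF True] by simp
    next
      case False
      obtain x y z where xyz: "r = (x,y,z)" by (cases r)
      have s: "sgn (x - i) = - sgn (i - x)" by (simp add: sgn_if)
      show ?thesis
      proof (cases "y \<in> {j,j+1} \<and> z \<in> {k,k+1}")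
        case True
        then have "r \<in> S" using False r xyz by (auto simp: S_def B_def)
        then show ?thesis
          using True unfolding 1 2 unfolding 3 4 W'(2)[OF False] unfolding xyz
          by (auto simp: row_sign_def s algebra_simps)
      next
        case False
        then have "r \<notin> S" using xyz by (auto simp: S_def)
        then show ?thesis
          using False unfolding 1 2 unfolding 3 4 unfolding xyz
          by (auto simp: row_sign_def)
      qed
    qed
  qed
  also have "\<dots> = (\<Sum>r\<in>S. eps p * ?g r)"
  proof -
    have "?R \<inter> S = S" by (auto simp: S_def)
    then show ?thesis using sum.inter_restrict[OF fin, of "\<lambda>r. eps p * ?g r" S] by simp
  qed
  also have "\<dots> = eps p * (\<Sum>r\<in>S. ?g r)" by (simp add: sum_distrib_left)
  also have "(\<Sum>r\<in>S. ?g r) = 0"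
    unfolding S_def using slab_conservation[OF D f BR[unfolded B_def] F(1-4)] .
  finally show ?thesis by simp
qed

lemma flip_fields_sym: "flip_fields p a b f g \<longleftrightarrow> flip_fields p b a g f"
proof -
  have c: "p + b + a = p + a + b" by (simp add: ac_simps)
  have s: "{p, p + b, p + a, p + a + b} = {p, p + a, p + b, p + a + b}" by blast
  have e: "(\<forall>q. q \<notin> B \<longrightarrow> f q = g q) \<longleftrightarrow> (\<forall>q. q \<notin> B \<longrightarrow> g q = f q)" for B :: "cube set"
    by (simp only: eq_commute)
  show ?thesis unfolding flip_fields_def c s e[of "{p, p + a, p + b, p + a + b}"] by (intro iffI; elim conjE; intro conjI; assumption)
qed

lemma twist_e1_flip:
  assumes D: "finite D" and t: "t \<in> tilings D N" and fl: "flip t t'"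
  shows "twist (corner (1,0,0)) t' = twist (corner (1,0,0)) t"
proof -
  let ?R = "cylinder D N"
  have t: "t \<in> tilings_of ?R" using t by (simp add: tilings_def)
  have t': "t' \<in> tilings_of ?R" using flip_closed[OF t fl] .
  note fin = finite_cylinder[OF D, of N]
  obtain p a b where ab: "a \<in> axes" "b \<in> axes" "a \<noteq> b" and B: "{p, p + a, p + b, p + a + b} \<subseteq> ?R"
    and ff: "flip_fields p a b (dir t) (dir t')"
    using flip_dir[OF t fl] by blast
  have comm: "{p, p + b, p + a, p + b + a} = {p, p + a, p + b, p + a + b}"
    by (auto simp: ac_simps)
  note ff' = ff[unfolded flip_fields_sym[of p a b]]
  note B' = B[folded comm]
  consider "a = (0,1,0)" "b = (1,0,0)" | "a = (1,0,0)" "b = (0,1,0)"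
    | "a = (0,0,1)" "b = (1,0,0)" | "a = (1,0,0)" "b = (0,0,1)"
    | "a = (0,1,0)" "b = (0,0,1)" | "a = (0,0,1)" "b = (0,1,0)"
    using axes_cases[OF ab(1)] axes_cases[OF ab(2)] ab(3) by blast
  then have "twist_form ?R (dir t') = twist_form ?R (dir t)"
  proof cases
    case 1
    then show ?thesis using twist_form_flip_12[OF fin] B ff by metis
  next
    case 2
    then show ?thesis using twist_form_flip_12[OF fin] B' ff' by metis
  next
    case 3
    then show ?thesis using twist_form_flip_13[OF fin] B ff by metis
  next
    case 4
    then show ?thesis using twist_form_flip_13[OF fin] B' ff' by metis
  next
    case 5
    then show ?thesis using twist_form_flip_23[OF D field_dir[OF t]] B ff by metis
  next
    case 6
    then show ?thesis using twist_form_flip_23[OF D field_dir[OF t']] B' ff' by metis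
  qed
  with twist_e1[OF t fin] twist_e1[OF t' fin] show ?thesis by simp
qed

text \<open>
  The functions \<open>std_disk\<close> and \<open>std_tiling\<close> reduce any horizontal direction to that of the
  first axis (\<open>twist_std\<close>).
\<close>

definition std_disk :: "cube \<Rightarrow> square set \<Rightarrow> square set" where
  "std_disk U D = (if fst U = 0 then prod.swap ` D else D)"

definition std_tiling :: "cube \<Rightarrow> tiling \<Rightarrow> tiling" where
  "std_tiling U t = (if fst U = 0 then transpose_tiling t else t)"

lemma swap_xy_cylinder: "swap_xy ` cylinder D N = cylinder (prod.swap ` D) N"
proof -
  have "p \<in> swap_xy ` cylinder D N \<longleftrightarrow> p \<in> cylinder (prod.swap ` D) N" for p
  proof (cases p)
    case (fields i j k)
    have "p \<in> swap_xy ` cylinder D N \<longleftrightarrow> swap_xy p \<in> cylinder D N"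
      by (metis image_iff swap_xy_swap_xy)
    moreover have "(i,j) \<in> prod.swap ` D \<longleftrightarrow> (j,i) \<in> D" by force
    ultimately show ?thesis using fields by (simp add: mem_cylinder)
  qed
  then show ?thesis by blast
qed

lemma std_tiling_tilings: "t \<in> tilings D N \<Longrightarrow> std_tiling U t \<in> tilings (std_disk U D) N"
  using transpose_tilings[of t "cylinder D N"]
  by (simp add: std_tiling_def std_disk_def tilings_def swap_xy_cylinder)

lemma std_tiling_std_tiling [simp]: "std_tiling U (std_tiling U t) = t"
  by (simp add: std_tiling_def)

lemma std_disk_std_disk [simp]: "std_disk U (std_disk U D) = D"
  by (simp add: std_disk_def image_image)

lemma finite_std_disk [simp]: "finite D \<Longrightarrow> finite (std_disk U D)"
  by (simp add: std_disk_def)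

lemma twist_std:
  assumes D: "finite D" and U: "U \<in> horizontals" and t: "t \<in> tilings D N"
  shows "twist (corner U) t = (if fst U = 0 then - 1 else 1) * twist (corner (1,0,0)) (std_tiling U t)"
proof -
  have t: "t \<in> tilings_of (cylinder D N)" using t by (simp add: tilings_def)
  note fin = finite_cylinder[OF D, of N]
  have m: "twist (corner (-1,0,0)) t = twist (corner (1,0,0)) t"
    "twist (corner (0,-1,0)) t = twist (corner (0,1,0)) t"
    using twist_uminus[OF _ t fin, of "(1,0,0)"] twist_uminus[OF _ t fin, of "(0,1,0)"]
    by (simp_all add: horizontals_def)
  show ?thesis
    using U twist_transpose[OF t fin] m by (auto simp: horizontals_def std_tiling_def)
qed

lemma flip_std: "flip t t' \<Longrightarrow> flip (std_tiling U t) (std_tiling U t')"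
  by (simp add: std_tiling_def flip_transpose)

lemma trit_std: "trit t t' \<Longrightarrow> trit (std_tiling U t) (std_tiling U t')"
  by (simp add: std_tiling_def trit_transpose)

theorem twist_flip:
  assumes D: "finite D" and U: "U \<in> horizontals" and t: "t \<in> tilings D N" and fl: "flip t t'"
  shows "twist (corner U) t' = twist (corner U) t"
proof -
  have t': "t' \<in> tilings D N" using t fl flip_closed unfolding tilings_def by blast
  show ?thesis
    using twist_e1_flip[OF finite_std_disk[OF D] std_tiling_tilings[OF t] flip_std[OF fl]]
    by (simp add: twist_std[OF D U t] twist_std[OF D U t'])
qed

section \<open>The twist is an integer\<close>

lemma sum_telescope_int:
  fixes F :: "int \<Rightarrow> int"
  assumes "A \<le> B"
  shows "(\<Sum>k\<in>{A..<B}. F k - F (k - 1)) = F (B - 1) - F (A - 1)"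
  using assms
proof (induction B rule: int_ge_induct)
  case (step i)
  have "{A..<i + 1} = insert i {A..<i}" using step by auto
  then show ?case using step by simp
qed simp

lemma sum_antisym_zero:
  fixes g :: "'a \<Rightarrow> 'a \<Rightarrow> int"
  assumes "\<And>x y. g y x = - g x y"
  shows "(\<Sum>x\<in>Z. \<Sum>y\<in>Z. g x y) = 0"
proof -
  have "(\<Sum>x\<in>Z. \<Sum>y\<in>Z. g x y) = (\<Sum>x\<in>Z. \<Sum>y\<in>Z. g y x)" by (rule sum.swap)
  also have "\<dots> = (\<Sum>x\<in>Z. \<Sum>y\<in>Z. - g x y)" by (intro sum.cong refl) (rule assms)
  also have "\<dots> = - (\<Sum>x\<in>Z. \<Sum>y\<in>Z. g x y)" by (simp add: sum_negf)
  finally show ?thesis by simp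
qed

text \<open>
  Signs satisfy \<open>a * b * c = a + b + c - 2\<close> modulo 4.  Apply this to the factors \<open>o2\<close>,
  \<open>o3\<close> and the factor that depends only on the two positions, which is the sign of their order
  times their colours.  The sum over pairs then becomes a sum of sums over single positions.  In the
  part that depends on the positions, the sum over the cubes of type \<open>o2\<close> may be replaced by the
  sum over the whole row: pairs of two cubes of type \<open>o3\<close> cancel by antisymmetry, and the two
  cubes \<open>x\<close> and \<open>m x\<close> of a domino along the row cancel because their colours differ.
\<close>

lemma row_mod_4:
  fixes X :: "int set" and o2 o3 e m :: "int \<Rightarrow> int"
  assumes X: "finite X"
    and o: "\<And>x. x \<in> X \<Longrightarrow> (o2 x, o3 x) \<in> {(0,0), (1,0), (-1,0), (0,1), (0,-1)}"
    and e: "\<And>x. e x \<in> {1, -1}"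
    and m: "\<And>x. x \<in> X \<Longrightarrow> o2 x = 0 \<Longrightarrow> o3 x = 0 \<Longrightarrow>
        m x \<in> X \<and> o2 (m x) = 0 \<and> o3 (m x) = 0 \<and> m (m x) = x \<and> e (m x) = - e x \<and> \<bar>m x - x\<bar> = 1"
  defines "l \<equiv> int (card {x\<in>X. o2 x = -1})" and "r \<equiv> int (card {x\<in>X. o2 x = 1})"
    and "d \<equiv> int (card {x\<in>X. o3 x = -1})" and "u \<equiv> int (card {x\<in>X. o3 x = 1})"
  shows "4 dvd (\<Sum>x\<in>X. \<Sum>x'\<in>X. sgn (x' - x) * (e x' * o2 x') * (e x * o3 x))
     - ((\<Sum>x\<in>{x\<in>X. o3 x \<noteq> 0}. \<Sum>x'\<in>X. sgn (x' - x) * (e x * e x')) + 2 * (l * u + r * d))"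
proof -
  define Z where "Z = {x\<in>X. o3 x \<noteq> 0}"
  define Y where "Y = {x\<in>X. o2 x \<noteq> 0}"
  define H where "H = {x\<in>X. o2 x = 0 \<and> o3 x = 0}"
  define g where "g x x' = sgn (x' - x) * (e x * e x')" for x x'
  have fin: "finite Z" "finite Y" "finite H" using X by (auto simp: Z_def Y_def H_def)
  have XU: "X = Z \<union> Y \<union> H" by (auto simp: Z_def Y_def H_def)
  have dj: "Z \<inter> Y = {}" "(Z \<union> Y) \<inter> H = {}" using o by (force simp: Z_def Y_def H_def)+
  have "(\<Sum>x\<in>X. \<Sum>x'\<in>X. sgn (x' - x) * (e x' * o2 x') * (e x * o3 x)) = (\<Sum>x\<in>Z. \<Sum>x'\<in>Y. g x x' * o2 x' * o3 x)"
  proof -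
    have "(\<Sum>x\<in>X. \<Sum>x'\<in>X. sgn (x' - x) * (e x' * o2 x') * (e x * o3 x))
        = (\<Sum>x\<in>X. \<Sum>x'\<in>X. g x x' * o2 x' * o3 x)"
      by (intro sum.cong refl) (simp add: g_def mult_ac)
    also have "\<dots> = (\<Sum>x\<in>Z. \<Sum>x'\<in>X. g x x' * o2 x' * o3 x)"
      using X by (intro sum.mono_neutral_right) (auto simp: Z_def)
    also have "\<dots> = (\<Sum>x\<in>Z. \<Sum>x'\<in>Y. g x x' * o2 x' * o3 x)"
      using X by (intro sum.cong refl sum.mono_neutral_right) (auto simp: Y_def)
    finally show ?thesis .
  qed
  moreover have "4 dvd (\<Sum>x\<in>Z. \<Sum>x'\<in>Y. g x x' * o2 x' * o3 x - (g x x' + o2 x' + o3 x - 2))"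
  proof (intro dvd_sum)
    fix x x' assume x: "x \<in> Z" "x' \<in> Y"
    then have "x \<noteq> x'" using dj by auto
    then have "g x x' \<in> {1, -1}" using e[of x] e[of x'] by (auto simp: g_def sgn_if)
    moreover have "o3 x \<in> {1, -1}" "o2 x' \<in> {1, -1}" using x o[of x] o[of x'] by (auto simp: Z_def Y_def)
    ultimately show "4 dvd g x x' * o2 x' * o3 x - (g x x' + o2 x' + o3 x - 2)" by auto
  qed
  moreover have "(\<Sum>x\<in>Z. \<Sum>x'\<in>Y. g x x' * o2 x' * o3 x - (g x x' + o2 x' + o3 x - 2))
     = (\<Sum>x\<in>Z. \<Sum>x'\<in>Y. g x x' * o2 x' * o3 x) - (\<Sum>x\<in>Z. \<Sum>x'\<in>Y. g x x')
       - int (card Z) * (\<Sum>x'\<in>Y. o2 x') - int (card Y) * (\<Sum>x\<in>Z. o3 x) + 2 * int (card Y) * int (card Z)"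
    by (simp add: sum_subtractf sum.distrib sum_distrib_left sum_distrib_right algebra_simps)
  moreover have "(\<Sum>x\<in>Z. \<Sum>x'\<in>Y. g x x') = (\<Sum>x\<in>Z. \<Sum>x'\<in>X. g x x')"
  proof -
    have "(\<Sum>x\<in>Z. \<Sum>x'\<in>X. g x x') = (\<Sum>x\<in>Z. (\<Sum>x'\<in>Z. g x x') + (\<Sum>x'\<in>Y. g x x') + (\<Sum>x'\<in>H. g x x'))"
      using fin dj by (simp add: XU sum.union_disjoint)
    also have "\<dots> = (\<Sum>x\<in>Z. \<Sum>x'\<in>Z. g x x') + (\<Sum>x\<in>Z. \<Sum>x'\<in>Y. g x x') + (\<Sum>x\<in>Z. \<Sum>x'\<in>H. g x x')"
      by (simp add: sum.distrib)
    also have "(\<Sum>x\<in>Z. \<Sum>x'\<in>Z. g x x') = 0"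
      by (rule sum_antisym_zero) (auto simp: g_def sgn_if)
    also have "(\<Sum>x\<in>Z. \<Sum>x'\<in>H. g x x') = 0"
    proof (rule sum.neutral, rule ballI)
      fix x assume x: "x \<in> Z"
      show "(\<Sum>x'\<in>H. g x x') = 0"
      proof (rule sum_involution_zero[OF fin(3), where h = m])
        fix y assume y: "y \<in> H"
        then have my: "m y \<in> H" "m (m y) = y" "e (m y) = - e y" "\<bar>m y - y\<bar> = 1"
          using m[of y] by (auto simp: H_def)
        have "x \<noteq> y" "x \<noteq> m y" using x y my(1) dj by auto
        then have "sgn (m y - x) = sgn (y - x)" using my(4) by (auto simp: sgn_if)
        then show "m y \<in> H \<and> m (m y) = y \<and> g x (m y) = - g x y"
          using my by (simp add: g_def)
      qed
    qed
    finally show ?thesis by simp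
  qed
  moreover have "(\<Sum>x'\<in>Y. o2 x') = r - l" "int (card Y) = r + l"
  proof -
    have Y: "Y = {x\<in>X. o2 x = 1} \<union> {x\<in>X. o2 x = -1}" using o by (force simp: Y_def)
    show "(\<Sum>x'\<in>Y. o2 x') = r - l" unfolding Y using X by (subst sum.union_disjoint) (auto simp: l_def r_def)
    show "int (card Y) = r + l" unfolding Y using X by (subst card_Un_disjoint) (auto simp: l_def r_def)
  qed
  moreover have "(\<Sum>x\<in>Z. o3 x) = u - d" "int (card Z) = u + d"
  proof -
    have Z: "Z = {x\<in>X. o3 x = 1} \<union> {x\<in>X. o3 x = -1}" using o by (force simp: Z_def)
    show "(\<Sum>x\<in>Z. o3 x) = u - d" unfolding Z using X by (subst sum.union_disjoint) (auto simp: u_def d_def)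
    show "int (card Z) = u + d" unfolding Z using X by (subst card_Un_disjoint) (auto simp: u_def d_def)
  qed
  ultimately have "4 dvd (\<Sum>x\<in>X. \<Sum>x'\<in>X. sgn (x' - x) * (e x' * o2 x') * (e x * o3 x))
     - (\<Sum>x\<in>Z. \<Sum>x'\<in>X. g x x') - (u + d) * (r - l) - (r + l) * (u - d) + 2 * (r + l) * (u + d)"
    (is "4 dvd ?E") by simp
  then have "4 dvd ?E + 4 * (- (l * u + r * d + l * d))" by (rule dvd_add) (rule dvd_triv_left)
  moreover have "(\<Sum>x\<in>X. \<Sum>x'\<in>X. sgn (x' - x) * (e x' * o2 x') * (e x * o3 x))
     - ((\<Sum>x\<in>{x\<in>X. o3 x \<noteq> 0}. \<Sum>x'\<in>X. sgn (x' - x) * (e x * e x')) + 2 * (l * u + r * d))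
     = ?E + 4 * (- (l * u + r * d + l * d))"
    unfolding Z_def[symmetric] g_def[symmetric] by (simp add: algebra_simps)
  ultimately show ?thesis by (simp only:)
qed

lemma field_neighbour:
  assumes f: "field_on R f" and c: "c \<noteq> 0"
  shows "f (p + c) = - c \<longleftrightarrow> f p = c"
proof
  assume a: "f p = c"
  then have "p \<in> R" using field_onD(4)[OF f, of p] c by metis
  then show "f (p + c) = - c" using field_onD(3)[OF f, of p] a by simp
next
  assume a: "f (p + c) = - c"
  then have "p + c \<in> R" using field_onD(4)[OF f, of "p + c"] c by (metis neg_equal_0_iff_equal)
  then show "f p = c" using field_onD(3)[OF f, of "p + c"] a by simp
qed

lemma sum_cylinder:
  fixes h :: "cube \<Rightarrow> int"
  assumes D: "finite D" and Y: "snd ` D \<subseteq> Y" "finite Y"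
  shows "(\<Sum>p\<in>cylinder D N. h p) = (\<Sum>y\<in>Y. \<Sum>k\<in>{0..<int N}. \<Sum>x\<in>{x. (x,y) \<in> D}. h (x,y,k))"
proof -
  have X: "finite {x. (x,y) \<in> D}" for y
    by (rule finite_subset[of _ "fst ` D"]) (use D in force)+
  have mem: "b \<in> Y" if "(a, b) \<in> D" for a b using Y(1) that by force
  have "(\<Sum>y\<in>Y. \<Sum>k\<in>{0..<int N}. \<Sum>x\<in>{x. (x,y) \<in> D}. h (x,y,k))
     = (\<Sum>(y,k,x)\<in>(SIGMA y:Y. SIGMA k:{0..<int N}. {x. (x,y) \<in> D}). h (x,y,k))"
    using Y X by (simp add: sum.Sigma)
  also have "\<dots> = (\<Sum>p\<in>cylinder D N. h p)"
    by (rule sum.reindex_bij_witness[where j = "\<lambda>(y,k,x). (x,y,k)" and i = "\<lambda>(x,y,k). (y,k,x)"])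
       (use mem in \<open>auto simp: mem_cylinder\<close>)
  finally show ?thesis by simp
qed

definition row_form :: "square set \<Rightarrow> (cube \<Rightarrow> cube) \<Rightarrow> int \<Rightarrow> int \<Rightarrow> int" where
  "row_form D f y k = (\<Sum>x\<in>{x. (x,y) \<in> D}. \<Sum>x'\<in>{x. (x,y) \<in> D}. sgn (x' - x) * w2 f (x',y,k) * w3 f (x,y,k))"

lemma twist_form_rows:
  assumes D: "finite D" and Y: "snd ` D \<subseteq> Y" "finite Y"
  shows "twist_form (cylinder D N) f = (\<Sum>y\<in>Y. \<Sum>k\<in>{0..<int N}. row_form D f y k)"
proof -
  have "(\<Sum>q\<in>cylinder D N. row_sign (x,y,k) q * w2 f q * w3 f (x,y,k))
      = (\<Sum>x'\<in>{x. (x,y) \<in> D}. sgn (x' - x) * w2 f (x',y,k) * w3 f (x,y,k))"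
    if "k \<in> {0..<int N}" for x y k
  proof -
    let ?S = "(\<lambda>x'. (x',y,k)) ` {x. (x,y) \<in> D}"
    have "(\<Sum>q\<in>cylinder D N. row_sign (x,y,k) q * w2 f q * w3 f (x,y,k))
       = (\<Sum>q\<in>?S. row_sign (x,y,k) q * w2 f q * w3 f (x,y,k))"
      using that finite_cylinder[OF D]
      by (intro sum.mono_neutral_right) (auto simp: mem_cylinder row_sign_def)
    also have "\<dots> = (\<Sum>x'\<in>{x. (x,y) \<in> D}. sgn (x' - x) * w2 f (x',y,k) * w3 f (x,y,k))"
      by (subst sum.reindex) (auto simp: inj_on_def row_sign_def)
    finally show ?thesis .
  qed
  then show ?thesis
    unfolding twist_form_def row_form_def
      sum_cylinder[OF D Y, of "\<lambda>p. \<Sum>q\<in>cylinder D N. row_sign p q * w2 f q * w3 f p"]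
    by (intro sum.cong refl)
qed

text \<open>
  The terms in the first two sums depend on the position \<open>x\<close> but not on the height \<open>k\<close>.  So
  the two cubes of a vertical domino contribute the same to them.
\<close>

lemma row_form_mod_4:
  fixes y k :: int
  assumes D: "finite D" and f: "field_on (cylinder D N) f" and k: "k \<in> {0..<int N}"
  defines "X \<equiv> {x. (x,y) \<in> D}" and "c \<equiv> \<lambda>v. int (card {x. f (x,y,k) = v})"
  shows "4 dvd row_form D f y k -
    ((\<Sum>x\<in>{x. f (x,y,k) = (0,0,1)}. \<Sum>x'\<in>X. sgn (x' - x) * (-1) ^ nat \<bar>x - x'\<bar>)
     + (\<Sum>x\<in>{x. f (x,y,k) = (0,0,-1)}. \<Sum>x'\<in>X. sgn (x' - x) * (-1) ^ nat \<bar>x - x'\<bar>)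
     + 2 * (c (0,-1,0) * c (0,0,1) + c (0,1,0) * c (0,0,-1)))"
proof -
  have fX: "finite X" unfolding X_def
    by (rule finite_subset[of _ "fst ` D"]) (use D in force)+
  define F where "F x = f (x,y,k)" for x
  define o2 where "o2 x = fst (snd (F x))" for x
  define o3 where "o3 x = snd (snd (F x))" for x
  define e where "e x = eps (x,y,k)" for x
  define m where "m x = x + fst (F x)" for x
  have XR: "x \<in> X \<longleftrightarrow> (x,y,k) \<in> cylinder D N" for x using k by (simp add: X_def mem_cylinder)
  have st: "F x \<in> steps" if "x \<in> X" for x using field_onD(1)[OF f] that by (simp add: XR F_def)
  have nX: "F x = 0" if "x \<notin> X" for x using field_onD(4)[OF f] that by (simp add: XR F_def)
  have setX: "{x. F x = v} = {x\<in>X. F x = v}" if "v \<in> steps" for v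
    using nX that zero_notin_steps by (metis (mono_tags, lifting))
  have o: "(o2 x, o3 x) \<in> {(0,0), (1,0), (-1,0), (0,1), (0,-1)}" if "x \<in> X" for x
    using st[OF that] by (auto simp: o2_def o3_def steps_eq)
  have e1: "e x \<in> {1, -1}" for x by (auto simp: e_def eps_def)
  have m1: "m x \<in> X \<and> o2 (m x) = 0 \<and> o3 (m x) = 0 \<and> m (m x) = x \<and> e (m x) = - e x \<and> \<bar>m x - x\<bar> = 1"
    if x: "x \<in> X" "o2 x = 0" "o3 x = 0" for x
  proof -
    obtain a where a: "F x = (a,0,0)" "a \<in> {1,-1}" using st[OF x(1)] x(2,3) by (auto simp: o2_def o3_def steps_eq)
    have mx: "(x,y,k) + F x = (m x,y,k)" using a by (simp add: m_def)
    have R: "(x,y,k) \<in> cylinder D N" using x(1) XR by simp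
    have "m x \<in> X" using field_onD(2)[OF f R] mx XR by (simp add: F_def)
    moreover have Fm: "F (m x) = (-a,0,0)" using field_onD(3)[OF f R] mx a by (simp add: F_def)
    moreover have "e (m x) = - e x" using eps_add_step[OF st[OF x(1)], of "(x,y,k)"] mx by (simp add: e_def)
    ultimately show ?thesis using a by (auto simp: m_def o2_def o3_def)
  qed
  have s2: "{x\<in>X. o2 x = 1} = {x. F x = (0,1,0)}" "{x\<in>X. o2 x = -1} = {x. F x = (0,-1,0)}"
    and s3: "{x\<in>X. o3 x = 1} = {x. F x = (0,0,1)}" "{x\<in>X. o3 x = -1} = {x. F x = (0,0,-1)}"
    using st setX[of "(0,1,0)"] setX[of "(0,-1,0)"] setX[of "(0,0,1)"] setX[of "(0,0,-1)"]
    by (force simp: o2_def o3_def steps_eq)+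
  have Z: "{x\<in>X. o3 x \<noteq> 0} = {x. F x = (0,0,1)} \<union> {x. F x = (0,0,-1)}"
  proof -
    have "{x\<in>X. o3 x \<noteq> 0} = {x\<in>X. o3 x = 1} \<union> {x\<in>X. o3 x = -1}" using o by force
    then show ?thesis unfolding s3 .
  qed
  have ee: "e x * e x' = (-1) ^ nat \<bar>x - x'\<bar>" for x x'
    by (cases "even (x - x')") (auto simp: e_def eps_def black_def even_nat_iff)
  have fin: "finite {x. F x = (0,0,1)}" "finite {x. F x = (0,0,-1)}"
    using fX unfolding s3[symmetric] by simp_all
  have RF: "row_form D f y k = (\<Sum>x\<in>X. \<Sum>x'\<in>X. sgn (x' - x) * (e x' * o2 x') * (e x * o3 x))"
    unfolding row_form_def X_def[symmetric] by (simp add: w2_def w3_def e_def o2_def o3_def F_def mult.assoc)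
  have ZZ: "(\<Sum>x\<in>{x\<in>X. o3 x \<noteq> 0}. \<Sum>x'\<in>X. sgn (x' - x) * (e x * e x'))
    = (\<Sum>x\<in>{x. F x = (0,0,1)}. \<Sum>x'\<in>X. sgn (x' - x) * (-1) ^ nat \<bar>x - x'\<bar>)
     + (\<Sum>x\<in>{x. F x = (0,0,-1)}. \<Sum>x'\<in>X. sgn (x' - x) * (-1) ^ nat \<bar>x - x'\<bar>)"
    unfolding Z ee using fin by (intro sum.union_disjoint) auto
  have "4 dvd (\<Sum>x\<in>X. \<Sum>x'\<in>X. sgn (x' - x) * (e x' * o2 x') * (e x * o3 x))
     - ((\<Sum>x\<in>{x\<in>X. o3 x \<noteq> 0}. \<Sum>x'\<in>X. sgn (x' - x) * (e x * e x'))
     + 2 * (int (card {x\<in>X. o2 x = -1}) * int (card {x\<in>X. o3 x = 1})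
          + int (card {x\<in>X. o2 x = 1}) * int (card {x\<in>X. o3 x = -1})))"
    by (rule row_mod_4[where m = m]) (use fX o e1 m1 in blast)+
  then show ?thesis
    unfolding RF ZZ s2 s3 c_def F_def .
qed

lemma card_slices:
  fixes P :: "square \<Rightarrow> bool" and y :: int
  assumes "finite {s. P s}"
  shows "int (card {s. P s \<and> snd s \<le> y}) = int (card {s. P s \<and> snd s \<le> y - 1}) + int (card {x. P (x, y)})"
proof -
  have fin: "finite {s. P s \<and> Q s}" for Q by (rule finite_subset[OF _ assms]) auto
  have U: "{s. P s \<and> snd s \<le> y} = {s. P s \<and> snd s \<le> y - 1} \<union> (\<lambda>x. (x, y)) ` {x. P (x, y)}"
    by force
  have C: "card ((\<lambda>x. (x, y)) ` {x. P (x, y)}) = card {x. P (x, y)}"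
    by (rule card_image) (simp add: inj_on_def)
  have F: "finite ((\<lambda>x. (x, y)) ` {x. P (x, y)})"
    by (rule finite_subset[OF _ assms]) auto
  have dj: "{s. P s \<and> snd s \<le> y - 1} \<inter> (\<lambda>x. (x, y)) ` {x. P (x, y)} = {}" by auto
  show ?thesis unfolding U using card_Un_disjoint[OF fin F dj] C by simp
qed

lemma even_card_if_odd_sum_zero:
  fixes g :: "'a \<Rightarrow> int"
  assumes "finite S" "\<And>s. s \<in> S \<Longrightarrow> odd (g s)" "sum g S = 0"
  shows "even (card S)"
proof -
  have "even (sum g S) \<longleftrightarrow> even (card {s\<in>S. odd (g s)})" by (rule even_sum_iff[OF assms(1)])
  moreover have "{s\<in>S. odd (g s)} = S" using assms(2) by auto
  ultimately show ?thesis using assms(3) by simp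
qed

lemma even_combine:
  fixes p :: int
  shows "even (p - x) \<Longrightarrow> even (e - (g1 + g2 + g3 + l1 + l2)) \<Longrightarrow> even (p + e - (x + g1 + g2 + g3 + l1 + l2))"
  by presburger

text \<open>
  Let \<open>a y k\<close> be the number of vertical dominoes in the vertical strip \<open>y\<close> that start at
  height \<open>k\<close>, and \<open>b y k\<close> the number of dominoes from strip \<open>y\<close> to strip
  \<open>y + 1\<close> at height \<open>k\<close>.  By \<open>row_form_mod_4\<close>, the form is modulo 4 twice the sum of
  \<open>(n - 1) * a y k\<close>, where \<open>n\<close> is the number of squares in row \<open>y\<close>, and of terms
  which are products of neighbouring values of \<open>a\<close> and \<open>b\<close>.  It remains to show that this
  sum is even.

  Modulo 2, the numbers \<open>a\<close> and \<open>b\<close> are the edge weights of a planar grid whose degrees are the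
  parities of the row lengths.  The number \<open>h y k\<close> of vertical dominoes that start at height
  \<open>k\<close> in the strips up to \<open>y\<close> serves as a height function: \<open>a\<close> is a difference of
  \<open>h\<close> (\<open>a_diff\<close>), and \<open>b\<close> is a sum of two values of \<open>h\<close> and a term that depends
  only on \<open>y\<close> (\<open>b_eq\<close>).  In these terms the sum telescopes.  The boundary terms are even,
  since the number of vertical dominoes that cross from one floor to the next is even (\<open>h_high\<close>).
\<close>

theorem twist_form_div_4:
  assumes D: "finite D" and ev: "even (card D)" and f: "field_on (cylinder D N) f"
  shows "4 dvd twist_form (cylinder D N) f"
proof -
  define a where "a y k = int (card {x. f (x,y,k) = (0,0,1)})" for y k
  define b where "b y k = int (card {x. f (x,y,k) = (0,1,0)})" for y k
  define h where "h y k = int (card {s. f (fst s,snd s,k) = (0,0,1) \<and> snd s \<le> y})" for y k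
  define L where "L y = int (card {s. s \<in> D \<and> snd s \<le> y})" for y
  let ?X = "\<lambda>y. {x. (x,y) \<in> D}"
  have fX: "finite (?X y)" for y
    by (rule finite_subset[of _ "fst ` D"]) (use D in force)+
  have nzD: "s \<in> D \<and> 0 \<le> k \<and> k < int N" if "f (fst s, snd s, k) \<noteq> 0" for s k
    using field_onD(4)[OF f, of "(fst s, snd s, k)"] that by (auto simp: mem_cylinder)
  have fin: "finite {s. f (fst s, snd s, k) = v}" if "v \<noteq> 0" for k v
    by (rule finite_subset[OF _ D]) (use nzD that in blast)
  have down: "{x. f (x,y,k) = (0,0,-1)} = {x. f (x,y,k-1) = (0,0,1)}" for y k
    using field_neighbour[OF f, of "(0,0,1)" "(x,y,k-1)" for x] by (auto simp: zero_prod_def)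
  have left: "{x. f (x,y,k) = (0,-1,0)} = {x. f (x,y-1,k) = (0,1,0)}" for y k
    using field_neighbour[OF f, of "(0,1,0)" "(x,y-1,k)" for x] by (auto simp: zero_prod_def)
  have a_diff: "a y k = h y k - h (y - 1) k" for y k
    using card_slices[OF fin[of "(0,0,1)" k], of y] by (simp add: a_def h_def zero_prod_def)
  have L_diff: "int (card (?X y)) = L y - L (y - 1)" for y
    using card_slices[of "\<lambda>s. s \<in> D" y] D by (simp add: L_def)
  have a_end: "a y k = 0" "h y k = 0" if "k = -1 \<or> k = int N - 1" for y k
  proof -
    have "f (x,y,k) \<noteq> (0,0,1)" for x y
    proof
      assume e: "f (x,y,k) = (0,0,1)"
      then have "(x,y,k) \<in> cylinder D N" using field_onD(4)[OF f, of "(x,y,k)"] by (auto simp: zero_prod_def)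
      then have "(x,y,k) + f (x,y,k) \<in> cylinder D N" "k \<ge> 0" using field_onD(2)[OF f] by (auto simp: mem_cylinder)
      with e that show False by (auto simp: mem_cylinder)
    qed
    then show "a y k = 0" "h y k = 0" by (simp_all add: a_def h_def)
  qed
  (* Room on both sides of the disk, so that the boundary terms of the sums over y are 0 or even. *)
  obtain m :: int where m: "\<And>s. s \<in> D \<Longrightarrow> - m < snd s \<and> snd s < m" "m > 0"
  proof -
    have "finite ((\<lambda>s. \<bar>snd s\<bar>) ` D)" using D by simp
    then obtain B where "\<And>s. s \<in> D \<Longrightarrow> \<bar>snd s\<bar> \<le> B" by (meson bdd_above.E bdd_above_finite image_eqI)
    then have "\<And>s. s \<in> D \<Longrightarrow> - (max B 0 + 1) < snd s \<and> snd s < max B 0 + 1" by (force simp: abs_le_iff)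
    then show thesis using that[of "max B 0 + 1"] by force
  qed
  have h_low: "h y k = 0" if "y \<le> - m" for y k
  proof -
    have "{s. f (fst s,snd s,k) = (0,0,1) \<and> snd s \<le> y} = {}"
    proof (intro equals0I)
      fix s assume "s \<in> {s. f (fst s,snd s,k) = (0,0,1) \<and> snd s \<le> y}"
      then show False using nzD[of s k] m(1)[of s] that by (simp add: zero_prod_def)
    qed
    then show ?thesis unfolding h_def by (simp only: card.empty)
  qed
  have L_high: "L y = int (card D)" if "y \<ge> m" for y
  proof -
    have "{s. s \<in> D \<and> snd s \<le> y} = D"
    proof (intro equalityI subsetI)
      fix s assume "s \<in> D"
      then show "s \<in> {s. s \<in> D \<and> snd s \<le> y}" using m(1)[of s] that by simp
    qed simp
    then show ?thesis by (simp add: L_def)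
  qed
  have b_high: "b y k = 0" if "y \<ge> m" for y k
  proof -
    have "{x. f (x,y,k) = (0,1,0)} = {}"
    proof (intro equals0I)
      fix x assume "x \<in> {x. f (x,y,k) = (0,1,0)}"
      then show False using nzD[of "(x,y)" k] m(1)[of "(x,y)"] that by (simp add: zero_prod_def)
    qed
    then show ?thesis by (simp add: b_def)
  qed
  (* Count the squares of floor k in the strips up to y by their type.  Those with
     a horizontal domino within these strips come in pairs. *)
  have b_eq: "even (b y k + h y k + h y (k - 1) + L y)" if k: "0 \<le> k" "k < int N" for y k
  proof -
    define S where "S = {s. s \<in> D \<and> snd s \<le> y}"
    define g where "g s = f (fst s, snd s, k)" for s
    define U where "U = {s. g s = (0,0,1) \<and> snd s \<le> y}"
    define V where "V = {s. g s = (0,0,-1) \<and> snd s \<le> y}"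
    define W where "W = (\<lambda>x. (x, y)) ` {x. g (x, y) = (0,1,0)}"
    define T where "T = {s \<in> S. snd (snd (g s)) = 0 \<and> s \<notin> W}"
    have R: "(fst s, snd s, k) \<in> cylinder D N \<longleftrightarrow> s \<in> D" for s
      using k by (simp add: mem_cylinder)
    have gst: "g s \<in> steps" if "s \<in> D" for s
      using field_onD(1)[OF f, of "(fst s, snd s, k)"] that R by (simp add: g_def)
    have gD: "s \<in> D" if "g s \<noteq> 0" for s using nzD that by (auto simp: g_def)
    have fS: "finite S" using D by (simp add: S_def)
    have UVW: "U \<subseteq> S" "V \<subseteq> S" "W \<subseteq> S"
      using gD by (auto simp: U_def V_def W_def S_def zero_prod_def)
    have dj: "U \<inter> V = {}" "(U \<union> V) \<inter> W = {}" "(U \<union> V \<union> W) \<inter> T = {}"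
      by (auto simp: U_def V_def W_def T_def)
    have cover: "S = U \<union> V \<union> W \<union> T"
    proof
      show "S \<subseteq> U \<union> V \<union> W \<union> T"
      proof
        fix s assume s: "s \<in> S"
        then have "g s \<in> steps" using gst by (simp add: S_def)
        then show "s \<in> U \<union> V \<union> W \<union> T" using s by (auto simp: U_def V_def T_def S_def steps_eq)
      qed
      show "U \<union> V \<union> W \<union> T \<subseteq> S" using UVW by (auto simp: T_def)
    qed
    have fT: "finite U" "finite V" "finite W" "finite T"
      using fS UVW by (auto simp: T_def intro: finite_subset)
    have "card S = card U + card V + card W + card T"
      unfolding cover using fT dj by (simp add: card_Un_disjoint)
    moreover have "even (card T)"
    proof (rule even_card_if_odd_sum_zero[where g = "\<lambda>s. eps (fst s, snd s, k)"])
      show "finite T" by (rule fT(4))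
      show "odd (eps (fst s, snd s, k))" for s by (simp add: eps_def)
      show "(\<Sum>s\<in>T. eps (fst s, snd s, k)) = 0"
      proof (rule sum_involution_zero[where h = "\<lambda>s. (fst s + fst (g s), snd s + fst (snd (g s)))"])
        show "finite T" by (rule fT(4))
        fix s assume s: "s \<in> T"
        let ?s = "(fst s + fst (g s), snd s + fst (snd (g s)))"
        obtain x y' where xy: "s = (x, y')" by (cases s)
        have sD: "s \<in> D" "y' \<le> y" "s \<notin> W" using s xy by (auto simp: T_def S_def)
        obtain v w where vw: "g s = (v,w,0)" using s by (cases "g s") (auto simp: T_def)
        have st: "(v,w,0) \<in> steps" using gst[OF sD(1)] vw by simp
        have p: "(fst s, snd s, k) + g s = (fst ?s, snd ?s, k)" by (simp add: vw)
        have sR: "(fst s, snd s, k) \<in> cylinder D N" using R sD(1) by simp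
        have "?s \<in> D" using field_onD(2)[OF f sR] p R[of ?s] by (simp add: g_def)
        moreover have gs: "g ?s = (-v,-w,0)" using field_onD(3)[OF f sR] p vw by (simp add: g_def)
        moreover have "\<not> (g (x, y') = (0,1,0) \<and> y' = y)" using sD(3) xy by (auto simp: W_def)
        then have "snd ?s \<le> y"
          using st sD(2) xy vw by (auto simp: steps_eq)
        moreover have "?s \<notin> W"
        proof
          assume "?s \<in> W"
          then have "g ?s = (0,1,0)" "snd ?s = y" by (auto simp: W_def)
          then show False using gs xy sD(2) vw by simp
        qed
        ultimately have "?s \<in> T" by (simp add: T_def S_def)
        moreover have "eps (fst ?s, snd ?s, k) = - eps (fst s, snd s, k)"
          using eps_add_step[OF gst[OF sD(1)], of "(fst s, snd s, k)"] p by simp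
        ultimately show "?s \<in> T \<and> (fst ?s + fst (g ?s), snd ?s + fst (snd (g ?s))) = s \<and>
            eps (fst ?s, snd ?s, k) = - eps (fst s, snd s, k)"
          using gs xy vw by simp
      qed
    qed
    moreover have "int (card W) = b y k"
      unfolding W_def b_def g_def by (subst card_image) (auto simp: inj_on_def)
    moreover have "int (card U) = h y k" by (simp add: U_def h_def g_def)
    moreover have "int (card V) = h y (k - 1)"
    proof -
      have "g s = (0,0,-1) \<longleftrightarrow> f (fst s, snd s, k - 1) = (0,0,1)" for s
        using down[of "snd s" k] unfolding g_def by blast
      then show ?thesis by (simp add: V_def h_def)
    qed
    moreover have "int (card S) = L y" by (simp add: S_def L_def)
    ultimately show ?thesis by presburger
  qed
  have h_high: "even (h y k)" if "y \<ge> m" "-1 \<le> k" "k < int N" for y k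
    using that(2,3)
  proof (induction k rule: int_ge_induct)
    case base
    then show ?case by (simp add: a_end)
  next
    case (step i)
    then show ?case
      using b_eq[of "i + 1" y] L_high[OF that(1)] b_high[OF that(1)] ev by simp
  qed
  define \<rho> where "\<rho> y x = (\<Sum>x'\<in>?X y. sgn (x' - x) * (-1) ^ nat \<bar>x - x'\<bar>)" for y x :: int
  define P where "P y k = (\<Sum>x\<in>{x. f (x,y,k) = (0,0,1)}. \<rho> y x)" for y k
  let ?Y = "{-m..<m + 1}" and ?K = "{0..<int N}"
  have Y: "snd ` D \<subseteq> ?Y" using m(1) by force
  have shift: "(\<Sum>k\<in>?K. F (k - 1)) = (\<Sum>k\<in>?K. F k)" if "F (-1) = 0" "F (int N - 1) = 0" for F :: "int \<Rightarrow> int"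
    using sum_telescope_int[of 0 "int N" F] that by (simp add: sum_subtractf)
  define E where "E y k = b (y - 1) k * a y k + b y k * a y (k - 1)" for y k
  have "4 dvd twist_form (cylinder D N) f - (\<Sum>y\<in>?Y. \<Sum>k\<in>?K. P y k + P y (k - 1) + 2 * E y k)"
    unfolding twist_form_rows[OF D Y finite_atLeastLessThan_int] sum_subtractf[symmetric]
  proof (intro dvd_sum)
    fix y k assume "k \<in> ?K"
    from row_form_mod_4[OF D f this, of y]
    show "4 dvd row_form D f y k - (P y k + P y (k - 1) + 2 * E y k)"
      unfolding down left P_def \<rho>_def E_def a_def b_def .
  qed
  moreover have "(\<Sum>y\<in>?Y. \<Sum>k\<in>?K. P y k + P y (k - 1) + 2 * E y k)
      = 2 * (\<Sum>y\<in>?Y. \<Sum>k\<in>?K. P y k + E y k)"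
  proof -
    have "(\<Sum>k\<in>?K. P y (k - 1)) = (\<Sum>k\<in>?K. P y k)" for y
    proof (rule shift)
      have "{x. f (x,y,k) = (0,0,1)} = {}" if "k = -1 \<or> k = int N - 1" for k
      proof -
        have "finite {x. f (x,y,k) = (0,0,1)}"
          by (rule finite_subset[OF _ fX[of y]]) (use nzD[of "(x,y)" k for x] in \<open>auto simp: zero_prod_def\<close>)
        then show ?thesis using a_end(1)[OF that, of y] by (simp add: a_def)
      qed
      then show "P y (-1) = 0" "P y (int N - 1) = 0" by (simp_all add: P_def)
    qed
    then show ?thesis by (simp add: sum.distrib sum_distrib_left)
  qed
  moreover have "even (\<Sum>y\<in>?Y. \<Sum>k\<in>?K. P y k + E y k)"
  proof -
    define G where "G y k = h y k * h y (k - 1)" for y k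
    have 1: "even (P y k + E y k - (a y k * (L y - L (y - 1) - 1) + (G y k - G (y - 1) k)
        + (h (y - 1) k * h y k - h (y - 1) k * h (y - 1) k)
        + (h y (k - 1) * h y (k - 1) - h y (k - 1) * h (y - 1) (k - 1))
        + L (y - 1) * a y k + L y * a y (k - 1)))"
      if "k \<in> ?K" for y k
    proof -
      have "even (P y k - a y k * (L y - L (y - 1) - 1))"
      proof -
        have "even (\<rho> y x - (int (card (?X y)) - 1))" if "x \<in> ?X y" for x
        proof -
          have "\<rho> y x = (\<Sum>x'\<in>?X y - {x}. sgn (x' - x) * (-1) ^ nat \<bar>x - x'\<bar>)"
            unfolding \<rho>_def using fX that by (simp add: sum.remove)
          moreover have "even \<dots> \<longleftrightarrow> even (card {x' \<in> ?X y - {x}. odd (sgn (x' - x) * (-1) ^ nat \<bar>x - x'\<bar>)})"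
            using fX by (intro even_sum_iff) auto
          moreover have "{x' \<in> ?X y - {x}. odd (sgn (x' - x) * (-1) ^ nat \<bar>x - x'\<bar>)} = ?X y - {x}"
            by (auto simp: sgn_if)
          moreover have "int (card (?X y - {x})) = int (card (?X y)) - 1"
            using fX[of y] that by (metis card_Suc_Diff1 of_nat_Suc add_diff_cancel_left')
          ultimately have "even (\<rho> y x) \<longleftrightarrow> even (card (?X y - {x}))"
            and "int (card (?X y - {x})) = int (card (?X y)) - 1" by (simp_all only:)
          then show ?thesis by presburger
        qed
        then have "even (\<Sum>x\<in>{x. f (x,y,k) = (0,0,1)}. \<rho> y x - (int (card (?X y)) - 1))"
          using nzD[of "(x,y)" k for x] by (intro dvd_sum) (auto simp: zero_prod_def)
        then show ?thesis unfolding L_diff[symmetric]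
          by (simp add: P_def a_def sum_subtractf)
      qed
      moreover have "even (E y k - ((G y k - G (y - 1) k)
        + (h (y - 1) k * h y k - h (y - 1) k * h (y - 1) k)
        + (h y (k - 1) * h y (k - 1) - h y (k - 1) * h (y - 1) (k - 1))
        + L (y - 1) * a y k + L y * a y (k - 1)))"
      proof -
        have "even (b y k + h y k + h y (k - 1) + L y)" "even (b (y - 1) k + h (y - 1) k + h (y - 1) (k - 1) + L (y - 1))"
          using b_eq that by auto
        then obtain c c' where c: "b y k + h y k + h y (k - 1) + L y = 2 * c"
            "b (y - 1) k + h (y - 1) k + h (y - 1) (k - 1) + L (y - 1) = 2 * c'" by (elim evenE)
        then have b: "b y k = 2 * c - h y k - h y (k - 1) - L y"
            "b (y - 1) k = 2 * c' - h (y - 1) k - h (y - 1) (k - 1) - L (y - 1)" by simp_all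
        have "E y k - ((G y k - G (y - 1) k)
        + (h (y - 1) k * h y k - h (y - 1) k * h (y - 1) k)
        + (h y (k - 1) * h y (k - 1) - h y (k - 1) * h (y - 1) (k - 1))
        + L (y - 1) * a y k + L y * a y (k - 1))
          = 2 * (c' * a y k + c * a y (k - 1) - h (y - 1) k * h y k + h (y - 1) k * h (y - 1) k
              + h (y - 1) (k - 1) * h (y - 1) k - h y k * h y (k - 1) - h y (k - 1) * h y (k - 1)
              + h y (k - 1) * h (y - 1) (k - 1) - L (y - 1) * a y k - L y * a y (k - 1))"
          unfolding E_def G_def b a_diff by (simp add: algebra_simps)
        then show ?thesis by (simp only: dvd_triv_left)
      qed
      ultimately show ?thesis by (rule even_combine)
    qed
    then have sub: "even (\<Sum>y\<in>?Y. \<Sum>k\<in>?K. P y k + E y k - (a y k * (L y - L (y - 1) - 1) + (G y k - G (y - 1) k)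
        + (h (y - 1) k * h y k - h (y - 1) k * h (y - 1) k)
        + (h y (k - 1) * h y (k - 1) - h y (k - 1) * h (y - 1) (k - 1))
        + L (y - 1) * a y k + L y * a y (k - 1)))"
      by (intro dvd_sum)
    have main: "even (\<Sum>y\<in>?Y. \<Sum>k\<in>?K. a y k * (L y - L (y - 1) - 1) + (G y k - G (y - 1) k)
        + (h (y - 1) k * h y k - h (y - 1) k * h (y - 1) k)
        + (h y (k - 1) * h y (k - 1) - h y (k - 1) * h (y - 1) (k - 1))
        + L (y - 1) * a y k + L y * a y (k - 1))" (is "even ?S")
    proof -
      (* Shifting k by one turns the terms at height k - 1 into terms at height k; afterwards
         all terms are even or telescope in y. *)
      have s1: "(\<Sum>k\<in>?K. h y (k - 1) * h y (k - 1) - h y (k - 1) * h (y - 1) (k - 1))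
         = (\<Sum>k\<in>?K. h y k * h y k - h y k * h (y - 1) k)" for y
        by (rule shift) (simp_all add: a_end)
      have s2: "(\<Sum>k\<in>?K. L y * a y (k - 1)) = (\<Sum>k\<in>?K. L y * a y k)" for y
        by (rule shift) (simp_all add: a_end)
      have "?S = (\<Sum>y\<in>?Y. \<Sum>k\<in>?K. (G y k - G (y - 1) k) + (h y k * h y k - h (y - 1) k * h (y - 1) k)
          + (h y k - h (y - 1) k) + 2 * ((L y - 1) * a y k))"
        unfolding sum.distrib s1 s2 unfolding sum.distrib[symmetric]
        by (intro sum.cong refl) (simp add: a_diff algebra_simps)
      also have "\<dots> = (\<Sum>k\<in>?K. \<Sum>y\<in>?Y. (G y k - G (y - 1) k) + (h y k * h y k - h (y - 1) k * h (y - 1) k)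
          + (h y k - h (y - 1) k) + 2 * ((L y - 1) * a y k))"
        by (rule sum.swap)
      also have "even \<dots>"
      proof (rule dvd_sum)
        fix k assume k: "k \<in> ?K"
        have T: "(\<Sum>y\<in>?Y. F y - F (y - 1)) = F m - F (- m - 1)" for F :: "int \<Rightarrow> int"
          using sum_telescope_int[of "-m" "m + 1" F] m(2) by simp
        have "even (h m k)" using h_high[of m k] k by simp
        moreover have "h (- m - 1) k = 0" by (rule h_low) simp
        ultimately show "even (\<Sum>y\<in>?Y. (G y k - G (y - 1) k) + (h y k * h y k - h (y - 1) k * h (y - 1) k)
          + (h y k - h (y - 1) k) + 2 * ((L y - 1) * a y k))"
          unfolding sum.distrib T[of "\<lambda>y. G y k"] T[of "\<lambda>y. h y k * h y k"] T[of "\<lambda>y. h y k"]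
            sum_distrib_left[symmetric]
          by (simp add: G_def)
      qed
      finally show ?thesis .
    qed
    show ?thesis using dvd_add[OF sub main] unfolding sum.distrib[symmetric] by simp
  qed
  ultimately show ?thesis by presburger
qed

lemma balanced_even_card:
  assumes "finite D" "balanced D"
  shows "even (card D)"
proof -
  let ?A = "{(i, j) \<in> D. even (i + j)}" and ?B = "{(i, j) \<in> D. odd (i + j)}"
  have U: "D = ?A \<union> ?B" by blast
  have I: "?A \<inter> ?B = {}" by blast
  have F: "finite ?A" "finite ?B" by (rule finite_subset[OF _ assms(1)], blast)+
  have "card (?A \<union> ?B) = card ?A + card ?B" by (rule card_Un_disjoint[OF F I])
  then have "card D = card ?A + card ?B" unfolding U[symmetric] .
  then show ?thesis using assms(2) by (simp add: balanced_def)
qed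

theorem twist_Ints:
  assumes D: "finite D" "even (card D)" and U: "U \<in> horizontals" and t: "t \<in> tilings D N"
  shows "twist (corner U) t \<in> \<int>"
proof -
  have card: "card (std_disk U D) = card D"
    by (simp add: std_disk_def card_image)
  have t': "std_tiling U t \<in> tilings_of (cylinder (std_disk U D) N)"
    using std_tiling_tilings[OF t, of U] by (simp add: tilings_def)
  have "4 dvd twist_form (cylinder (std_disk U D) N) (dir (std_tiling U t))"
    by (rule twist_form_div_4[OF finite_std_disk[OF D(1)] _ field_dir[OF t']]) (simp add: card D(2))
  then obtain n where "twist_form (cylinder (std_disk U D) N) (dir (std_tiling U t)) = 4 * n" by blast
  then have "twist (corner (1,0,0)) (std_tiling U t) = of_int n"
    using twist_e1[OF t' finite_cylinder[OF finite_std_disk[OF D(1)]]] by simp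
  then show ?thesis by (simp add: twist_std[OF D(1) U t])
qed

section \<open>Tilings as walks through floors\<close>

fun walk :: "'e set \<Rightarrow> ('e \<Rightarrow> 'v) \<Rightarrow> ('e \<Rightarrow> 'v) \<Rightarrow> 'v \<Rightarrow> 'e list \<Rightarrow> 'v \<Rightarrow> bool" where
  "walk E src tgt v [] w \<longleftrightarrow> v = w"
| "walk E src tgt v (e # es) w \<longleftrightarrow> e \<in> E \<and> src e = v \<and> walk E src tgt (tgt e) es w"

lemma walk_append:
  "walk E src tgt v (xs @ ys) w \<longleftrightarrow> (\<exists>u. walk E src tgt v xs u \<and> walk E src tgt u ys w)"
  by (induction xs arbitrary: v) auto

lemma walk_set: "walk E src tgt v es w \<Longrightarrow> set es \<subseteq> E"
  by (induction es arbitrary: v) auto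

lemma walk_nth:
  "walk E src tgt v es w \<longleftrightarrow>
     (if es = [] then v = w else src (hd es) = v \<and> tgt (last es) = w) \<and> (\<forall>i<length es. es ! i \<in> E) \<and>
     (\<forall>i. Suc i < length es \<longrightarrow> tgt (es ! i) = src (es ! Suc i))"
proof (induction es arbitrary: v)
  case (Cons e es)
  show ?case
  proof (cases es)
    case Nil
    then show ?thesis by auto
  next
    case (Cons e' es')
    have "(\<forall>i<length (e # es). (e # es) ! i \<in> E) \<longleftrightarrow> e \<in> E \<and> (\<forall>i<length es. es ! i \<in> E)"
      by (simp add: All_less_Suc2)
    moreover have "(\<forall>i. Suc i < length (e # es) \<longrightarrow> tgt ((e # es) ! i) = src ((e # es) ! Suc i))
       \<longleftrightarrow> tgt e = src (es ! 0) \<and> (\<forall>i. Suc i < length es \<longrightarrow> tgt (es ! i) = src (es ! Suc i))"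
      using Cons by (auto simp: nth_Cons split: nat.splits)
    ultimately show ?thesis unfolding walk.simps Cons.IH using Cons by (auto simp: hd_conv_nth)
  qed
qed simp

type_synonym floor = "square \<Rightarrow> cube"

text \<open>
  The direction field of a single floor.  Squares with a horizontal step are matched within the floor;
  squares with a vertical step are left to be matched with the neighbouring floors.
\<close>

definition floor_on :: "square set \<Rightarrow> floor \<Rightarrow> bool" where
  "floor_on D g \<longleftrightarrow>
     (\<forall>s\<in>D. g s \<in> steps \<and>
        (snd (snd (g s)) = 0 \<longrightarrow>
           (fst s + fst (g s), snd s + fst (snd (g s))) \<in> D \<and>
           g (fst s + fst (g s), snd s + fst (snd (g s))) = - g s)) \<and>
     (\<forall>s. s \<notin> D \<longrightarrow> g s = 0)"

definition lower_plug :: "floor \<Rightarrow> square set" where "lower_plug g = {s. g s = (0,0,-1)}"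
definition upper_plug :: "floor \<Rightarrow> square set" where "upper_plug g = {s. g s = (0,0,1)}"

abbreviation floor_walk :: "square set \<Rightarrow> square set \<Rightarrow> floor list \<Rightarrow> square set \<Rightarrow> bool" where
  "floor_walk D \<equiv> walk (Collect (floor_on D)) lower_plug upper_plug"

definition field_floors :: "nat \<Rightarrow> (cube \<Rightarrow> cube) \<Rightarrow> floor list" where
  "field_floors N f = map (\<lambda>k s. f (fst s, snd s, int k)) [0..<N]"

definition floors_field :: "floor list \<Rightarrow> cube \<Rightarrow> cube" where
  "floors_field gs = (\<lambda>(x, y, k). if 0 \<le> k \<and> k < int (length gs) then (gs ! nat k) (x, y) else 0)"

lemma length_field_floors [simp]: "length (field_floors N f) = N"
  by (simp add: field_floors_def)

lemma nth_field_floors: "k < N \<Longrightarrow> field_floors N f ! k = (\<lambda>s. f (fst s, snd s, int k))"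
  by (simp add: field_floors_def)

lemma field_floors_floors_field: "field_floors (length gs) (floors_field gs) = gs"
  by (rule nth_equalityI) (auto simp: nth_field_floors floors_field_def)

lemma floors_field_field_floors:
  assumes f: "field_on (cylinder D N) f"
  shows "floors_field (field_floors N f) = f"
proof
  fix p :: cube
  obtain x y k where p: "p = (x,y,k)" by (cases p)
  show "floors_field (field_floors N f) p = f p"
  proof (cases "0 \<le> k \<and> k < int N")
    case True
    then have "nat k < N" by linarith
    then show ?thesis using True by (simp add: p floors_field_def nth_field_floors)
  next
    case False
    then have "p \<notin> cylinder D N" by (auto simp: p mem_cylinder)
    then show ?thesis using False field_onD(4)[OF f] by (auto simp: p floors_field_def)
  qed
qed

lemma field_floors_walk:
  assumes f: "field_on (cylinder D N) f"
  shows "floor_walk D {} (field_floors N f) {}"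
  unfolding walk_nth
proof (intro conjI allI impI)
  note F = field_onD[OF f]
  show "if field_floors N f = [] then {} = {} else lower_plug (hd (field_floors N f)) = {} \<and> upper_plug (last (field_floors N f)) = {}"
  proof (cases "N = 0")
    case True
    then show ?thesis by (simp add: field_floors_def)
  next
    case False
    then have ne: "field_floors N f \<noteq> []" by (simp add: field_floors_def)
    have "f (x,y,0) \<noteq> (0,0,-1)" for x y
    proof
      assume e: "f (x,y,0) = (0,0,-1)"
      then have "(x,y,0) \<in> cylinder D N" using F(4)[of "(x,y,0)"] by (auto simp: zero_prod_def)
      from F(2)[OF this] show False by (simp add: e mem_cylinder)
    qed
    moreover have "f (x,y,int N - 1) \<noteq> (0,0,1)" for x y
    proof
      assume e: "f (x,y,int N - 1) = (0,0,1)"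
      then have "(x,y,int N - 1) \<in> cylinder D N" using F(4)[of "(x,y,int N - 1)"] by (auto simp: zero_prod_def)
      from F(2)[OF this] show False by (simp add: e mem_cylinder)
    qed
    ultimately show ?thesis
      using False ne by (simp add: hd_conv_nth last_conv_nth nth_field_floors lower_plug_def upper_plug_def of_nat_diff)
  qed
next
  fix i assume "i < length (field_floors N f)"
  then have i: "i < N" by simp
  note F = field_onD[OF f]
  have R: "(x,y,int i) \<in> cylinder D N \<longleftrightarrow> (x,y) \<in> D" for x y using i by (simp add: mem_cylinder)
  have "floor_on D (\<lambda>s. f (fst s, snd s, int i))"
    unfolding floor_on_def
  proof (intro conjI ballI allI impI)
    fix s assume s: "s \<in> D"
    then have sR: "(fst s, snd s, int i) \<in> cylinder D N" by (simp add: R)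
    show "f (fst s, snd s, int i) \<in> steps" using F(1)[OF sR] .
    let ?s = "(fst s + fst (f (fst s, snd s, int i)), snd s + fst (snd (f (fst s, snd s, int i))))"
    assume h: "snd (snd (f (fst s, snd s, int i))) = 0"
    then have "(fst s, snd s, int i) + f (fst s, snd s, int i) = (fst ?s, snd ?s, int i)"
      by (cases "f (fst s, snd s, int i)") simp
    then show "?s \<in> D" "f (fst ?s, snd ?s, int i) = - f (fst s, snd s, int i)"
      using F(2,3)[OF sR] R by simp_all
  next
    fix s assume "s \<notin> D"
    then show "f (fst s, snd s, int i) = 0" using F(4) R by simp
  qed
  then show "field_floors N f ! i \<in> Collect (floor_on D)" using i by (simp add: nth_field_floors)
next
  fix i assume "Suc i < length (field_floors N f)"
  then have i: "Suc i < N" by simp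
  show "upper_plug (field_floors N f ! i) = lower_plug (field_floors N f ! Suc i)"
    using i field_neighbour[OF f, of "(0,0,1)" "(x,y,int i)" for x y]
    by (auto simp: nth_field_floors upper_plug_def lower_plug_def zero_prod_def add.commute)
qed

lemma floors_field_field:
  assumes w: "floor_walk D {} gs {}"
  shows "field_on (cylinder D (length gs)) (floors_field gs)"
  unfolding field_on_def
proof (intro conjI ballI allI impI)
  fix p assume pR: "p \<in> cylinder D (length gs)"
  obtain x y k where p: "p = (x,y,k)" by (cases p)
  define i where "i = nat k"
  have i: "i < length gs" "k = int i" and s: "(x,y) \<in> D" using pR by (auto simp: p mem_cylinder i_def)
  have E: "floor_on D (gs ! i)" using w i unfolding walk_nth by simp
  have ff: "floors_field gs p = (gs ! i) (x,y)" using i by (simp add: p floors_field_def)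
  define c where "c = (gs ! i) (x,y)"
  have st: "c \<in> steps" using E s unfolding floor_on_def c_def by blast
  show "floors_field gs p \<in> steps" using st ff c_def by simp
  consider "snd (snd c) = 0" | "c = (0,0,1)" | "c = (0,0,-1)" using st by (auto simp: steps_eq)
  then have "p + c \<in> cylinder D (length gs) \<and> floors_field gs (p + c) = - c"
  proof cases
    case 1
    then have "(x + fst c, y + fst (snd c)) \<in> D \<and> (gs ! i) (x + fst c, y + fst (snd c)) = - c"
      using E s unfolding floor_on_def c_def by fastforce
    moreover have "p + c = (x + fst c, y + fst (snd c), int i)" using 1 p i by (cases c) simp
    ultimately show ?thesis using i by (simp add: mem_cylinder floors_field_def)
  next
    case 2
    then have a: "(x,y) \<in> upper_plug (gs ! i)" by (simp add: upper_plug_def c_def)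
    have "Suc i < length gs"
    proof (rule ccontr)
      assume "\<not> Suc i < length gs"
      then have "i = length gs - 1" "gs \<noteq> []" using i by auto
      then have "gs ! i = last gs" "gs \<noteq> []" by (simp_all add: last_conv_nth)
      then show False using w a unfolding walk_nth by auto
    qed
    moreover then have "upper_plug (gs ! i) = lower_plug (gs ! Suc i)" using w unfolding walk_nth by blast
    moreover have "p + c = (x,y,int (Suc i))" using 2 p i by simp
    ultimately show ?thesis using a s 2 by (auto simp: mem_cylinder floors_field_def lower_plug_def nat_add_distrib)
  next
    case 3
    then have a: "(x,y) \<in> lower_plug (gs ! i)" by (simp add: lower_plug_def c_def)
    have "i \<noteq> 0"
    proof
      assume "i = 0"
      then have "gs ! i = hd gs" "gs \<noteq> []" using i by (auto simp: hd_conv_nth)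
      then show False using w a unfolding walk_nth by auto
    qed
    then obtain j where j: "i = Suc j" by (cases i) auto
    then have "upper_plug (gs ! j) = lower_plug (gs ! i)" using w i unfolding walk_nth by blast
    moreover have "p + c = (x,y,int j)" using 3 p i j by simp
    ultimately show ?thesis using a s 3 i j by (auto simp: mem_cylinder floors_field_def upper_plug_def)
  qed
  then show "p + floors_field gs p \<in> cylinder D (length gs)"
    "floors_field gs (p + floors_field gs p) = - floors_field gs p" by (simp_all add: ff c_def)
next
  fix p assume pR: "p \<notin> cylinder D (length gs)"
  obtain x y k where p: "p = (x,y,k)" by (cases p)
  show "floors_field gs p = 0"
  proof (cases "0 \<le> k \<and> k < int (length gs)")
    case True
    then have "(x,y) \<notin> D" using pR by (auto simp: p mem_cylinder)
    moreover have "nat k < length gs" using True by linarith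
    then have "floor_on D (gs ! nat k)" using w unfolding walk_nth by simp
    ultimately show ?thesis using True by (simp add: p floors_field_def floor_on_def)
  qed (auto simp: p floors_field_def)
qed

definition tiling_floors :: "nat \<Rightarrow> tiling \<Rightarrow> floor list" where
  "tiling_floors N t = field_floors N (dir t)"

lemma length_tiling_floors [simp]: "length (tiling_floors N t) = N"
  by (simp add: tiling_floors_def)

theorem bij_betw_tiling_floors:
  "bij_betw (tiling_floors N) (tilings D N) {gs. length gs = N \<and> floor_walk D {} gs {}}"
proof -
  have "bij_betw (field_floors N) (Collect (field_on (cylinder D N))) {gs. length gs = N \<and> floor_walk D {} gs {}}"
    by (rule bij_betw_byWitness[where f' = floors_field])
       (auto simp: floors_field_field_floors field_floors_floors_field field_floors_walk floors_field_field)
  then have "bij_betw (field_floors N \<circ> dir) (tilings_of (cylinder D N)) {gs. length gs = N \<and> floor_walk D {} gs {}}"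
    using bij_betw_dir by (rule bij_betw_trans[rotated])
  moreover have "field_floors N \<circ> dir = tiling_floors N" by (auto simp: tiling_floors_def)
  ultimately show ?thesis by (simp add: tilings_def)
qed

lemma tiling_floors_walk: "t \<in> tilings D N \<Longrightarrow> floor_walk D {} (tiling_floors N t) {}"
  using bij_betw_tiling_floors[of N D] by (auto simp: bij_betw_def)

lemma finite_floors:
  assumes D: "finite D"
  shows "finite (Collect (floor_on D))"
proof (rule finite_subset)
  show "Collect (floor_on D) \<subseteq> {g. \<forall>s. (s \<in> D \<longrightarrow> g s \<in> steps) \<and> (s \<notin> D \<longrightarrow> g s = 0)}"
    by (auto simp: floor_on_def)
  show "finite {g. \<forall>s. (s \<in> D \<longrightarrow> g s \<in> steps) \<and> (s \<notin> D \<longrightarrow> g s = (0::cube))}"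
    by (rule finite_set_of_finite_funs[OF D]) (simp add: steps_eq)
qed

text \<open>
  Only products of two colours at the same height enter, so the floor may be placed at height 0.
\<close>

definition floor_weight :: "square set \<Rightarrow> cube \<Rightarrow> floor \<Rightarrow> int" where
  "floor_weight D U g =
     (\<Sum>s\<in>D. \<Sum>s'\<in>D. pair_term U (\<lambda>p. g (fst p, fst (snd p))) (fst s, snd s, 0) (fst s', snd s', 0))"

lemma sum_cylinder_levels:
  fixes h :: "cube \<Rightarrow> int"
  assumes D: "finite D"
  shows "(\<Sum>p\<in>cylinder D N. h p) = (\<Sum>k<N. \<Sum>s\<in>D. h (fst s, snd s, int k))"
proof -
  have "(\<Sum>k<N. \<Sum>s\<in>D. h (fst s, snd s, int k)) = (\<Sum>(k,s)\<in>{..<N} \<times> D. h (fst s, snd s, int k))"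
    by (simp add: sum.cartesian_product)
  also have "\<dots> = (\<Sum>p\<in>cylinder D N. h p)"
    by (rule sum.reindex_bij_witness[where j = "\<lambda>(k,s). (fst s, snd s, int k)" and i = "\<lambda>(x,y,k). (nat k, (x,y))"])
       (auto simp: mem_cylinder)
  finally show ?thesis by simp
qed

theorem twist_floors:
  assumes D: "finite D" and U: "U \<in> horizontals" and t: "t \<in> tilings D N"
  shows "4 * twist (corner U) t = of_int (\<Sum>g\<leftarrow>tiling_floors N t. floor_weight D U g)"
proof -
  have t': "t \<in> tilings_of (cylinder D N)" using t by (simp add: tilings_def)
  let ?f = "dir t"
  have level: "pair_term U ?f (x,y,k) (x',y',k') =
      (if k = k' then pair_term U (\<lambda>p. ?f (fst p, fst (snd p), k)) (x,y,0) (x',y',0) else 0)" for x y k x' y' k'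
  proof -
    have "eps (x,y,k) * eps (x',y',k) = eps (x,y,0) * eps (x',y',0)" by (auto simp: eps_def black_def)
    moreover have "ahead U (x,y,k) (x',y',k') \<longleftrightarrow> k = k' \<and> ahead U (x,y,0) (x',y',0)"
      using U unfolding horizontals_def by (auto simp: ahead_horizontals)
    ultimately show ?thesis by (cases "k = k'") (simp_all add: pair_term_def)
  qed
  have "(\<Sum>p\<in>cylinder D N. \<Sum>q\<in>cylinder D N. pair_term U ?f p q)
    = (\<Sum>k<N. \<Sum>s\<in>D. \<Sum>k'<N. \<Sum>s'\<in>D. if k = k' then
         pair_term U (\<lambda>p. ?f (fst p, fst (snd p), int k)) (fst s, snd s, 0) (fst s', snd s', 0) else 0)"
    unfolding sum_cylinder_levels[OF D] by (simp add: level)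
  also have "\<dots> = (\<Sum>k<N. \<Sum>s\<in>D. \<Sum>k'<N. if k = k' then \<Sum>s'\<in>D. 
         pair_term U (\<lambda>p. ?f (fst p, fst (snd p), int k)) (fst s, snd s, 0) (fst s', snd s', 0) else 0)"
    by (intro sum.cong refl) simp
  also have "\<dots> = (\<Sum>k<N. floor_weight D U (\<lambda>s. ?f (fst s, snd s, int k)))"
    by (simp add: floor_weight_def)
  also have "\<dots> = (\<Sum>g\<leftarrow>tiling_floors N t. floor_weight D U g)"
    by (simp add: tiling_floors_def field_floors_def sum_list_sum_nth o_def interv_sum_list_conv_sum_set_nat atLeast0LessThan)
  finally show ?thesis using twist_eq[OF U t' finite_cylinder[OF D]] by simp
qed

definition vertical_floor_field :: "square set \<Rightarrow> floor \<Rightarrow> bool" where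
  "vertical_floor_field D g \<longleftrightarrow> (\<forall>s\<in>D. snd (snd (g s)) \<noteq> 0)"

lemma vertical_step: "a \<in> steps \<Longrightarrow> vertical {p, p + a} \<longleftrightarrow> snd (snd a) \<noteq> 0"
proof -
  assume a: "a \<in> steps"
  obtain x y z where p: "p = (x,y,z)" by (cases p)
  show ?thesis
  proof
    assume "vertical {p, p + a}"
    then obtain q where "{p, p + a} = {q, q + (0,0,1)}" by (auto simp: vertical_def)
    then show "snd (snd a) \<noteq> 0" by (cases q, cases a) (auto simp: doubleton_eq_iff p)
  next
    assume "snd (snd a) \<noteq> 0"
    then consider "a = (0,0,1)" | "a = (0,0,-1)" using a by (auto simp: steps_eq)
    then show "vertical {p, p + a}"
    proof cases
      case 1
      then show ?thesis unfolding vertical_def by blast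
    next
      case 2
      have "{p, p + a} = {p + a, p + a + (0,0,1)}" by (auto simp: 2 p)
      then show ?thesis unfolding vertical_def by blast
    qed
  qed
qed

lemma num_vertical_floors_eq:
  assumes t: "t \<in> tilings D N"
  shows "num_vertical_floors N t = length (filter (vertical_floor_field D) (tiling_floors N t))"
proof -
  have t': "t \<in> tilings_of (cylinder D N)" using t by (simp add: tilings_def)
  have *: "vertical_floor t (Suc i) \<longleftrightarrow> vertical_floor_field D (tiling_floors N t ! i)" if i: "i < N" for i
  proof -
    have "vertical_floor t (Suc i) \<longleftrightarrow> (\<forall>s\<in>D. vertical {(fst s, snd s, int i), (fst s, snd s, int i) + dir t (fst s, snd s, int i)})"
    proof
      assume v: "vertical_floor t (Suc i)"
      show "\<forall>s\<in>D. vertical {(fst s, snd s, int i), (fst s, snd s, int i) + dir t (fst s, snd s, int i)}"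
      proof
        fix s assume "s \<in> D"
        then have "(fst s, snd s, int i) \<in> cylinder D N" using i by (simp add: mem_cylinder)
        from v have "\<forall>d\<in>t. (\<exists>a b. (a, b, int i) \<in> d) \<longrightarrow> vertical d" by (simp add: vertical_floor_def)
        with dir_domino(2)[OF t' \<open>(fst s, snd s, int i) \<in> cylinder D N\<close>]
        show "vertical {(fst s, snd s, int i), (fst s, snd s, int i) + dir t (fst s, snd s, int i)}"
          by (meson insertI1)
      qed
    next
      assume v: "\<forall>s\<in>D. vertical {(fst s, snd s, int i), (fst s, snd s, int i) + dir t (fst s, snd s, int i)}"
      show "vertical_floor t (Suc i)"
        unfolding vertical_floor_def
      proof (intro ballI impI)
        fix d assume d: "d \<in> t" "\<exists>x y. (x, y, int (Suc i) - 1) \<in> d"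
        then obtain x y where p: "(x,y,int i) \<in> d" by auto
        then have "(x,y,int i) \<in> cylinder D N" using d(1) Union_tiling[OF t'] by blast
        then have "(x,y) \<in> D" by (simp add: mem_cylinder)
        with v dir_in_block[OF t' d(1) p] show "vertical d" by force
      qed
    qed
    also have "\<dots> \<longleftrightarrow> vertical_floor_field D (tiling_floors N t ! i)"
      unfolding vertical_floor_field_def tiling_floors_def nth_field_floors[OF i]
    proof (rule ball_cong[OF refl])
      fix s assume "s \<in> D"
      then have "(fst s, snd s, int i) \<in> cylinder D N" using i by (simp add: mem_cylinder)
      from vertical_step[OF dir_domino(1)[OF t' this]]
      show "vertical {(fst s, snd s, int i), (fst s, snd s, int i) + dir t (fst s, snd s, int i)} \<longleftrightarrow>
         snd (snd (dir t (fst s, snd s, int i))) \<noteq> 0" .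
    qed
    finally show ?thesis .
  qed
  have "{k \<in> {1..N}. vertical_floor t k} = Suc ` {i. i < N \<and> vertical_floor_field D (tiling_floors N t ! i)}"
  proof (intro equalityI subsetI)
    fix k assume "k \<in> {k \<in> {1..N}. vertical_floor t k}"
    then show "k \<in> Suc ` {i. i < N \<and> vertical_floor_field D (tiling_floors N t ! i)}"
      using * by (cases k) auto
  next
    fix k assume "k \<in> Suc ` {i. i < N \<and> vertical_floor_field D (tiling_floors N t ! i)}"
    then show "k \<in> {k \<in> {1..N}. vertical_floor t k}" using * by auto
  qed
  then show ?thesis
    by (simp add: num_vertical_floors_def card_image length_filter_conv_card)
qed

section \<open>Stacking\<close>

lemma Un_tilings:
  assumes t: "t \<in> tilings_of A" and t': "t' \<in> tilings_of B" and dj: "A \<inter> B = {}"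
  shows "t \<union> t' \<in> tilings_of (A \<union> B)" "t \<inter> t' = {}"
proof -
  have sub: "d \<subseteq> A" if "d \<in> t" for d using that Union_tiling[OF t] by blast
  have sub': "d \<subseteq> B" if "d \<in> t'" for d using that Union_tiling[OF t'] by blast
  show "t \<inter> t' = {}"
  proof (rule ccontr)
    assume "t \<inter> t' \<noteq> {}"
    then obtain d where d: "d \<in> t" "d \<in> t'" by blast
    then have "d = {}" using sub sub' dj by blast
    then show False using tiling_block_nonempty[OF t d(1)] by simp
  qed
  have "disjoint (t \<union> t')"
  proof (rule disjointI)
    fix d e assume "d \<in> t \<union> t'" "e \<in> t \<union> t'" "d \<noteq> e"
    then show "d \<inter> e = {}"
      using sub sub' dj tiling_block[OF t, of d e] tiling_block[OF t', of d e] by blast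
  qed
  moreover have "\<Union>(t \<union> t') = A \<union> B" using Union_tiling[OF t] Union_tiling[OF t'] by simp
  moreover have "{} \<notin> t \<union> t'" using tiling_block_nonempty[OF t] tiling_block_nonempty[OF t'] by blast
  moreover have "\<forall>d\<in>t \<union> t'. is_domino d" using t t' unfolding tilings_of_def by blast
  ultimately show "t \<union> t' \<in> tilings_of (A \<union> B)" by (simp add: tilings_of_def partition_on_def)
qed

lemma translate_tiling:
  fixes v :: cube
  assumes t: "t \<in> tilings_of A"
  shows "(\<lambda>d. (\<lambda>p. p + v) ` d) ` t \<in> tilings_of ((\<lambda>p. p + v) ` A)"
proof -
  let ?T = "(\<lambda>d. (\<lambda>p. p + v) ` d) ` t"
  have "\<Union>?T = (\<lambda>p. p + v) ` \<Union>t" by blast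
  then have "\<Union>?T = (\<lambda>p. p + v) ` A" using Union_tiling[OF t] by simp
  moreover have "disjoint ?T"
  proof (rule disjoint_image)
    show "inj_on (\<lambda>p. p + v) (\<Union>t)" by (simp add: inj_on_def)
    show "disjoint t" using t by (simp add: tilings_of_def partition_on_def)
  qed
  moreover have "{} \<notin> ?T" using tiling_block_nonempty[OF t] by blast
  moreover have "\<forall>d\<in>?T. is_domino d"
  proof
    fix d assume "d \<in> ?T"
    then obtain e where e: "e \<in> t" "d = (\<lambda>p. p + v) ` e" by blast
    have "is_domino e" using t e(1) unfolding tilings_of_def by blast
    then obtain p a where "a \<in> axes" "e = {p, p + a}" unfolding is_domino_def by blast
    then have "a \<in> axes" "d = {p + v, p + v + a}" using e(2) by (auto simp: ac_simps)
    then show "is_domino d" unfolding is_domino_def by blast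
  qed
  ultimately show ?thesis by (simp add: tilings_of_def partition_on_def)
qed

lemma dir_translate:
  fixes v :: cube
  assumes t: "t \<in> tilings_of A" and p: "p \<in> A"
  shows "dir ((\<lambda>d. (\<lambda>p. p + v) ` d) ` t) (p + v) = dir t p"
proof (rule dir_eqI[OF translate_tiling[OF t]])
  note D = dir_domino[OF t p]
  have "(\<lambda>p. p + v) ` {p, p + dir t p} \<in> (\<lambda>d. (\<lambda>p. p + v) ` d) ` t" using D(2) by blast
  then show "{p + v, p + v + dir t p} \<in> (\<lambda>d. (\<lambda>p. p + v) ` d) ` t" by (simp add: ac_simps)
  show "dir t p \<noteq> 0"
  proof
    assume "dir t p = 0"
    with D(1) show False by simp
  qed
qed

lemma cylinder_add:
  "cylinder D (N0 + N1) = cylinder D N0 \<union> (\<lambda>p. p + (0, 0, int N0)) ` cylinder D N1"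
  "cylinder D N0 \<inter> (\<lambda>p. p + (0, 0, int N0)) ` cylinder D N1 = {}"
proof -
  have sh: "(x,y,k) \<in> (\<lambda>p. p + (0, 0, int N0)) ` cylinder D N1 \<longleftrightarrow> (x,y,k - int N0) \<in> cylinder D N1" for x y k
  proof
    assume "(x,y,k - int N0) \<in> cylinder D N1"
    then have "(x,y,k - int N0) + (0,0,int N0) \<in> (\<lambda>p. p + (0, 0, int N0)) ` cylinder D N1" by (rule imageI)
    then show "(x,y,k) \<in> (\<lambda>p. p + (0, 0, int N0)) ` cylinder D N1" by simp
  qed auto
  show "cylinder D (N0 + N1) = cylinder D N0 \<union> (\<lambda>p. p + (0, 0, int N0)) ` cylinder D N1"
    using sh by (auto simp: mem_cylinder)
  show "cylinder D N0 \<inter> (\<lambda>p. p + (0, 0, int N0)) ` cylinder D N1 = {}"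
    using sh by (auto simp: mem_cylinder)
qed

lemma stack_tilings:
  assumes t0: "t0 \<in> tilings D N0" and t1: "t1 \<in> tilings D N1"
  shows "stack N0 t0 t1 \<in> tilings D (N0 + N1)"
    "t0 \<inter> (\<lambda>d. (\<lambda>p. p + (0, 0, int N0)) ` d) ` t1 = {}"
  using Un_tilings[OF t0[unfolded tilings_def] translate_tiling[OF t1[unfolded tilings_def], of "(0,0,int N0)"]
      cylinder_add(2)]
  unfolding stack_def tilings_def cylinder_add(1) by blast+

lemma tiling_floors_stack:
  assumes t0: "t0 \<in> tilings D N0" and t1: "t1 \<in> tilings D N1"
  shows "tiling_floors (N0 + N1) (stack N0 t0 t1) = tiling_floors N0 t0 @ tiling_floors N1 t1"
proof (rule nth_equalityI)
  fix i assume "i < length (tiling_floors (N0 + N1) (stack N0 t0 t1))"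
  then have i: "i < N0 + N1" by simp
  let ?s = "stack N0 t0 t1"
  have s: "?s \<in> tilings_of (cylinder D (N0 + N1))" using stack_tilings(1)[OF t0 t1] by (simp add: tilings_def)
  have t0': "t0 \<in> tilings_of (cylinder D N0)" using t0 by (simp add: tilings_def)
  have t1': "t1 \<in> tilings_of (cylinder D N1)" using t1 by (simp add: tilings_def)
  show "tiling_floors (N0 + N1) ?s ! i = (tiling_floors N0 t0 @ tiling_floors N1 t1) ! i"
  proof (cases "i < N0")
    case True
    have "dir ?s (x,y,int i) = dir t0 (x,y,int i)" for x y
    proof (cases "(x,y) \<in> D")
      case D: True
      then have "(x,y,int i) \<in> cylinder D N0" using True by (simp add: mem_cylinder)
      from dir_subset[OF t0' s _ this] show ?thesis by (simp add: stack_def)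
    next
      case False
      then have "(x,y,int i) \<notin> cylinder D N0" "(x,y,int i) \<notin> cylinder D (N0 + N1)" by (simp_all add: mem_cylinder)
      then show ?thesis using field_onD(4)[OF field_dir[OF t0']] field_onD(4)[OF field_dir[OF s]] by simp
    qed
    then show ?thesis using True i by (simp add: tiling_floors_def nth_append nth_field_floors)
  next
    case False
    then obtain j where j: "i = N0 + j" "j < N1" using i by (metis add_diff_inverse_nat nat_add_left_cancel_less)
    have "dir ?s (x,y,int i) = dir t1 (x,y,int j)" for x y
    proof (cases "(x,y) \<in> D")
      case D: True
      then have R: "(x,y,int j) \<in> cylinder D N1" using j by (simp add: mem_cylinder)
      have e: "(x,y,int i) = (x,y,int j) + (0,0,int N0)" using j by simp
      have "dir ?s (x,y,int i) = dir ((\<lambda>d. (\<lambda>p. p + (0,0,int N0)) ` d) ` t1) (x,y,int i)"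
      proof (rule dir_subset[OF translate_tiling[OF t1', of "(0,0,int N0)"] s])
        show "(x,y,int i) \<in> (\<lambda>p. p + (0,0,int N0)) ` cylinder D N1"
          unfolding e using R by (rule imageI)
      qed (simp add: stack_def)
      also have "\<dots> = dir t1 (x,y,int j)" unfolding e by (rule dir_translate[OF t1' R])
      finally show ?thesis .
    next
      case False
      then have "(x,y,int j) \<notin> cylinder D N1" "(x,y,int i) \<notin> cylinder D (N0 + N1)" by (simp_all add: mem_cylinder)
      then show ?thesis using field_onD(4)[OF field_dir[OF t1']] field_onD(4)[OF field_dir[OF s]] by simp
    qed
    then show ?thesis using j by (simp add: tiling_floors_def nth_append nth_field_floors)
  qed
qed simp

lemma twist_stack:
  assumes D: "finite D" and U: "U \<in> horizontals" and t0: "t0 \<in> tilings D N0" and t1: "t1 \<in> tilings D N1"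
  shows "twist (corner U) (stack N0 t0 t1) = twist (corner U) t0 + twist (corner U) t1"
  using twist_floors[OF D U stack_tilings(1)[OF t0 t1]] twist_floors[OF D U t0] twist_floors[OF D U t1]
  by (simp add: tiling_floors_stack[OF t0 t1])

lemma num_vertical_floors_stack:
  assumes t0: "t0 \<in> tilings D N0" and t1: "t1 \<in> tilings D N1"
  shows "num_vertical_floors (N0 + N1) (stack N0 t0 t1) = num_vertical_floors N0 t0 + num_vertical_floors N1 t1"
  by (simp add: num_vertical_floors_eq[OF stack_tilings(1)[OF t0 t1]] num_vertical_floors_eq[OF t0]
      num_vertical_floors_eq[OF t1] tiling_floors_stack[OF t0 t1])

text \<open>
  The tiling with the trit is at the bottom, so the region of the trit is not translated.
\<close>

lemma trit_stack:
  assumes t0: "t0 \<in> tilings D N0" and t1: "t1 \<in> tilings D N1" and trit: "trit t0 t0'"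
  shows "trit (stack N0 t0 t1) (stack N0 t0' t1)"
proof -
  obtain A T T' where T: "A \<in> trit_regions" "T \<in> tilings_of A" "T' \<in> tilings_of A" "T \<subseteq> t0" "T' \<noteq> T" "t0' = (t0 - T) \<union> T'"
    using trit unfolding trit_def retile_def by blast
  let ?t1 = "(\<lambda>d. (\<lambda>p. p + (0, 0, int N0)) ` d) ` t1"
  have "?t1 \<inter> T = {}" using stack_tilings(2)[OF t0 t1] T(4) by blast
  then have "stack N0 t0' t1 = (stack N0 t0 t1 - T) \<union> T'" unfolding stack_def T(6) by blast
  moreover have "T \<subseteq> stack N0 t0 t1" using T(4) unfolding stack_def by blast
  ultimately show ?thesis using T(1-3,5) unfolding trit_def retile_def by blast
qed

text \<open>
  The direction field of \<open>t_vert\<close>, if \<open>N\<close> is even.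
\<close>

definition vert_field :: "square set \<Rightarrow> nat \<Rightarrow> cube \<Rightarrow> cube" where
  "vert_field D N p = (if p \<in> cylinder D N then (0, 0, if even (snd (snd p)) then 1 else - 1) else 0)"

lemma vert_field:
  assumes "even N"
  shows "field_on (cylinder D N) (vert_field D N)"
  unfolding field_on_def
proof (intro conjI ballI allI impI)
  fix p assume p: "p \<in> cylinder D N"
  obtain x y k where xyk: "p = (x,y,k)" by (cases p)
  show "vert_field D N p \<in> steps" using p by (simp add: vert_field_def steps_eq)
  have k: "0 \<le> k" "k < int N" "(x,y) \<in> D" using p by (simp_all add: xyk mem_cylinder)
  have "even k \<Longrightarrow> k + 1 < int N" "odd k \<Longrightarrow> 1 \<le> k" using k assms by presburger+
  then have "p + vert_field D N p \<in> cylinder D N" using p k by (auto simp: vert_field_def xyk mem_cylinder)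
  then show "p + vert_field D N p \<in> cylinder D N" "vert_field D N (p + vert_field D N p) = - vert_field D N p"
    using p by (auto simp: vert_field_def xyk)
qed (simp add: vert_field_def)

text \<open>
  In \<open>t_vert\<close> each domino starts at an even height.
\<close>

lemma t_vert_eq:
  assumes "even N"
  shows "t_vert D N = dominoes (cylinder D N) (vert_field D N)"
proof (intro equalityI subsetI)
  fix d assume "d \<in> t_vert D N"
  then obtain i j m where d: "d = {(i, j, 2 * int m), (i, j, 2 * int m + 1)}" "(i,j) \<in> D" "m < N div 2"
    unfolding t_vert_def by blast
  then have p: "(i, j, 2 * int m) \<in> cylinder D N" by (simp add: mem_cylinder)
  then have "d = {(i, j, 2 * int m), (i, j, 2 * int m) + vert_field D N (i, j, 2 * int m)}"
    by (simp add: d(1) vert_field_def)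
  with p show "d \<in> dominoes (cylinder D N) (vert_field D N)" unfolding dominoes_def by blast
next
  fix d assume "d \<in> dominoes (cylinder D N) (vert_field D N)"
  then obtain p where p: "p \<in> cylinder D N" "d = {p, p + vert_field D N p}" unfolding dominoes_def by blast
  obtain x y k where xyk: "p = (x,y,k)" by (cases p)
  have k: "0 \<le> k" "k < int N" "(x,y) \<in> D" using p(1) by (simp_all add: xyk mem_cylinder)
  define m where "m = nat (k div 2)"
  have m: "m < N div 2" "int m = k div 2" using k assms by (auto simp: m_def)
  have "d = {(x, y, 2 * int m), (x, y, 2 * int m + 1)}"
  proof (cases "even k")
    case True
    then have "2 * int m = k" using m by simp
    then show ?thesis using p True by (simp add: vert_field_def xyk)
  next
    case False
    then have "2 * int m = k - 1" using m by presburger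
    then show ?thesis using p False by (auto simp: vert_field_def xyk)
  qed
  then show "d \<in> t_vert D N" using k(3) m(1) unfolding t_vert_def by blast
qed

lemma t_vert_tilings: "even N \<Longrightarrow> t_vert D N \<in> tilings D N"
  by (simp add: t_vert_eq dominoes_tiling vert_field tilings_def)

lemma num_vertical_floors_t_vert:
  assumes "even N"
  shows "num_vertical_floors N (t_vert D N) = N"
proof -
  have "vertical_floor_field D g" if "g \<in> set (tiling_floors N (t_vert D N))" for g
    using that by (auto simp: tiling_floors_def field_floors_def t_vert_eq[OF assms] dir_dominoes[OF vert_field[OF assms]]
        vertical_floor_field_def vert_field_def mem_cylinder split: if_splits)
  then show ?thesis
    unfolding num_vertical_floors_eq[OF t_vert_tilings[OF assms]] by (simp add: filter_True)
qed

section \<open>A trit that changes the twist by one\<close>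

lemma retile_dominoes:
  assumes f: "field_on R f" and g: "field_on R g" and A: "A \<subseteq> R"
    and cf: "\<And>p. p \<in> A \<Longrightarrow> p + f p \<in> A" and cg: "\<And>p. p \<in> A \<Longrightarrow> p + g p \<in> A"
    and eq: "\<And>p. p \<notin> A \<Longrightarrow> g p = f p" and ne: "f \<noteq> g"
  shows "retile A (dominoes R f) (dominoes R g)"
proof -
  define f' where "f' p = (if p \<in> A then f p else 0)" for p
  define g' where "g' p = (if p \<in> A then g p else 0)" for p
  have f': "field_on A f'" unfolding field_on_def
  proof (intro conjI ballI allI impI)
    fix p assume p: "p \<in> A"
    then have "p \<in> R" using A by blast
    then show "f' p \<in> steps" "p + f' p \<in> A" "f' (p + f' p) = - f' p"
      using p field_onD(1,3)[OF f] cf[OF p] by (simp_all add: f'_def)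
  qed (simp add: f'_def)
  have g': "field_on A g'" unfolding field_on_def
  proof (intro conjI ballI allI impI)
    fix p assume p: "p \<in> A"
    then have "p \<in> R" using A by blast
    then show "g' p \<in> steps" "p + g' p \<in> A" "g' (p + g' p) = - g' p"
      using p field_onD(1,3)[OF g] cg[OF p] by (simp_all add: g'_def)
  qed (simp add: g'_def)
  have eqT: "dominoes A f' = (\<lambda>p. {p, p + f p}) ` A" "dominoes A g' = (\<lambda>p. {p, p + g p}) ` A"
    by (auto simp: dominoes_def f'_def g'_def)
  have sub: "dominoes A f' \<subseteq> dominoes R f" unfolding eqT using A by (auto simp: dominoes_def)
  have "f' \<noteq> g'"
  proof
    assume e: "f' = g'"
    have "f p = g p" for p using fun_cong[OF e, of p] eq[of p] by (cases "p \<in> A") (simp_all add: f'_def g'_def)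
    with ne show False by blast
  qed
  then have "dominoes A g' \<noteq> dominoes A f'" using dir_dominoes[OF f'] dir_dominoes[OF g'] by metis
  moreover have "dominoes R g = (dominoes R f - dominoes A f') \<union> dominoes A g'"
  proof -
    have split: "dominoes R h = (\<lambda>p. {p, p + h p}) ` (R - A) \<union> (\<lambda>p. {p, p + h p}) ` A" for h
      using A unfolding dominoes_def by blast
    have "(\<lambda>p. {p, p + g p}) ` (R - A) = (\<lambda>p. {p, p + f p}) ` (R - A)"
      by (rule image_cong) (simp_all add: eq)
    moreover have "(\<lambda>p. {p, p + f p}) ` (R - A) \<inter> (\<lambda>p. {p, p + f p}) ` A = {}"
    proof (rule equals0I)
      fix x assume "x \<in> (\<lambda>p. {p, p + f p}) ` (R - A) \<inter> (\<lambda>p. {p, p + f p}) ` A"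
      then obtain p q where pq: "q \<notin> A" "p \<in> A" "x = {q, q + f q}" "x = {p, p + f p}" by blast
      then have "q \<in> {p, p + f p}" by blast
      with cf[OF pq(2)] pq(1,2) show False by blast
    qed
    ultimately show ?thesis unfolding eqT split[of f] split[of g] by blast
  qed
  ultimately show ?thesis
    unfolding retile_def using dominoes_tiling[OF f'] dominoes_tiling[OF g'] sub by blast
qed

lemma height_cylinder: "p \<in> cylinder D N \<Longrightarrow> snd (snd p) \<in> {0..<int N}"
  by (cases p) (simp add: mem_cylinder)

text \<open>
  A direction field on an explicit finite region, as an association list.
\<close>

type_synonym table = "(cube \<times> cube) list"

text \<open>
  The explicit tilings below list each domino only once, by one of its cubes.
\<close>

definition both_ends :: "table \<Rightarrow> table" where
  "both_ends ds = concat (map (\<lambda>(p, a). [(p, a), (p + a, - a)]) ds)"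

text \<open>
  A tiling of the \<open>a \<times> b \<times> 4\<close> box.  The last condition says that the components \<open>w2\<close>
  have sum 0 over the cubes of the box with a given \<open>y\<close>.  It makes the contributions of the
  vertical dominoes outside of the box to the twist vanish.
\<close>

definition box_table :: "int \<Rightarrow> int \<Rightarrow> table \<Rightarrow> bool" where
  "box_table a b T \<longleftrightarrow>
     distinct (map fst T) \<and> int (length T) = 4 * a * b \<and> 0 \<le> a \<and> 0 \<le> b \<and>
     (\<forall>(p, d)\<in>set T. p \<in> {0..<a} \<times> {0..<b} \<times> {0..<4}) \<and>
     (\<forall>(p, d)\<in>set T. d \<in> steps \<and> map_of T (p + d) = Some (- d)) \<and>
     (\<forall>y\<in>{0..<b}. (\<Sum>(p, d)\<leftarrow>T. if fst (snd p) = y then eps p * fst (snd d) else 0) = 0)"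

definition table_form :: "table \<Rightarrow> int" where
  "table_form T = (\<Sum>(p, d)\<leftarrow>T. \<Sum>(q, e)\<leftarrow>T.
      row_sign p q * (eps q * fst (snd e)) * (eps p * snd (snd d)))"

definition box_field :: "square set \<Rightarrow> int \<Rightarrow> int \<Rightarrow> table \<Rightarrow> cube \<Rightarrow> cube" where
  "box_field D i j T p = (case map_of T (p - (i, j, 0)) of Some d \<Rightarrow> d | None \<Rightarrow> vert_field D 4 p)"

lemma eps_mult: "eps (p + q) = - (eps p * eps q)"
  by (cases p, cases q) (auto simp: eps_def black_def)

context
  fixes D :: "square set" and i j a b :: int and T :: table
  assumes D: "finite D" and T: "box_table a b T" and sub: "{i..<i + a} \<times> {j..<j + b} \<subseteq> D"
begin

lemma box_field_in:
  assumes "(p, d) \<in> set T"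
  shows "box_field D i j T ((i,j,0) + p) = d"
  using T assms by (simp add: box_field_def box_table_def)

lemma box_table_keys: "set (map fst T) = {0..<a} \<times> {0..<b} \<times> {0..<4}"
proof (rule card_subset_eq)
  show "set (map fst T) \<subseteq> {0..<a} \<times> {0..<b} \<times> {0..<4}"
    using T unfolding box_table_def by fastforce
  have d: "distinct (map fst T)" and n: "int (length T) = 4 * a * b" "0 \<le> a" "0 \<le> b"
    using T unfolding box_table_def by blast+
  have "int (card ({0..<a} \<times> {0..<b} \<times> {0..<4::int})) = 4 * a * b"
    using n(2,3) by (simp add: card_cartesian_product)
  then show "card (set (map fst T)) = card ({0..<a} \<times> {0..<b} \<times> {0..<4::int})"
    unfolding distinct_card[OF d] length_map using n(1) by (simp only: of_nat_eq_iff[where 'a = int, symmetric])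
qed simp

lemma box_field_out:
  assumes "p - (i,j,0) \<notin> {0..<a} \<times> {0..<b} \<times> {0..<4}"
  shows "box_field D i j T p = vert_field D 4 p"
proof -
  have "map_of T (p - (i,j,0)) = None"
    unfolding map_of_eq_None_iff set_map[symmetric] box_table_keys using assms .
  then show ?thesis by (simp add: box_field_def)
qed

lemma box_keys: "p \<in> {0..<a} \<times> {0..<b} \<times> {0..<4} \<longleftrightarrow> (\<exists>d. (p, d) \<in> set T)"
proof -
  have "{0..<a} \<times> {0..<b} \<times> {0..<4} = fst ` set T" using box_table_keys by simp
  then show ?thesis by force
qed

lemma box_cylinder: "p \<in> {0..<a} \<times> {0..<b} \<times> {0..<4} \<Longrightarrow> (i,j,0) + p \<in> cylinder D 4"
  using sub by (cases p) (auto simp: mem_cylinder)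

lemma box_field: "field_on (cylinder D 4) (box_field D i j T)"
  unfolding field_on_def
proof (intro conjI ballI allI impI)
  let ?f = "box_field D i j T"
  fix p assume p: "p \<in> cylinder D 4"
  have "?f p \<in> steps \<and> p + ?f p \<in> cylinder D 4 \<and> ?f (p + ?f p) = - ?f p"
  proof (cases "p - (i,j,0) \<in> {0..<a} \<times> {0..<b} \<times> {0..<4}")
    case True
    then obtain d where d: "(p - (i,j,0), d) \<in> set T" using iffD1[OF box_keys True] by blast
    then have fp: "?f p = d" using box_field_in[OF d] by simp
    have d': "d \<in> steps" "map_of T (p - (i,j,0) + d) = Some (- d)"
      using T d unfolding box_table_def by blast+
    then have m: "(p - (i,j,0) + d, - d) \<in> set T" by (simp add: map_of_SomeD)
    then have "p - (i,j,0) + d \<in> {0..<a} \<times> {0..<b} \<times> {0..<4}" by (intro iffD2[OF box_keys] exI)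
    then have "(i,j,0) + (p - (i,j,0) + d) \<in> cylinder D 4" by (rule box_cylinder)
    moreover have e: "(i,j,0) + (p - (i,j,0) + d) = p + d" by simp
    ultimately show ?thesis using box_field_in[OF m] fp d'(1) unfolding e by simp
  next
    case False
    then have fp: "?f p = vert_field D 4 p" by (rule box_field_out)
    note V = field_onD[OF vert_field[of 4 D, simplified] ]
    have in4: "snd (snd p) \<in> {0..<4}" "snd (snd (p + vert_field D 4 p)) \<in> {0..<4}"
      using height_cylinder[OF p] height_cylinder[OF V(2)[OF p]] by simp_all
    have "fst (vert_field D 4 p) = 0" "fst (snd (vert_field D 4 p)) = 0" by (auto simp: vert_field_def)
    then have "p + vert_field D 4 p - (i,j,0) \<notin> {0..<a} \<times> {0..<b} \<times> {0..<4}"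
      using False in4 by (auto simp: mem_Times_iff)
    then have "?f (p + vert_field D 4 p) = vert_field D 4 (p + vert_field D 4 p)" by (rule box_field_out)
    then show ?thesis using V(1-3)[OF p] fp by simp
  qed
  then show "?f p \<in> steps" "p + ?f p \<in> cylinder D 4" "?f (p + ?f p) = - ?f p" by blast+
next
  fix p assume p: "p \<notin> cylinder D 4"
  have "p - (i,j,0) \<notin> {0..<a} \<times> {0..<b} \<times> {0..<4}"
  proof
    assume "p - (i,j,0) \<in> {0..<a} \<times> {0..<b} \<times> {0..<4}"
    from box_cylinder[OF this] p show False by simp
  qed
  from box_field_out[OF this] p show "box_field D i j T p = 0" by (simp add: vert_field_def)
qed

lemma sum_box:
  fixes h :: "cube \<Rightarrow> cube \<Rightarrow> int"
  shows "(\<Sum>p\<in>(\<lambda>p. (i,j,0) + p) ` ({0..<a} \<times> {0..<b} \<times> {0..<4}). h p (box_field D i j T p))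
    = (\<Sum>(p, d)\<leftarrow>T. h ((i,j,0) + p) d)"
proof -
  have dist: "distinct (map fst T)" using T unfolding box_table_def by blast
  have keys: "{0..<a} \<times> {0..<b} \<times> {0..<4} = fst ` set T" using box_table_keys by simp
  have inj: "inj_on fst (set T)" and dT: "distinct T" using dist by (simp_all add: distinct_map)
  have "(\<Sum>p\<in>(\<lambda>p. (i,j,0) + p) ` ({0..<a} \<times> {0..<b} \<times> {0..<4}). h p (box_field D i j T p))
     = (\<Sum>p\<in>fst ` set T. h ((i,j,0) + p) (box_field D i j T ((i,j,0) + p)))"
    unfolding keys by (subst sum.reindex) (simp_all add: inj_on_def)
  also have "\<dots> = (\<Sum>x\<in>set T. h ((i,j,0) + fst x) (box_field D i j T ((i,j,0) + fst x)))"
    by (subst sum.reindex[OF inj]) simp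
  also have "\<dots> = (\<Sum>x\<in>set T. h ((i,j,0) + fst x) (snd x))"
    by (intro sum.cong refl) (metis box_field_in prod.collapse)
  also have "\<dots> = (\<Sum>(p, d)\<leftarrow>T. h ((i,j,0) + p) d)"
    unfolding sum_list_distinct_conv_sum_set[OF dT, symmetric] by (simp add: case_prod_unfold)
  finally show ?thesis .
qed

text \<open>
  A square outside of the box carries two vertical dominoes, and \<open>w3\<close> has the same value on their
  four cubes.  It lies on the same side of all cubes of the box with the same \<open>y\<close>.  So its
  contribution is a multiple of a sum that vanishes by the definition of \<open>box_table\<close>.
\<close>

lemma twist_form_box: "twist_form (cylinder D 4) (box_field D i j T) = table_form T"
proof -
  let ?f = "box_field D i j T"
  let ?R = "cylinder D 4"
  define B :: "cube set" where "B = (\<lambda>p. (i,j,0) + p) ` ({0..<a} \<times> {0..<b} \<times> {0..<4})"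
  have memB: "(x,y,k) \<in> B \<longleftrightarrow> x \<in> {i..<i + a} \<and> y \<in> {j..<j + b} \<and> k \<in> {0..<4}" for x y k
  proof
    assume "x \<in> {i..<i + a} \<and> y \<in> {j..<j + b} \<and> k \<in> {0..<4}"
    then have "(x - i, y - j, k) \<in> {0..<a} \<times> {0..<b} \<times> {0..<4}" by auto
    then have "(i,j,0) + (x - i, y - j, k) \<in> B" unfolding B_def by (rule imageI)
    moreover have "(i,j,0) + (x - i, y - j, k) = (x,y,k)" by simp
    ultimately show "(x,y,k) \<in> B" by (simp only:)
  qed (auto simp: B_def)
  have fin: "finite ?R" by (rule finite_cylinder[OF D])
  have BR: "B \<subseteq> ?R" unfolding B_def using box_cylinder by blast
  have out: "?f p = vert_field D 4 p" if "p \<notin> B" for p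
  proof (rule box_field_out)
    show "p - (i,j,0) \<notin> {0..<a} \<times> {0..<b} \<times> {0..<4}"
    proof
      assume "p - (i,j,0) \<in> {0..<a} \<times> {0..<b} \<times> {0..<4}"
      then have "(i,j,0) + (p - (i,j,0)) \<in> B" unfolding B_def by (rule imageI)
      then show False using that by simp
    qed
  qed
  have w2o: "w2 ?f q = 0" if "q \<notin> B" for q
    by (simp add: w2_def out[OF that] vert_field_def)
  have rows: "(\<Sum>q\<in>B. if fst (snd q) = y then w2 ?f q else 0) = 0" for y
  proof -
    have E: "eps (i + x, j + y, z) = - (eps (i,j,0) * eps (x,y,z))" for x y z
      using eps_mult[of "(i,j,0)" "(x,y,z)"] by simp
    have "(\<Sum>q\<in>B. if fst (snd q) = y then w2 ?f q else 0)
      = (\<Sum>(p, d)\<leftarrow>T. (if fst (snd ((i,j,0) + p)) = y then eps ((i,j,0) + p) * fst (snd d) else 0))"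
      unfolding B_def w2_def by (rule sum_box)
    also have "\<dots> = (\<Sum>(p, d)\<leftarrow>T. - eps (i,j,0) * (if fst (snd p) = y - j then eps p * fst (snd d) else 0))"
      by (rule arg_cong[where f = sum_list], rule map_cong[OF refl])
        (auto simp: E)
    also have "\<dots> = - eps (i,j,0) * (\<Sum>(p, d)\<leftarrow>T. if fst (snd p) = y - j then eps p * fst (snd d) else 0)"
      by (simp only: case_prod_unfold sum_list_const_mult)
    also have "(\<Sum>(p, d)\<leftarrow>T. if fst (snd p) = y - j then eps p * fst (snd d) else 0) = 0"
    proof (cases "y - j \<in> {0..<b}")
      case True
      then show ?thesis using T unfolding box_table_def by blast
    next
      case False
      have "(case x of (p, d) \<Rightarrow> if fst (snd p) = y - j then eps p * fst (snd d) else 0) = 0" if "x \<in> set T" for x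
      proof -
        obtain p d where x: "x = (p, d)" by (cases x)
        then have "p \<in> {0..<a} \<times> {0..<b} \<times> {0..<4}" using that by (intro iffD2[OF box_keys] exI) simp
        then show ?thesis using False x by auto
      qed
      then show ?thesis by (simp add: sum_list_0 cong: map_cong)
    qed
    finally show ?thesis by simp
  qed
  have "twist_form ?R ?f = (\<Sum>p\<in>?R. \<Sum>q\<in>B. row_sign p q * w2 ?f q * w3 ?f p)"
    unfolding twist_form_def using fin BR w2o
    by (intro sum.cong refl sum.mono_neutral_right) auto
  also have "\<dots> = (\<Sum>p\<in>?R - B. \<Sum>q\<in>B. row_sign p q * w2 ?f q * w3 ?f p)
      + (\<Sum>p\<in>B. \<Sum>q\<in>B. row_sign p q * w2 ?f q * w3 ?f p)"
    by (rule sum.subset_diff[OF BR fin])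
  also have "(\<Sum>p\<in>?R - B. \<Sum>q\<in>B. row_sign p q * w2 ?f q * w3 ?f p) = 0"
  proof -
    let ?D = "D - {i..<i + a} \<times> {j..<j + b}"
    have RB: "?R - B = cylinder ?D 4" by (auto simp: memB mem_cylinder)
    have "(\<Sum>p\<in>?R - B. \<Sum>q\<in>B. row_sign p q * w2 ?f q * w3 ?f p)
      = (\<Sum>k<4. \<Sum>s\<in>?D. \<Sum>q\<in>B. row_sign (fst s, snd s, int k) q * w2 ?f q * w3 ?f (fst s, snd s, int k))"
      unfolding RB by (rule sum_cylinder_levels) (simp add: D)
    also have "\<dots> = (\<Sum>s\<in>?D. \<Sum>q\<in>B. \<Sum>k<4. row_sign (fst s, snd s, int k) q * w2 ?f q * w3 ?f (fst s, snd s, int k))"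
      by (subst sum.swap) (intro sum.cong refl sum.swap)
    also have "\<dots> = (\<Sum>s\<in>?D. \<Sum>q\<in>B. (sgn (i - fst s) * eps (fst s, snd s, 0)) * (if fst (snd q) = snd s then w2 ?f q else 0))"
    proof (intro sum.cong refl)
      fix s q assume s: "s \<in> ?D" and q: "q \<in> B"
      obtain x y where xy: "s = (x,y)" by (cases s)
      obtain x' y' k' where q': "q = (x',y',k')" by (cases q)
      have k': "0 \<le> k'" "k' < 4" "x' \<in> {i..<i + a}" "y' \<in> {j..<j + b}" using q by (auto simp: q' memB)
      have w3: "w3 ?f (x,y,int k) = eps (x,y,0)" if "k < 4" for k
      proof -
        have "(x,y,int k) \<notin> B" using s by (auto simp: memB xy)
        moreover have "(x,y,int k) \<in> ?R" using s that by (auto simp: mem_cylinder xy)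
        ultimately show ?thesis by (auto simp: w3_def out vert_field_def eps_def black_def)
      qed
      show "(\<Sum>k<4. row_sign (fst s, snd s, int k) q * w2 ?f q * w3 ?f (fst s, snd s, int k))
        = (sgn (i - fst s) * eps (fst s, snd s, 0)) * (if fst (snd q) = snd s then w2 ?f q else 0)"
      proof (cases "y = y'")
        case False
        then show ?thesis by (simp add: xy q' row_sign_def)
      next
        case True
        then have "x \<notin> {i..<i + a}" using s k'(4) by (auto simp: xy)
        then have sg: "sgn (x' - x) = sgn (i - x)" using k'(3) by (auto simp: sgn_if)
        have "(\<Sum>k<4. row_sign (x, y, int k) q * w2 ?f q * w3 ?f (x, y, int k))
          = (\<Sum>k<4. if k = nat k' then sgn (i - x) * w2 ?f q * eps (x,y,0) else 0)"
          using True k' by (intro sum.cong refl) (auto simp: q' row_sign_def sg w3[unfolded True])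
        also have "\<dots> = sgn (i - x) * w2 ?f q * eps (x,y,0)" using k' by (simp add: nat_less_iff)
        finally show ?thesis using True by (simp add: xy q')
      qed
    qed
    also have "\<dots> = 0"
    proof (rule sum.neutral, rule ballI)
      fix s
      show "(\<Sum>q\<in>B. (sgn (i - fst s) * eps (fst s, snd s, 0)) * (if fst (snd q) = snd s then w2 ?f q else 0)) = 0"
        unfolding sum_distrib_left[symmetric] rows by simp
    qed
    finally show ?thesis .
  qed
  also have "(\<Sum>p\<in>B. \<Sum>q\<in>B. row_sign p q * w2 ?f q * w3 ?f p) = table_form T"
  proof -
    let ?c = "(i,j,0) :: cube"
    have "(\<Sum>p\<in>B. \<Sum>q\<in>B. row_sign p q * w2 ?f q * w3 ?f p)
      = (\<Sum>p\<in>B. \<Sum>(q, e)\<leftarrow>T. row_sign p (?c + q) * (eps (?c + q) * fst (snd e)) * w3 ?f p)"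
    proof (rule sum.cong[OF refl])
      fix p
      show "(\<Sum>q\<in>B. row_sign p q * w2 ?f q * w3 ?f p)
        = (\<Sum>(q, e)\<leftarrow>T. row_sign p (?c + q) * (eps (?c + q) * fst (snd e)) * w3 ?f p)"
        unfolding B_def w2_def by (rule sum_box[of "\<lambda>q e. row_sign p q * (eps q * fst (snd e)) * w3 ?f p"])
    qed
    also have "\<dots> = (\<Sum>(p, d)\<leftarrow>T. \<Sum>(q, e)\<leftarrow>T. row_sign (?c + p) (?c + q) * (eps (?c + q) * fst (snd e)) * (eps (?c + p) * snd (snd d)))"
      unfolding B_def w3_def
      by (rule sum_box[of "\<lambda>p d. \<Sum>(q, e)\<leftarrow>T. row_sign p (?c + q) * (eps (?c + q) * fst (snd e)) * (eps p * snd (snd d))"])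
    also have "\<dots> = table_form T"
    proof -
      have K: "row_sign (?c + p) (?c + q) * (eps (?c + q) * e') * (eps (?c + p) * d')
        = row_sign p q * (eps q * e') * (eps p * d')" for p q e' d'
      proof -
        have "row_sign (?c + p) (?c + q) = row_sign p q" by (cases p, cases q) (auto simp: row_sign_def)
        moreover have "eps ?c = 1 \<or> eps ?c = -1" by (simp add: eps_def)
        ultimately show ?thesis by (auto simp: eps_mult)
      qed
      show ?thesis unfolding table_form_def by (simp only: K)
    qed
    finally show ?thesis .
  qed
  finally show ?thesis by simp
qed

end

lemma both_ends_append [simp]: "both_ends (xs @ ys) = both_ends xs @ both_ends ys"
  by (simp add: both_ends_def)

text \<open>
  The two tilings \<open>trit_before\<close> and \<open>trit_after\<close> of the same six cubes differ by a trit.  Each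
  frame consists of dominoes that complete both of them to a tiling of a box of height 4, for the two
  orientations of the rectangle.
\<close>

definition trit_before :: table where
  "trit_before = [((0,0,1), (1,0,0)), ((0,0,2), (0,1,0)), ((1,1,1), (0,0,1))]"
definition trit_after :: table where
  "trit_after = [((0,0,1), (0,0,1)), ((0,1,2), (1,0,0)), ((1,0,1), (0,1,0))]"
definition frame_3x2 :: table where
  "frame_3x2 = [((0,0,0), (1,0,0)), ((0,0,3), (0,1,0)), ((0,1,0), (0,0,1)), ((1,0,2), (0,0,1)),
     ((1,1,0), (1,0,0)), ((1,1,3), (1,0,0)), ((2,0,0), (0,0,1)), ((2,0,2), (0,0,1)), ((2,1,1), (0,0,1))]"
definition frame_2x3 :: table where
  "frame_2x3 = [((0,0,0), (1,0,0)), ((0,0,3), (0,1,0)), ((0,1,0), (0,0,1)), ((0,2,0), (0,0,1)),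
     ((0,2,2), (0,0,1)), ((1,0,2), (0,0,1)), ((1,1,0), (0,1,0)), ((1,1,3), (0,1,0)), ((1,2,1), (0,0,1))]"

lemma frame_tables:
  "box_table 3 2 (both_ends (frame_3x2 @ trit_before))" "box_table 3 2 (both_ends (frame_3x2 @ trit_after))"
  "box_table 2 3 (both_ends (frame_2x3 @ trit_before))" "box_table 2 3 (both_ends (frame_2x3 @ trit_after))"
  by (simp_all add: box_table_def both_ends_def frame_3x2_def frame_2x3_def trit_before_def trit_after_def
      steps_eq eps_def black_def zero_prod_def)

lemma frame_forms:
  "table_form (both_ends (frame_3x2 @ trit_before)) = 0" "table_form (both_ends (frame_3x2 @ trit_after)) = - 4"
  "table_form (both_ends (frame_2x3 @ trit_before)) = 0" "table_form (both_ends (frame_2x3 @ trit_after)) = - 4"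
  by (simp_all add: table_form_def both_ends_def frame_3x2_def frame_2x3_def trit_before_def trit_after_def
      eps_def black_def row_sign_def)

lemma trit_frame:
  assumes D: "finite D" and sub: "{i..<i + a} \<times> {j..<j + b} \<subseteq> D"
    and T: "box_table a b (both_ends (F @ trit_before))" and T': "box_table a b (both_ends (F @ trit_after))"
  shows "trit (dominoes (cylinder D 4) (box_field D i j (both_ends (F @ trit_before))))
              (dominoes (cylinder D 4) (box_field D i j (both_ends (F @ trit_after))))"
proof -
  let ?f = "box_field D i j (both_ends (F @ trit_before))"
  let ?g = "box_field D i j (both_ends (F @ trit_after))"
  let ?c = "(i,j,0) :: cube"
  define A :: "cube set" where "A = {(i,j,1), (i+1,j,1), (i,j,2), (i,j+1,2), (i+1,j+1,1), (i+1,j+1,2)}"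
  have f: "?f (?c + p) = d" if "(p, d) \<in> set (both_ends trit_before)" for p d
    using box_field_in[OF D T sub] that by simp
  have g: "?g (?c + p) = d" if "(p, d) \<in> set (both_ends trit_after)" for p d
    using box_field_in[OF D T' sub] that by simp
  have memF: "((0,0,1), (1,0,0)) \<in> set (both_ends trit_before)" "((1,0,1), (-1,0,0)) \<in> set (both_ends trit_before)" "((0,0,2), (0,1,0)) \<in> set (both_ends trit_before)" "((0,1,2), (0,-1,0)) \<in> set (both_ends trit_before)" "((1,1,1), (0,0,1)) \<in> set (both_ends trit_before)" "((1,1,2), (0,0,-1)) \<in> set (both_ends trit_before)"
    by (simp_all add: trit_before_def both_ends_def)
  have F: "?f (i,j,1) = (1,0,0)" "?f (i+1,j,1) = (-1,0,0)" "?f (i,j,2) = (0,1,0)" "?f (i,j+1,2) = (0,-1,0)" "?f (i+1,j+1,1) = (0,0,1)" "?f (i+1,j+1,2) = (0,0,-1)"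
    using f[OF memF(1)] f[OF memF(2)] f[OF memF(3)] f[OF memF(4)] f[OF memF(5)] f[OF memF(6)] by simp_all
  have memG: "((0,0,1), (0,0,1)) \<in> set (both_ends trit_after)" "((0,0,2), (0,0,-1)) \<in> set (both_ends trit_after)" "((0,1,2), (1,0,0)) \<in> set (both_ends trit_after)" "((1,1,2), (-1,0,0)) \<in> set (both_ends trit_after)" "((1,0,1), (0,1,0)) \<in> set (both_ends trit_after)" "((1,1,1), (0,-1,0)) \<in> set (both_ends trit_after)"
    by (simp_all add: trit_after_def both_ends_def)
  have G: "?g (i,j,1) = (0,0,1)" "?g (i,j,2) = (0,0,-1)" "?g (i,j+1,2) = (1,0,0)" "?g (i+1,j+1,2) = (-1,0,0)" "?g (i+1,j,1) = (0,1,0)" "?g (i+1,j+1,1) = (0,-1,0)"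
    using g[OF memG(1)] g[OF memG(2)] g[OF memG(3)] g[OF memG(4)] g[OF memG(5)] g[OF memG(6)] by simp_all
  have "retile A (dominoes (cylinder D 4) ?f) (dominoes (cylinder D 4) ?g)"
  proof (rule retile_dominoes[OF box_field[OF D T sub] box_field[OF D T' sub]])
    have K: "?c + p \<in> cylinder D 4" if "(p, d) \<in> set (both_ends trit_before)" for p d
    proof -
      have "(p, d) \<in> set (both_ends (F @ trit_before))" using that by simp
      then show ?thesis by (intro box_cylinder[OF D T sub] iffD2[OF box_keys[OF D T sub]] exI)
    qed
    show "A \<subseteq> cylinder D 4"
      using K[OF memF(1)] K[OF memF(2)] K[OF memF(3)] K[OF memF(4)] K[OF memF(5)] K[OF memF(6)]
      unfolding A_def by simp
    show "p + ?f p \<in> A" if "p \<in> A" for p using that F unfolding A_def by (elim insertE emptyE) simp_all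
    show "p + ?g p \<in> A" if "p \<in> A" for p using that G unfolding A_def by (elim insertE emptyE) simp_all
    show "?g p = ?f p" if "p \<notin> A" for p
    proof -
      have keys: "q + ?c \<in> A" if "q \<in> fst ` set (both_ends trit_before) \<union> fst ` set (both_ends trit_after)" for q
        using that by (auto simp: A_def trit_before_def trit_after_def both_ends_def)
      have "p - ?c \<notin> fst ` set (both_ends trit_before) \<union> fst ` set (both_ends trit_after)"
        using keys[of "p - ?c"] that by auto
      then have "map_of (both_ends trit_before) (p - ?c) = None" "map_of (both_ends trit_after) (p - ?c) = None"
        unfolding map_of_eq_None_iff by blast+
      then show ?thesis by (simp add: box_field_def map_add_def split: option.splits)
    qed
    show "?f \<noteq> ?g"
    proof
      assume "?f = ?g"
      then have "?f (i,j,1) = ?g (i,j,1)" by simp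
      then show False using F(1) G(1) by simp
    qed
  qed
  moreover have "A \<in> trit_regions"
  proof -
    have C: "({0, 1} \<times> {0, 1} \<times> {0, 1} - {(0,1,0), (1, 1, 1) - (0,1,0)} :: cube set)
      = {(0,0,0), (1,0,0), (0,0,1), (0,1,1), (1,1,0), (1,1,1)}"
      by auto
    have "A = (\<lambda>v. (i,j,1) + v) ` ({0, 1} \<times> {0, 1} \<times> {0, 1} - {(0,1,0), (1, 1, 1) - (0,1,0)})"
      unfolding C A_def by simp
    moreover have "(0,1,0) \<in> ({0, 1} \<times> {0, 1} \<times> {0, 1} :: cube set)" by simp
    ultimately show ?thesis unfolding trit_regions_def by (intro CollectI exI conjI)
  qed
  ultimately show ?thesis unfolding trit_def by blast
qed

text \<open>
  In both orientations the trit changes four times the twist in the direction of the first axis from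
  0 to \<open>-4\<close>.  The transposition that is used for the other directions turns this decrease of the
  twist into an increase, so the two tilings may have to exchange their roles; trits are reversible.
\<close>

theorem trit_changing_twist:
  assumes D: "finite D" and rect: "contains_2x3_rectangle D" and U: "U \<in> horizontals"
  shows "\<exists>s0\<in>tilings D 4. \<exists>s1\<in>tilings D 4. trit s0 s1 \<and> twist (corner U) s1 = twist (corner U) s0 + 1"
proof -
  have e1: "\<exists>s0\<in>tilings D 4. \<exists>s1\<in>tilings D 4. trit s0 s1 \<and> trit s1 s0 \<and>
      twist (corner (1,0,0)) s1 = twist (corner (1,0,0)) s0 + 1"
    if D: "finite D" and rect: "contains_2x3_rectangle D" for D
  proof -
    obtain i j a b F where sub: "{i..<i + a} \<times> {j..<j + b} \<subseteq> D"
      and T: "box_table a b (both_ends (F @ trit_before))" "box_table a b (both_ends (F @ trit_after))"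
      and v: "table_form (both_ends (F @ trit_before)) = 0" "table_form (both_ends (F @ trit_after)) = - 4"
    proof -
      from rect obtain i j where "{i..i + 1} \<times> {j..j + 2} \<subseteq> D \<or> {i..i + 2} \<times> {j..j + 1} \<subseteq> D"
        unfolding contains_2x3_rectangle_def by blast
      then have "{i..<i + 2} \<times> {j..<j + 3} \<subseteq> D \<or> {i..<i + 3} \<times> {j..<j + 2} \<subseteq> D"
      proof (rule disj_forward)
        assume "{i..i + 1} \<times> {j..j + 2} \<subseteq> D"
        moreover have "{i..i + 1} = {i..<i + 2}" "{j..j + 2} = {j..<j + 3}" by auto
        ultimately show "{i..<i + 2} \<times> {j..<j + 3} \<subseteq> D" by simp
      next
        assume "{i..i + 2} \<times> {j..j + 1} \<subseteq> D"
        moreover have "{i..i + 2} = {i..<i + 3}" "{j..j + 1} = {j..<j + 2}" by auto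
        ultimately show "{i..<i + 3} \<times> {j..<j + 2} \<subseteq> D" by simp
      qed
      then show thesis
      proof
        assume "{i..<i + 2} \<times> {j..<j + 3} \<subseteq> D"
        then show thesis using that[OF _ frame_tables(3,4) frame_forms(3,4)] by blast
      next
        assume "{i..<i + 3} \<times> {j..<j + 2} \<subseteq> D"
        then show thesis using that[OF _ frame_tables(1,2) frame_forms(1,2)] by blast
      qed
    qed
    let ?s = "\<lambda>T. dominoes (cylinder D 4) (box_field D i j T)"
    let ?b = "both_ends (F @ trit_before)" and ?a = "both_ends (F @ trit_after)"
    note fin = finite_cylinder[OF D, of 4]
    have til: "?s T \<in> tilings_of (cylinder D 4)" if "box_table a b T" for T
      using dominoes_tiling[OF box_field[OF D that sub]] .
    have tw: "4 * twist (corner (1,0,0)) (?s T) = of_int (table_form T)" if "box_table a b T" for T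
      using twist_e1[OF til[OF that] fin] dir_dominoes[OF box_field[OF D that sub]] twist_form_box[OF D that sub] by simp
    have trit: "trit (?s ?b) (?s ?a)" by (rule trit_frame[OF D sub T])
    have "twist (corner (1,0,0)) (?s ?b) = twist (corner (1,0,0)) (?s ?a) + 1"
      using tw[OF T(1)] tw[OF T(2)] v by simp
    then show ?thesis
      using til[OF T(1)] til[OF T(2)] trit trit_sym[OF til[OF T(1)] trit] unfolding tilings_def by blast
  qed
  have rect': "contains_2x3_rectangle (std_disk U D)"
  proof -
    have "A \<times> B \<subseteq> D \<Longrightarrow> B \<times> A \<subseteq> prod.swap ` D" for A B by force
    then show ?thesis using rect unfolding std_disk_def contains_2x3_rectangle_def by (cases "fst U = 0") (simp, blast, simp)
  qed
  obtain s0 s1 where s: "s0 \<in> tilings (std_disk U D) 4" "s1 \<in> tilings (std_disk U D) 4" "trit s0 s1" "trit s1 s0"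
      "twist (corner (1,0,0)) s1 = twist (corner (1,0,0)) s0 + 1"
    using e1[OF finite_std_disk[OF D] rect'] by blast
  define r0 r1 where r: "r0 = std_tiling U s0" "r1 = std_tiling U s1"
  have rt: "r0 \<in> tilings D 4" "r1 \<in> tilings D 4"
    using std_tiling_tilings[OF s(1), of U] std_tiling_tilings[OF s(2), of U] by (simp_all add: r)
  have "trit r0 r1" "trit r1 r0" using s(3,4) by (simp_all add: r trit_std)
  moreover have "twist (corner U) r1 = twist (corner U) r0 + 1 \<or> twist (corner U) r0 = twist (corner U) r1 + 1"
    using s(5) unfolding twist_std[OF D U rt(1)] twist_std[OF D U rt(2)] by (simp add: r)
  ultimately show ?thesis using rt by blast
qed

section \<open>Counting walks by blocks\<close>

definition walks :: "'e set \<Rightarrow> ('e \<Rightarrow> 'v) \<Rightarrow> ('e \<Rightarrow> 'v) \<Rightarrow> 'v \<Rightarrow> nat \<Rightarrow> 'v \<Rightarrow> 'e list set" where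
  "walks E src tgt v n w = {es. length es = n \<and> walk E src tgt v es w}"

lemma walk_end_unique: "walk E src tgt v es w \<Longrightarrow> walk E src tgt v es w' \<Longrightarrow> w = w'"
  by (induction es arbitrary: v) auto

lemma walk_start_unique: "walk E src tgt v es w \<Longrightarrow> walk E src tgt v' es w' \<Longrightarrow> es \<noteq> [] \<Longrightarrow> v = v'"
  by (cases es) auto

lemma walk_end_mem: "walk E src tgt v es w \<Longrightarrow> w \<in> insert v (tgt ` E)"
  by (induction es arbitrary: v) auto

lemma walk_concat_replicate: "walk E src tgt v es v \<Longrightarrow> walk E src tgt v (concat (replicate n es)) v"
  by (induction n) (auto simp: walk_append)

lemma finite_walks: "finite E \<Longrightarrow> finite (walks E src tgt v n w)"
  by (rule finite_subset[OF _ finite_lists_length_eq[of E n]]) (use walk_set in \<open>fastforce simp: walks_def\<close>)+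

text \<open>
  Given the vertex in between, the two parts of a walk can be chosen independently.
\<close>

lemma sum_walks_append:
  fixes f g :: "'e list \<Rightarrow> real"
  assumes E: "finite E"
  shows "(\<Sum>es\<in>walks E src tgt v (l + n) w. f (take l es) * g (drop l es)) =
    (\<Sum>u\<in>insert v (tgt ` E). (\<Sum>xs\<in>walks E src tgt v l u. f xs) * (\<Sum>ys\<in>walks E src tgt u n w. g ys))"
proof -
  let ?W = "walks E src tgt"
  let ?V = "insert v (tgt ` E)"
  have "(\<Sum>u\<in>?V. (\<Sum>xs\<in>?W v l u. f xs) * (\<Sum>ys\<in>?W u n w. g ys))
    = (\<Sum>u\<in>?V. \<Sum>(xs,ys)\<in>?W v l u \<times> ?W u n w. f xs * g ys)"
    by (simp add: sum_product sum.cartesian_product)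
  also have "\<dots> = (\<Sum>(u,xs,ys)\<in>(SIGMA u:?V. ?W v l u \<times> ?W u n w). f xs * g ys)"
    using E by (subst sum.Sigma) (auto simp: finite_walks)
  also have "\<dots> = (\<Sum>es\<in>?W v (l + n) w. f (take l es) * g (drop l es))"
  proof (rule sum.reindex_bij_witness[where j = "\<lambda>(u,xs,ys). xs @ ys"
        and i = "\<lambda>es. (THE u. walk E src tgt v (take l es) u, take l es, drop l es)"])
    fix a assume "a \<in> (SIGMA u:?V. ?W v l u \<times> ?W u n w)"
    then obtain u xs ys where a: "a = (u, xs, ys)" "xs \<in> ?W v l u" "ys \<in> ?W u n w" by auto
    have "(THE u. walk E src tgt v xs u) = u"
      using a(2) walk_end_unique by (auto simp: walks_def intro!: the_equality)
    then show "(THE u. walk E src tgt v (take l (case a of (u,xs,ys) \<Rightarrow> xs @ ys)) u,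
        take l (case a of (u,xs,ys) \<Rightarrow> xs @ ys), drop l (case a of (u,xs,ys) \<Rightarrow> xs @ ys)) = a"
      using a by (auto simp: walks_def)
    show "(case a of (u,xs,ys) \<Rightarrow> xs @ ys) \<in> ?W v (l + n) w"
      using a by (auto simp: walks_def walk_append)
    show "f (take l (case a of (u,xs,ys) \<Rightarrow> xs @ ys)) * g (drop l (case a of (u,xs,ys) \<Rightarrow> xs @ ys))
      = (case a of (u,xs,ys) \<Rightarrow> f xs * g ys)"
      using a by (auto simp: walks_def)
  next
    fix es assume es: "es \<in> ?W v (l + n) w"
    then have "walk E src tgt v (take l es @ drop l es) w" "length es = l + n" by (auto simp: walks_def)
    then obtain u where u: "walk E src tgt v (take l es) u" "walk E src tgt u (drop l es) w" "length es = l + n"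
      unfolding walk_append by blast
    have the: "(THE u. walk E src tgt v (take l es) u) = u"
      using u(1) walk_end_unique by (auto intro!: the_equality)
    show "(case (THE u. walk E src tgt v (take l es) u, take l es, drop l es) of (u,xs,ys) \<Rightarrow> xs @ ys) = es"
      by simp
    show "(THE u. walk E src tgt v (take l es) u, take l es, drop l es) \<in> (SIGMA u:?V. ?W v l u \<times> ?W u n w)"
      unfolding the using u walk_end_mem[OF u(1)] by (auto simp: walks_def)
  qed
  finally show ?thesis by simp
qed

text \<open>
  Blocks of length \<open>l\<close> are cut off one after the other.  What follows the \<open>n\<close>-th block is
  ignored, so a length that is no multiple of \<open>l\<close> does no harm.
\<close>

primrec good_blocks :: "('e list \<Rightarrow> bool) \<Rightarrow> nat \<Rightarrow> nat \<Rightarrow> 'e list \<Rightarrow> nat" where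
  "good_blocks P l 0 es = 0"
| "good_blocks P l (Suc n) es = of_bool (P (take l es)) + good_blocks P l n (drop l es)"

text \<open>
  An exponential moment.  Between two given vertices there are at most \<open>B\<close> blocks, and if there is
  any then one of them is good.  So the mean of \<open>(1/2) ^ of_bool (P xs)\<close> over these blocks is at
  most \<open>1 - 1 / (2 * B)\<close>.  By \<open>sum_walks_append\<close> these factors multiply.
\<close>

lemma good_blocks_moment:
  fixes B :: real
  assumes E: "finite E" and B: "B \<ge> 1"
    and cB: "\<And>v u. real (card (walks E src tgt v l u)) \<le> B"
    and ex: "\<And>p v u. walk E src tgt v0 p v \<Longrightarrow> walks E src tgt v l u \<noteq> {} \<Longrightarrow> \<exists>xs\<in>walks E src tgt v l u. P xs"
    and v: "walk E src tgt v0 q v"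
  shows "(\<Sum>es\<in>walks E src tgt v (n * l + r) w. (1/2) ^ good_blocks P l n es)
     \<le> (1 - 1 / (2 * B)) ^ n * real (card (walks E src tgt v (n * l + r) w))"
  using v
proof (induction n arbitrary: v q)
  case 0
  then show ?case by simp
next
  case (Suc n)
  let ?W = "walks E src tgt"
  let ?V = "insert v (tgt ` E)"
  let ?\<rho> = "1 - 1 / (2 * B)"
  have \<rho>: "0 \<le> ?\<rho>" using B by simp
  have len: "Suc n * l + r = l + (n * l + r)" by simp
  have "(\<Sum>es\<in>?W v (Suc n * l + r) w. (1/2) ^ good_blocks P l (Suc n) es)
    = (\<Sum>es\<in>?W v (l + (n * l + r)) w. (1/2) ^ of_bool (P (take l es)) * (1/2) ^ good_blocks P l n (drop l es) :: real)"
    unfolding len by (simp add: power_add)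
  also have "\<dots> = (\<Sum>u\<in>?V. (\<Sum>xs\<in>?W v l u. (1/2) ^ of_bool (P xs)) * (\<Sum>ys\<in>?W u (n * l + r) w. (1/2) ^ good_blocks P l n ys))"
    by (rule sum_walks_append[OF E, where f = "\<lambda>xs. (1/2) ^ of_bool (P xs)" and g = "\<lambda>ys. (1/2) ^ good_blocks P l n ys"])
  also have "\<dots> \<le> (\<Sum>u\<in>?V. (?\<rho> * real (card (?W v l u))) * (?\<rho> ^ n * real (card (?W u (n * l + r) w))))"
  proof (rule sum_mono)
    fix u assume "u \<in> ?V"
    show "(\<Sum>xs\<in>?W v l u. (1/2) ^ of_bool (P xs)) * (\<Sum>ys\<in>?W u (n * l + r) w. (1/2) ^ good_blocks P l n ys)
      \<le> (?\<rho> * real (card (?W v l u))) * (?\<rho> ^ n * real (card (?W u (n * l + r) w)))"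
    proof (cases "?W v l u = {}")
      case True
      then show ?thesis by simp
    next
      case False
      then obtain xs where xs: "xs \<in> ?W v l u" "P xs" using ex[OF Suc.prems False] by blast
      have fin: "finite (?W v l u)" by (rule finite_walks[OF E])
      have "(\<Sum>ys\<in>?W v l u. (1/2) ^ of_bool (P ys)) = (1/2) ^ of_bool (P xs) + (\<Sum>ys\<in>?W v l u - {xs}. (1/2) ^ of_bool (P ys) :: real)"
        by (rule sum.remove[OF fin xs(1)])
      also have "(\<Sum>ys\<in>?W v l u - {xs}. (1/2) ^ of_bool (P ys) :: real) \<le> (\<Sum>ys\<in>?W v l u - {xs}. 1)"
        by (rule sum_mono) (simp add: of_bool_def)
      also have "(\<Sum>ys\<in>?W v l u - {xs}. 1) = real (card (?W v l u)) - 1"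
      proof -
        have "card (?W v l u) > 0" using fin xs(1) by (auto simp: card_gt_0_iff)
        then show ?thesis using fin xs(1) by (simp add: card_Diff_singleton of_nat_diff Suc_le_eq)
      qed
      finally have 1: "(\<Sum>ys\<in>?W v l u. (1/2) ^ of_bool (P ys)) \<le> real (card (?W v l u)) - 1 / 2"
        using xs(2) by simp
      have "real (card (?W v l u)) / (2 * B) \<le> 1 / 2" using cB[of v u] B by (simp add: field_simps)
      with 1 have a: "(\<Sum>ys\<in>?W v l u. (1/2) ^ of_bool (P ys)) \<le> ?\<rho> * real (card (?W v l u))"
        by (simp add: left_diff_distrib)
      have "walk E src tgt v0 (q @ xs) u" using Suc.prems xs(1) by (auto simp: walk_append walks_def)
      from Suc.IH[OF this] show ?thesis
        by (intro mult_mono a) (auto intro!: sum_nonneg mult_nonneg_nonneg \<rho>)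
    qed
  qed
  also have "\<dots> = ?\<rho> ^ Suc n * (\<Sum>u\<in>?V. (\<Sum>xs\<in>?W v l u. 1) * (\<Sum>ys\<in>?W u (n * l + r) w. 1))"
    by (simp add: sum_distrib_left mult_ac)
  also have "(\<Sum>u\<in>?V. (\<Sum>xs\<in>?W v l u. 1) * (\<Sum>ys\<in>?W u (n * l + r) w. 1)) = real (card (?W v (Suc n * l + r) w))"
    using sum_walks_append[OF E, where f = "\<lambda>_. 1" and g = "\<lambda>_. 1" and l = l and n = "n * l + r" and v = v and w = w and src = src and tgt = tgt] unfolding len by simp
  finally show ?case .
qed

text \<open>
  Markov's inequality for the moment in \<open>good_blocks_moment\<close>.
\<close>

lemma few_good_blocks:
  fixes B :: real
  assumes E: "finite E" and B: "B \<ge> 1"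
    and cB: "\<And>v u. real (card (walks E src tgt v l u)) \<le> B"
    and ex: "\<And>p v u. walk E src tgt v0 p v \<Longrightarrow> walks E src tgt v l u \<noteq> {} \<Longrightarrow> \<exists>xs\<in>walks E src tgt v l u. P xs"
  shows "real (card {es \<in> walks E src tgt v0 N w. good_blocks P l (N div l) es < m})
     \<le> 2 ^ m * (1 - 1 / (2 * B)) ^ (N div l) * real (card (walks E src tgt v0 N w))"
proof -
  let ?W = "walks E src tgt v0 N w"
  let ?S = "{es \<in> ?W. good_blocks P l (N div l) es < m}"
  have fin: "finite ?W" by (rule finite_walks[OF E])
  have "real (card ?S) * (1/2) ^ m = (\<Sum>es\<in>?S. (1/2) ^ m)" by simp
  also have "\<dots> \<le> (\<Sum>es\<in>?S. (1/2) ^ good_blocks P l (N div l) es)"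
    by (rule sum_mono) (auto intro!: power_decreasing)
  also have "\<dots> \<le> (\<Sum>es\<in>?W. (1/2) ^ good_blocks P l (N div l) es)"
    by (rule sum_mono2) (use fin in auto)
  also have "\<dots> \<le> (1 - 1 / (2 * B)) ^ (N div l) * real (card ?W)"
    using good_blocks_moment[OF E B cB ex, where q = "[]" and v = v0 and n = "N div l" and r = "N mod l" and w = w] by simp
  finally show ?thesis by (simp add: field_simps power_one_over)
qed

lemma walk_rev:
  assumes rv: "\<And>e. e \<in> E \<Longrightarrow> rv e \<in> E \<and> src (rv e) = tgt e \<and> tgt (rv e) = src e"
  shows "walk E src tgt v es w \<Longrightarrow> walk E src tgt w (rev (map rv es)) v"
  by (induction es arbitrary: v) (auto simp: walk_append rv)

text \<open>
  Look at the walk at the multiples of an even number \<open>h\<close>.  If the walk is long enough then two of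
  these vertices agree.  The part of the walk between them is exchanged for a way back to \<open>v0\<close>, the
  walk \<open>s\<close>, repetitions of the closed walk \<open>two\<close> that make up for the length, and the same way
  from \<open>v0\<close> again.  The map \<open>rv\<close>, which reverses edges, provides the way back.  The way and its
  reversal have together an even length, so the lengths match as \<open>K\<close> is even.  If \<open>h\<close> is large then
  the new part fits.
\<close>

lemma block_insertion:
  assumes E: "finite E"
    and rv: "\<And>e. e \<in> E \<Longrightarrow> rv e \<in> E \<and> src (rv e) = tgt e \<and> tgt (rv e) = src e"
    and two: "walk E src tgt v0 two v0" "length two = 2" and K: "even K"
  obtains l where "l > 0"
    "\<And>p v u. walk E src tgt v0 p v \<Longrightarrow> walks E src tgt v l u \<noteq> {} \<Longrightarrow>
       \<exists>xs ys. \<forall>s. length s = K \<longrightarrow> walk E src tgt v0 s v0 \<longrightarrow> xs @ s @ ys \<in> walks E src tgt v l u"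
proof -
  (* The reachable vertices, each with a fixed way to it from v0. *)
  define V where "V = {v \<in> insert v0 (tgt ` E). \<exists>p. walk E src tgt v0 p v}"
  have fV: "finite V" using E by (simp add: V_def)
  have "\<forall>v\<in>V. \<exists>p. walk E src tgt v0 p v" by (simp add: V_def)
  then obtain path where path: "\<And>v. v \<in> V \<Longrightarrow> walk E src tgt v0 (path v) v" by metis
  have "finite ((\<lambda>v. length (path v)) ` V)" using fV by simp
  then obtain A where A: "\<And>v. v \<in> V \<Longrightarrow> length (path v) \<le> A"
    by (meson bdd_above.E bdd_above_finite image_eqI)
  define h where "h = 2 * A + K + 2"
  define n where "n = card V + 1"
  have h: "h > 0" "even h" using K by (simp_all add: h_def)
  show thesis
  proof (rule that[of "n * h"])
    show "n * h > 0" using h by (simp add: n_def)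
    fix p v u assume p: "walk E src tgt v0 p v" and ne: "walks E src tgt v (n * h) u \<noteq> {}"
    then obtain es where es: "length es = n * h" "walk E src tgt v es u" by (auto simp: walks_def)
    have "\<exists>x. walk E src tgt v (take (i * h) es) x \<and> walk E src tgt x (drop (i * h) es) u" for i
      using es(2) walk_append[of E src tgt v "take (i * h) es" "drop (i * h) es" u] by simp
    then obtain x where x: "\<And>i. walk E src tgt v (take (i * h) es) (x i)" "\<And>i. walk E src tgt (x i) (drop (i * h) es) u"
      by metis
    have xV: "x i \<in> V" for i
    proof -
      have "walk E src tgt v0 (p @ take (i * h) es) (x i)" using p x(1) by (auto simp: walk_append)
      then show ?thesis using walk_end_mem[of E src tgt v0 "p @ take (i * h) es" "x i"] by (auto simp: V_def)
    qed
    (* There are n + 1 multiples of h up to n * h, one more than reachable vertices. *)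
    have "\<not> inj_on x {0..n}"
    proof
      assume "inj_on x {0..n}"
      then have "card {0..n} \<le> card V" using xV fV by (intro card_inj_on_le[of x]) auto
      then show False by (simp add: n_def)
    qed
    then obtain i j where ij: "i < j" "j \<le> n" "x i = x j"
      unfolding inj_on_def by (metis atLeastAtMost_iff linorder_neqE_nat)
    define z where "z = x i"
    have zV: "z \<in> V" using xV by (simp add: z_def)
    define a where "a = take (i * h) es"
    define c where "c = drop (j * h) es"
    have la: "length a = i * h" "length c = (n - j) * h"
      using es(1) ij by (simp_all add: a_def c_def min_def diff_mult_distrib)
    define q where "q = ((j - i) * h - K - 2 * length (path z)) div 2"
    have hle: "h \<le> (j - i) * h" using ij(1) by (simp add: Suc_le_eq)
    have "2 * length (path z) + K \<le> h" using A[OF zV] by (simp add: h_def)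
    then have "2 * length (path z) + K \<le> (j - i) * h" using hle by (rule order_trans)
    moreover have "even ((j - i) * h)" using h(2) by simp
    moreover have "2 * b + K + 2 * ((m - K - 2 * b) div 2) = m" if "2 * b + K \<le> m" "even m" for m b :: nat
      using that K by presburger
    ultimately have q: "2 * length (path z) + K + 2 * q = (j - i) * h"
      unfolding q_def by blast
    define home where "home = rev (map rv (path z))"
    define pad where "pad = concat (replicate q two)"
    have lens: "length home = length (path z)" "length pad = 2 * q"
      using two(2) by (simp_all add: home_def pad_def length_concat sum_list_replicate)
    have wb: "walk E src tgt z home v0" unfolding home_def by (rule walk_rev[OF rv path[OF zV]])
    have wp: "walk E src tgt v0 pad v0" unfolding pad_def by (rule walk_concat_replicate[OF two(1)])
    have "(a @ home) @ s @ (pad @ path z @ c) \<in> walks E src tgt v (n * h) u"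
      if s: "length s = K" "walk E src tgt v0 s v0" for s
    proof -
      have "length ((a @ home) @ s @ (pad @ path z @ c)) = i * h + (2 * length (path z) + K + 2 * q) + (n - j) * h"
        by (simp add: la lens s(1))
      also have "\<dots> = (i + (j - i) + (n - j)) * h" unfolding q by (simp add: algebra_simps)
      also have "\<dots> = n * h" using ij by simp
      finally have len: "length ((a @ home) @ s @ (pad @ path z @ c)) = n * h" .
      have "walk E src tgt v a z" using x(1)[of i] by (simp add: a_def z_def)
      moreover have "walk E src tgt z c u" using x(2)[of j] ij(3) by (simp add: c_def z_def)
      ultimately have "walk E src tgt v ((a @ home) @ s @ (pad @ path z @ c)) u"
        using wb s(2) wp path[OF zV] unfolding walk_append by blast
      with len show ?thesis by (simp add: walks_def)
    qed
    then show "\<exists>xs ys. \<forall>s. length s = K \<longrightarrow> walk E src tgt v0 s v0 \<longrightarrow> xs @ s @ ys \<in> walks E src tgt v (n * h) u"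
      by blast
  qed
qed

definition improvable :: "'e set \<Rightarrow> ('e \<Rightarrow> 'v) \<Rightarrow> ('e \<Rightarrow> 'v) \<Rightarrow> ('e \<Rightarrow> int) \<Rightarrow> nat \<Rightarrow> 'e list \<Rightarrow> bool" where
  "improvable E src tgt wt l xs \<longleftrightarrow>
     (\<exists>v u. xs \<in> walks E src tgt v l u \<and> (\<exists>ys\<in>walks E src tgt v l u. sum_list (map wt xs) < sum_list (map wt ys)))"

text \<open>
  Improve all improvable blocks at once.  The weights are integers, so each of them gains at least 1.
\<close>

lemma improve_blocks:
  assumes l: "l > 0"
  shows "es \<in> walks E src tgt v (n * l + r) w \<Longrightarrow>
    \<exists>es'\<in>walks E src tgt v (n * l + r) w.
      sum_list (map wt es) + int (good_blocks (improvable E src tgt wt l) l n es) \<le> sum_list (map wt es')"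
proof (induction n arbitrary: v es)
  case 0
  then show ?case by auto
next
  case (Suc n)
  let ?x = "take l es" and ?y = "drop l es"
  have len: "length es = l + (n * l + r)" and "walk E src tgt v (?x @ ?y) w"
    using Suc.prems by (auto simp: walks_def)
  then obtain u where u: "walk E src tgt v ?x u" "walk E src tgt u ?y w" unfolding walk_append by blast
  have x: "?x \<in> walks E src tgt v l u" and "?y \<in> walks E src tgt u (n * l + r) w"
    using u len by (auto simp: walks_def)
  from Suc.IH[OF this(2)] obtain y' where y': "y' \<in> walks E src tgt u (n * l + r) w"
    "sum_list (map wt ?y) + int (good_blocks (improvable E src tgt wt l) l n ?y) \<le> sum_list (map wt y')" by blast
  have "\<exists>x'\<in>walks E src tgt v l u. sum_list (map wt ?x) + of_bool (improvable E src tgt wt l ?x) \<le> sum_list (map wt x')"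
  proof (cases "improvable E src tgt wt l ?x")
    case True
    then obtain v' u' x' where x': "?x \<in> walks E src tgt v' l u'" "x' \<in> walks E src tgt v' l u'"
      "sum_list (map wt ?x) < sum_list (map wt x')" unfolding improvable_def by blast
    have "?x \<noteq> []" using l len by auto
    then have "v' = v" "u' = u"
      using x x'(1) walk_start_unique[of E src tgt v ?x u v' u'] walk_end_unique[of E src tgt v ?x u u']
      by (auto simp: walks_def)
    then show ?thesis using x' True by force
  next
    case False
    then show ?thesis using x by force
  qed
  then obtain x' where x': "x' \<in> walks E src tgt v l u"
    "sum_list (map wt ?x) + of_bool (improvable E src tgt wt l ?x) \<le> sum_list (map wt x')" by blast
  have "x' @ y' \<in> walks E src tgt v (Suc n * l + r) w"
    using x'(1) y'(1) by (auto simp: walks_def walk_append)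
  moreover have "sum_list (map wt es) = sum_list (map wt ?x) + sum_list (map wt ?y)"
    by (metis append_take_drop_id map_append sum_list_append)
  ultimately show ?case using x'(2) y'(2) by (intro bexI[of _ "x' @ y'"]) auto
qed

lemma filter_good_blocks:
  "good_blocks (\<lambda>xs. \<exists>x\<in>set xs. Q x) l n es \<le> length (filter Q es)"
proof (induction n arbitrary: es)
  case (Suc n)
  have "length (filter Q es) = length (filter Q (take l es)) + length (filter Q (drop l es))"
    by (metis append_take_drop_id filter_append length_append)
  moreover have "of_bool (\<exists>x\<in>set (take l es). Q x) \<le> length (filter Q (take l es))"
    by (auto simp: Suc_le_eq filter_empty_conv)
  ultimately show ?case using Suc[of "drop l es"] by simp
qed simp

section \<open>Tilings with few vertical floors or extreme twist\<close>

text \<open>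
  This involution on floors reverses the edges of the graph of plugs, which lets \<open>block_insertion\<close>
  walk back to the empty plug.
\<close>

definition rev_floor :: "floor \<Rightarrow> floor" where
  "rev_floor g = (\<lambda>s. (fst (g s), fst (snd (g s)), - snd (snd (g s))))"

lemma rev_floor:
  assumes g: "floor_on D g"
  shows "floor_on D (rev_floor g)" "lower_plug (rev_floor g) = upper_plug g" "upper_plug (rev_floor g) = lower_plug g"
proof -
  have st: "a \<in> steps \<Longrightarrow> (fst a, fst (snd a), - snd (snd a)) \<in> steps" for a by (cases a) (auto simp: steps_eq)
  show "floor_on D (rev_floor g)"
    unfolding floor_on_def
  proof (intro conjI ballI allI impI)
    fix s assume s: "s \<in> D"
    then show "rev_floor g s \<in> steps" using g st unfolding floor_on_def rev_floor_def by blast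
    assume "snd (snd (rev_floor g s)) = 0"
    then have h: "snd (snd (g s)) = 0" by (simp add: rev_floor_def)
    let ?s = "(fst s + fst (g s), snd s + fst (snd (g s)))"
    have "?s \<in> D \<and> g ?s = - g s" using g s h unfolding floor_on_def by blast
    then show "(fst s + fst (rev_floor g s), snd s + fst (snd (rev_floor g s))) \<in> D"
      "rev_floor g (fst s + fst (rev_floor g s), snd s + fst (snd (rev_floor g s))) = - rev_floor g s"
      by (simp_all add: rev_floor_def)
  next
    fix s assume "s \<notin> D"
    then have "g s = 0" using g unfolding floor_on_def by blast
    then show "rev_floor g s = 0" by (simp add: rev_floor_def zero_prod_def)
  qed
  have "rev_floor g s = (0,0,-1) \<longleftrightarrow> g s = (0,0,1)" "rev_floor g s = (0,0,1) \<longleftrightarrow> g s = (0,0,-1)" for s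
    using minus_equation_iff[of "snd (snd (g s))" 1] by (cases "g s", force simp: rev_floor_def)+
  then show "lower_plug (rev_floor g) = upper_plug g" "upper_plug (rev_floor g) = lower_plug g"
    by (simp_all add: lower_plug_def upper_plug_def)
qed

abbreviation floor_walks :: "square set \<Rightarrow> square set \<Rightarrow> nat \<Rightarrow> square set \<Rightarrow> floor list set" where
  "floor_walks D \<equiv> walks (Collect (floor_on D)) lower_plug upper_plug"

lemma bij_betw_floor_walks: "bij_betw (tiling_floors N) (tilings D N) (floor_walks D {} N {})"
  using bij_betw_tiling_floors[of N D] by (simp add: walks_def)

lemma card_tilings_le:
  assumes D: "finite D" and R: "\<And>t. t \<in> tilings D N \<Longrightarrow> R t \<Longrightarrow> R' (tiling_floors N t)"
  shows "card {t \<in> tilings D N. R t} \<le> card {es \<in> floor_walks D {} N {}. R' es}"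
proof (rule card_inj_on_le)
  show "inj_on (tiling_floors N) {t \<in> tilings D N. R t}"
    using bij_betw_floor_walks[of N D] unfolding bij_betw_def by (auto intro: inj_on_subset)
  show "tiling_floors N ` {t \<in> tilings D N. R t} \<subseteq> {es \<in> floor_walks D {} N {}. R' es}"
    using bij_betw_floor_walks[of N D] R unfolding bij_betw_def by blast
  show "finite {es \<in> floor_walks D {} N {}. R' es}"
    by (rule finite_subset[OF _ finite_walks[OF finite_floors[OF D]]]) blast
qed

lemma finite_tilings: "finite D \<Longrightarrow> finite (tilings D N)"
  unfolding bij_betw_finite[OF bij_betw_floor_walks[of N D]] by (rule finite_walks[OF finite_floors])

text \<open>
  Three kinds of blocks are unavoidable in the sense of \<open>few_good_blocks\<close>, as one can insert
  by \<open>block_insertion\<close> a tiling of height 4 with vertical floors, or the two tilings of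
  \<open>trit_changing_twist\<close>: the blocks with a vertical floor, those whose twist can be increased, and
  those whose twist can be decreased.  A tiling with few vertical floors has few blocks of the first
  kind.  A tiling with large twist has few of the second kind, because by \<open>improve_blocks\<close> the
  number of these blocks is at most four times the difference between \<open>c * N\<close> and the twist.
  In the same way a tiling with very negative twist has few blocks of the third kind.
\<close>

theorem rare_tilings:
  fixes c b :: real
  assumes D: "finite D" and rect: "contains_2x3_rectangle D" and U: "U \<in> horizontals"
    and bound: "\<And>N t. t \<in> tilings D N \<Longrightarrow> \<bar>twist (corner U) t\<bar> \<le> c * real N"
  obtains \<rho> C :: real and l :: nat where "0 < \<rho>" "\<rho> < 1" "0 \<le> C" "0 < l"
    "\<And>N. real (card {t \<in> tilings D N. num_vertical_floors N t < M \<or> c * real N - b \<le> \<bar>twist (corner U) t\<bar>})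
       \<le> C * \<rho> ^ (N div l) * real (card (tilings D N))"
proof -
  let ?E = "Collect (floor_on D)"
  let ?W = "floor_walks D"
  have E: "finite ?E" by (rule finite_floors[OF D])
  have rv: "rev_floor e \<in> ?E \<and> lower_plug (rev_floor e) = upper_plug e \<and> upper_plug (rev_floor e) = lower_plug e"
    if "e \<in> ?E" for e using rev_floor[of D e] that by simp
  have tw: "floor_walk D {} (tiling_floors 2 (t_vert D 2)) {}"
    by (rule tiling_floors_walk[OF t_vert_tilings]) simp
  obtain l where l: "l > 0" and ins: "\<And>p v u. floor_walk D {} p v \<Longrightarrow> ?W v l u \<noteq> {} \<Longrightarrow>
       \<exists>xs ys. \<forall>s. length s = 4 \<longrightarrow> floor_walk D {} s {} \<longrightarrow> xs @ s @ ys \<in> ?W v l u"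
    using block_insertion[OF E rv tw, of 4] by auto
  obtain s0 s1 where s: "s0 \<in> tilings D 4" "s1 \<in> tilings D 4"
    "twist (corner U) s1 = twist (corner U) s0 + 1"
    using trit_changing_twist[OF D rect U] by blast
  define wt where "wt = floor_weight D U"
  define tot where "tot es = sum_list (map wt es)" for es
  have tot: "4 * twist (corner U) t = of_int (tot (tiling_floors N t))" if "t \<in> tilings D N" for N t
    using twist_floors[OF D U that] by (simp add: tot_def wt_def)
  have s_tot: "tot (tiling_floors 4 s1) = tot (tiling_floors 4 s0) + 4"
    using tot[OF s(1)] tot[OF s(2)] s(3) by linarith
  define P1 where "P1 = (\<lambda>xs. \<exists>x\<in>set xs. vertical_floor_field D x)"
  define P2 where "P2 = improvable ?E lower_plug upper_plug wt l"
  define P3 where "P3 = improvable ?E lower_plug upper_plug (\<lambda>g. - wt g) l"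
  have neg: "sum_list (map (\<lambda>g. - wt g) es) = - tot es" for es
    by (induction es) (simp_all add: tot_def)
  have ex: "(\<exists>xs\<in>?W v l u. P1 xs) \<and> (\<exists>xs\<in>?W v l u. P2 xs) \<and> (\<exists>xs\<in>?W v l u. P3 xs)"
    if pv: "floor_walk D {} p v" "?W v l u \<noteq> {}" for p v u
  proof -
    obtain xs ys where xy: "\<And>s. length s = 4 \<Longrightarrow> floor_walk D {} s {} \<Longrightarrow> xs @ s @ ys \<in> ?W v l u"
      using ins[OF pv] by blast
    let ?v = "tiling_floors 4 (t_vert D 4)" and ?s0 = "tiling_floors 4 s0" and ?s1 = "tiling_floors 4 s1"
    have tv: "t_vert D 4 \<in> tilings D 4" by (rule t_vert_tilings) simp
    have m: "xs @ ?v @ ys \<in> ?W v l u" "xs @ ?s0 @ ys \<in> ?W v l u" "xs @ ?s1 @ ys \<in> ?W v l u"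
      using xy tiling_floors_walk[OF tv] tiling_floors_walk[OF s(1)] tiling_floors_walk[OF s(2)] by simp_all
    have "length (filter (vertical_floor_field D) ?v) = 4"
      using num_vertical_floors_eq[OF tv] num_vertical_floors_t_vert[of 4 D] by simp
    then have "\<exists>x\<in>set ?v. vertical_floor_field D x" by (metis filter_False list.size(3) zero_neq_numeral)
    then have "P1 (xs @ ?v @ ys)" by (auto simp: P1_def)
    moreover have "tot (xs @ ?s0 @ ys) < tot (xs @ ?s1 @ ys)" using s_tot by (simp add: tot_def)
    then have "P2 (xs @ ?s0 @ ys)" "P3 (xs @ ?s1 @ ys)"
      using m unfolding P2_def P3_def improvable_def neg unfolding tot_def by force+
    ultimately show ?thesis using m by blast
  qed
  define B where "B = real (card {xs. set xs \<subseteq> ?E \<and> length xs = l}) + 1"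
  have B: "B \<ge> 1" by (simp add: B_def)
  have cB: "real (card (?W v l u)) \<le> B" for v u
  proof -
    have "card (?W v l u) \<le> card {xs. set xs \<subseteq> ?E \<and> length xs = l}"
      by (rule card_mono[OF finite_lists_length_eq[OF E]]) (use walk_set in \<open>fastforce simp: walks_def\<close>)
    then show ?thesis by (simp add: B_def)
  qed
  (* Four times b, because the weights are four times the twists. *)
  define m where "m = max M (nat \<lceil>4 * b\<rceil> + 1)"
  have bm: "4 * b < real m" by (simp add: m_def) linarith
  define \<rho> where "\<rho> = 1 - 1 / (2 * B)"
  have \<rho>: "0 < \<rho>" "\<rho> < 1" using B by (simp_all add: \<rho>_def field_simps)
  have few: "real (card {es \<in> ?W {} N {}. good_blocks P l (N div l) es < m})
     \<le> 2 ^ m * \<rho> ^ (N div l) * real (card (tilings D N))" if "P \<in> {P1, P2, P3}" for P N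
  proof -
    have "real (card {es \<in> ?W {} N {}. good_blocks P l (N div l) es < m})
      \<le> 2 ^ m * (1 - 1 / (2 * B)) ^ (N div l) * real (card (?W {} N {}))"
      by (rule few_good_blocks[OF E B cB]) (use that ex in blast)
    then show ?thesis unfolding \<rho>_def bij_betw_same_card[OF bij_betw_floor_walks] .
  qed
  have improve: "\<exists>t'\<in>tilings D N. tot (tiling_floors N t) + int (good_blocks P2 l (N div l) (tiling_floors N t)) \<le> tot (tiling_floors N t')"
    "\<exists>t'\<in>tilings D N. - tot (tiling_floors N t) + int (good_blocks P3 l (N div l) (tiling_floors N t)) \<le> - tot (tiling_floors N t')"
    if t: "t \<in> tilings D N" for N t
  proof -
    have W: "tiling_floors N t \<in> ?W {} ((N div l) * l + N mod l) {}"
      using bij_betw_floor_walks[of N D] t by (auto simp: bij_betw_def)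
    have im: "?W {} ((N div l) * l + N mod l) {} = tiling_floors N ` tilings D N"
      using bij_betw_floor_walks[of N D] by (simp add: bij_betw_def)
    show "\<exists>t'\<in>tilings D N. tot (tiling_floors N t) + int (good_blocks P2 l (N div l) (tiling_floors N t)) \<le> tot (tiling_floors N t')"
      using improve_blocks[OF l W, of wt] unfolding im P2_def tot_def by blast
    show "\<exists>t'\<in>tilings D N. - tot (tiling_floors N t) + int (good_blocks P3 l (N div l) (tiling_floors N t)) \<le> - tot (tiling_floors N t')"
      using improve_blocks[OF l W, of "\<lambda>g. - wt g"] unfolding im P3_def neg by blast
  qed
  have "real (card {t \<in> tilings D N. num_vertical_floors N t < M \<or> c * real N - b \<le> \<bar>twist (corner U) t\<bar>})
       \<le> (3 * 2 ^ m) * \<rho> ^ (N div l) * real (card (tilings D N))" for N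
  proof -
    let ?A = "{t \<in> tilings D N. num_vertical_floors N t < M}"
    let ?B = "{t \<in> tilings D N. c * real N - b \<le> twist (corner U) t}"
    let ?C = "{t \<in> tilings D N. c * real N - b \<le> - twist (corner U) t}"
    let ?X = "2 ^ m * \<rho> ^ (N div l) * real (card (tilings D N))"
    have "card ?A \<le> card {es \<in> ?W {} N {}. good_blocks P1 l (N div l) es < m}"
    proof (rule card_tilings_le[OF D])
      fix t assume "t \<in> tilings D N" "num_vertical_floors N t < M"
      then show "good_blocks P1 l (N div l) (tiling_floors N t) < m"
        using filter_good_blocks[of "vertical_floor_field D" l "N div l" "tiling_floors N t"]
        by (simp add: P1_def m_def num_vertical_floors_eq)
    qed
    then have A: "real (card ?A) \<le> ?X" using few[of P1 N] by simp
    have "card ?B \<le> card {es \<in> ?W {} N {}. good_blocks P2 l (N div l) es < m}"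
    proof (rule card_tilings_le[OF D])
      fix t assume t: "t \<in> tilings D N" and large: "c * real N - b \<le> twist (corner U) t"
      obtain t' where t': "t' \<in> tilings D N"
        "tot (tiling_floors N t) + int (good_blocks P2 l (N div l) (tiling_floors N t)) \<le> tot (tiling_floors N t')"
        using improve(1)[OF t] by blast
      have "4 * twist (corner U) t + real (good_blocks P2 l (N div l) (tiling_floors N t)) \<le> 4 * twist (corner U) t'"
        unfolding tot[OF t] tot[OF t'(1)] using t'(2) by linarith
      then have "real (good_blocks P2 l (N div l) (tiling_floors N t)) < real m"
        using large bound[OF t'(1)] bm by linarith
      then show "good_blocks P2 l (N div l) (tiling_floors N t) < m" by simp
    qed
    then have Bb: "real (card ?B) \<le> ?X" using few[of P2 N] by simp
    have "card ?C \<le> card {es \<in> ?W {} N {}. good_blocks P3 l (N div l) es < m}"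
    proof (rule card_tilings_le[OF D])
      fix t assume t: "t \<in> tilings D N" and large: "c * real N - b \<le> - twist (corner U) t"
      obtain t' where t': "t' \<in> tilings D N"
        "- tot (tiling_floors N t) + int (good_blocks P3 l (N div l) (tiling_floors N t)) \<le> - tot (tiling_floors N t')"
        using improve(2)[OF t] by blast
      have "- (4 * twist (corner U) t) + real (good_blocks P3 l (N div l) (tiling_floors N t)) \<le> - (4 * twist (corner U) t')"
        unfolding tot[OF t] tot[OF t'(1)] using t'(2) by linarith
      then have "real (good_blocks P3 l (N div l) (tiling_floors N t)) < real m"
        using large bound[OF t'(1)] bm by linarith
      then show "good_blocks P3 l (N div l) (tiling_floors N t) < m" by simp
    qed
    then have Cc: "real (card ?C) \<le> ?X" using few[of P3 N] by simp
    have "card {t \<in> tilings D N. num_vertical_floors N t < M \<or> c * real N - b \<le> \<bar>twist (corner U) t\<bar>}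
      \<le> card (?A \<union> (?B \<union> ?C))"
      by (rule card_mono) (use finite_tilings[OF D] in \<open>auto simp: abs_if split: if_splits\<close>)
    also have "\<dots> \<le> card ?A + (card ?B + card ?C)"
      by (rule order_trans[OF card_Un_le add_left_mono[OF card_Un_le]])
    finally have "real (card {t \<in> tilings D N. num_vertical_floors N t < M \<or> c * real N - b \<le> \<bar>twist (corner U) t\<bar>})
      \<le> real (card ?A) + (real (card ?B) + real (card ?C))"
      unfolding of_nat_add[symmetric] of_nat_le_iff .
    then show ?thesis using A Bb Cc by (simp add: mult.assoc)
  qed
  then show thesis using that[of \<rho> "3 * 2 ^ m" l] \<rho> l by simp
qed

section \<open>Components under flips\<close>

lemma equiv_rtranclp:
  assumes S: "\<And>t t'. t \<in> A \<Longrightarrow> S t t' \<Longrightarrow> t' \<in> A \<and> S t' t"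
  shows "equiv A {(t, t'). t \<in> A \<and> t' \<in> A \<and> S\<^sup>*\<^sup>* t t'}"
proof (rule equivI)
  have sym: "S\<^sup>*\<^sup>* t t' \<Longrightarrow> t \<in> A \<Longrightarrow> t' \<in> A \<and> S\<^sup>*\<^sup>* t' t" for t t'
  proof (induction rule: rtranclp_induct)
    case (step y z)
    then show ?case using S[of y z] by (meson converse_rtranclp_into_rtranclp)
  qed simp
  show "{(t, t'). t \<in> A \<and> t' \<in> A \<and> S\<^sup>*\<^sup>* t t'} \<subseteq> A \<times> A" by blast
  show "refl_on A {(t, t'). t \<in> A \<and> t' \<in> A \<and> S\<^sup>*\<^sup>* t t'}" by (auto simp: refl_on_def)
  show "sym {(t, t'). t \<in> A \<and> t' \<in> A \<and> S\<^sup>*\<^sup>* t t'}" using sym by (auto simp: sym_def)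
  show "trans {(t, t'). t \<in> A \<and> t' \<in> A \<and> S\<^sup>*\<^sup>* t t'}" by (auto simp: trans_def)
qed

lemma flip_equiv:
  "equiv (tilings D N) {(t, t'). t \<in> tilings D N \<and> t' \<in> tilings D N \<and> flip_connected t t'}"
proof (rule equiv_rtranclp)
  show "t' \<in> tilings D N \<and> flip t' t" if "t \<in> tilings D N" "flip t t'" for t t'
    using that flip_closed flip_sym unfolding tilings_def by blast
qed

lemma twist_flip_connected:
  assumes D: "finite D" and U: "U \<in> horizontals" and t: "t \<in> tilings D N" and c: "flip_connected t t'"
  shows "twist (corner U) t' = twist (corner U) t"
proof -
  from c have "t' \<in> tilings D N \<and> twist (corner U) t' = twist (corner U) t"
  proof (induction rule: rtranclp_induct)
    case base
    then show ?case using t by simp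
  next
    case (step y z)
    then have "z \<in> tilings D N" using flip_closed unfolding tilings_def by blast
    then show ?case using step twist_flip[OF D U _ step(2), of N] by simp
  qed
  then show ?thesis ..
qed

text \<open>
  The choice of a tiling in the definition of \<open>component_twist\<close> is immaterial, by \<open>twist_flip\<close>.
\<close>

lemma component_twist_eq:
  assumes D: "finite D" and U: "U \<in> horizontals" and C: "C \<in> flip_components D N" and t: "t \<in> C"
  shows "component_twist (corner U) C = twist (corner U) t" "t \<in> tilings D N"
proof -
  let ?r = "{(t, t'). t \<in> tilings D N \<and> t' \<in> tilings D N \<and> flip_connected t t'}"
  have C': "C \<in> tilings D N // ?r" using C by (simp add: flip_components_def)
  have "(SOME t. t \<in> C) \<in> C" using t by (rule someI)
  then have "(t, SOME t. t \<in> C) \<in> ?r" by (rule quotient_eq_iff[OF flip_equiv C' C' t, THEN iffD1, OF _ refl])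
  then have t': "t \<in> tilings D N" and c: "flip_connected t (SOME t. t \<in> C)" by blast+
  show "component_twist (corner U) C = twist (corner U) t"
    unfolding component_twist_def by (rule twist_flip_connected[OF D U t' c])
  show "t \<in> tilings D N" by (rule t')
qed

lemma flip_component_connected:
  assumes C: "C \<in> flip_components D N" and t: "t \<in> C" "t' \<in> C"
  shows "flip_connected t t'"
proof -
  let ?r = "{(t, t'). t \<in> tilings D N \<and> t' \<in> tilings D N \<and> flip_connected t t'}"
  have C': "C \<in> tilings D N // ?r" using C by (simp add: flip_components_def)
  have "(t, t') \<in> ?r" by (rule quotient_eq_iff[OF flip_equiv C' C' t, THEN iffD1, OF refl])
  then show ?thesis by blast
qed

text \<open>
  The third statement is how fat components are recognized: a tiling with enough vertical floors lies in
  the fat component that its twist prescribes.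
\<close>

lemma fat_component_props:
  assumes D: "finite D" and U: "U \<in> horizontals"
    and ex1: "\<exists>!C. C \<in> fat_components D M N \<and> component_twist (corner U) C = of_int t"
  shows "fat_component (corner U) D M N t \<in> flip_components D N"
    "fat_component (corner U) D M N t \<noteq> {}"
    "\<And>s. s \<in> tilings D N \<Longrightarrow> num_vertical_floors N s \<ge> M \<Longrightarrow> twist (corner U) s = of_int t \<Longrightarrow>
       s \<in> fat_component (corner U) D M N t"
proof -
  let ?F = "fat_component (corner U) D M N t"
  let ?r = "{(t, t'). t \<in> tilings D N \<and> t' \<in> tilings D N \<and> flip_connected t t'}"
  have F: "?F \<in> fat_components D M N \<and> component_twist (corner U) ?F = of_int t"
    unfolding fat_component_def by (rule theI'[OF ex1])
  then show "?F \<in> flip_components D N" "?F \<noteq> {}" by (auto simp: fat_components_def)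
  fix s assume s: "s \<in> tilings D N" "num_vertical_floors N s \<ge> M" "twist (corner U) s = of_int t"
  let ?C = "?r `` {s}"
  have C: "?C \<in> flip_components D N" unfolding flip_components_def by (rule quotientI[OF s(1)])
  have sC: "s \<in> ?C" using s(1) by simp
  then have "?C \<in> fat_components D M N" using C s(2) by (auto simp: fat_components_def)
  moreover have "component_twist (corner U) ?C = of_int t"
    using component_twist_eq(1)[OF D U C sC] s(3) by simp
  ultimately have "?C = ?F" using ex1 F by blast
  then show "s \<in> ?F" using sC by simp
qed

section \<open>The giant component\<close>

text \<open>
  The bound decays like \<open>r ^ N\<close> for the \<open>l\<close>-th root \<open>r\<close> of \<open>\<rho>\<close>.  With the square
  root of \<open>r\<close> as the rate \<open>q\<close>, one factor \<open>q ^ N\<close> remains, and it tends to 0.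
\<close>

lemma geometric_blocks_smallo:
  fixes f :: "nat \<Rightarrow> real" and T :: "nat \<Rightarrow> nat" and \<rho> C :: real
  assumes \<rho>: "0 < \<rho>" "\<rho> < 1" and l: "0 < l" and C: "0 \<le> C"
    and f: "\<forall>\<^sub>F N in sequentially. \<bar>f N\<bar> \<le> C * \<rho> ^ (N div l) * real (T N)"
  obtains q where "0 < q" "q < 1" "f \<in> o(\<lambda>N. real (T N) * q ^ N)"
proof -
  define r where "r = root l \<rho>"
  have r: "0 < r" "r < 1" "r ^ l = \<rho>" using \<rho> l by (simp_all add: r_def)
  define q where "q = sqrt r"
  have q: "0 < q" "q < 1" "q * q = r" using r by (simp_all add: q_def)
  have blocks: "\<rho> ^ (N div l) \<le> r ^ N / \<rho>" for N
  proof -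
    have "N \<le> l * (N div l) + l" using l
      by (metis add_left_mono mult_div_mod_eq mod_less_divisor less_imp_le)
    then have "r ^ (l * (N div l) + l) \<le> r ^ N" using r by (intro power_decreasing) auto
    then have "\<rho> ^ (N div l) * \<rho> \<le> r ^ N" by (simp add: power_add power_mult r(3))
    then show ?thesis using \<rho> by (simp add: field_simps)
  qed
  have "f \<in> o(\<lambda>N. real (T N) * q ^ N)"
  proof (rule landau_o.smallI)
    fix e :: real assume e: "e > 0"
    have "(\<lambda>N. C / \<rho> * q ^ N) \<longlonglongrightarrow> C / \<rho> * 0"
      using q by (intro tendsto_mult tendsto_const LIMSEQ_realpow_zero) auto
    then have "\<forall>\<^sub>F N in sequentially. C / \<rho> * q ^ N < e" using e by (auto dest: order_tendstoD(2))
    with f show "\<forall>\<^sub>F N in sequentially. norm (f N) \<le> e * norm (real (T N) * q ^ N)"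
    proof eventually_elim
      case (elim N)
      have "\<bar>f N\<bar> \<le> C * \<rho> ^ (N div l) * real (T N)" by (rule elim(1))
      also have "\<dots> \<le> C * (r ^ N / \<rho>) * real (T N)"
        using blocks[of N] C by (intro mult_right_mono mult_left_mono) auto
      also have "\<dots> = (C / \<rho> * q ^ N) * (real (T N) * q ^ N)"
        unfolding q(3)[symmetric] by (simp add: power_mult_distrib)
      also have "\<dots> \<le> e * (real (T N) * q ^ N)"
        using elim(2) q by (intro mult_right_mono) auto
      finally show ?case using q by simp
    qed
  qed
  with q show thesis using that by blast
qed

lemma twist_t_vert:
  assumes D: "finite D" and U: "U \<in> horizontals" and M: "even M"
  shows "twist (corner U) (t_vert D M) = 0"
proof -
  have t: "t_vert D M \<in> tilings_of (cylinder D M)" using t_vert_tilings[OF M] by (simp add: tilings_def)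
  have d: "dir (t_vert D M) = vert_field D M"
    unfolding t_vert_eq[OF M] by (rule dir_dominoes[OF vert_field[OF M]])
  have "det3 (vert_field D M q) (vert_field D M p) U = 0" for p q
    by (cases U) (simp add: vert_field_def zero_prod_def)
  then have "pair_term U (dir (t_vert D M)) p q = 0" for p q by (simp add: pair_term_def d)
  then show ?thesis using twist_eq[OF U t finite_cylinder[OF D]] by simp
qed

theorem theorem6:
  fixes D :: "square set" and u :: "real^3" and M :: nat and c b :: real
  assumes u: "u \<in> horizontal_directions"
    and disk: "quadriculated_disk D"
    and bal: "balanced D"
    and reg: "regular u D"
    and rect: "contains_2x3_rectangle D"
    and M_even: "even M"
    and M: "\<forall>N. \<forall>t0\<in>tilings D N. \<forall>t1\<in>tilings D N.
              twist u t0 = twist u t1 \<longrightarrow>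
                flip_connected (stack N t0 (t_vert D M)) (stack N t1 (t_vert D M))"
    and c_rat: "c \<in> \<rat>"
    and i: "\<forall>N. \<forall>t\<in>tilings D N. \<bar>twist u t\<bar> \<le> c * real N"
    and ii: "\<forall>N\<ge>1. \<forall>t::int. of_int t \<in> {- c * real N + b .. c * real N - b} \<longrightarrow>
               (\<exists>!C. C \<in> fat_components D M N \<and> component_twist u C = of_int t)"
    and iii: "\<forall>N. \<forall>t::int. \<forall>C\<in>fat_components D M N. \<forall>C'\<in>fat_components D M N.
                component_twist u C = of_int t \<and> component_twist u C' = of_int t \<longrightarrow> C = C'"
  shows "(\<exists>b'\<ge>b. \<forall>N. \<forall>t::int. of_int t \<in> {- c * real N + b' .. c * real N - b' - 1} \<longrightarrow>
            (\<exists>t0 \<in> fat_component u D M N t. \<exists>t1 \<in> fat_component u D M N (t + 1). trit t0 t1))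
       \<and> (\<exists>G c'. 0 < c' \<and> c' < (1::real)
            \<and> (\<forall>N. tilings D N \<noteq> {} \<longrightarrow> G N \<in> flip_trit_components D N)
            \<and> (\<lambda>N. real (card (tilings D N - G N)))
                \<in> o(\<lambda>N. real (card (tilings D N)) * c' ^ N))"
proof -
  obtain U where U: "U \<in> horizontals" "u = corner U"
    using u unfolding horizontal_directions_eq by blast
  have D: "finite D" using disk by (simp add: quadriculated_disk_def)
  have evD: "even (card D)" by (rule balanced_even_card[OF D bal])
  let ?F = "fat_component u D M"
  have bound: "\<bar>twist u t\<bar> \<le> c * real N" if "t \<in> tilings D N" for N t using i that by blast
  obtain s0 s1 where s: "s0 \<in> tilings D 4" "s1 \<in> tilings D 4" "trit s0 s1" "twist u s1 = twist u s0 + 1"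
    using trit_changing_twist[OF D rect U(1)] U(2) by blast
  have cpos: "c > 0" using bound[OF s(1)] bound[OF s(2)] s(4) by simp
  obtain w0 :: int where w0: "twist u s0 = of_int w0"
    using twist_Ints[OF D evD U(1) s(1)] unfolding U(2) by (elim Ints_cases)
  (* Room for the trit of height 4, for the M vertical floors and for one more floor below them,
     and for the twist of the tiling with the trit. *)
  define b' where "b' = \<bar>b\<bar> + c * real (5 + M) + \<bar>twist u s0\<bar>"
  have c0: "c * real (5 + M) > 0" using cpos by simp
  have b': "b' \<ge> b" "b' > 0" using c0 unfolding b'_def by linarith+
  have tv: "t_vert D M \<in> tilings D M" by (rule t_vert_tilings[OF M_even])

  have props: "?F N t \<in> flip_components D N" "?F N t \<noteq> {}"
     "\<And>s. s \<in> tilings D N \<Longrightarrow> num_vertical_floors N s \<ge> M \<Longrightarrow> twist u s = of_int t \<Longrightarrow> s \<in> ?F N t"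
    if N: "N \<ge> 1" and t: "of_int t \<in> {- c * real N + b' .. c * real N - b'}" for N and t :: int
  proof -
    have "of_int t \<in> {- c * real N + b .. c * real N - b}" using t b'(1) by auto
    then have "\<exists>!C. C \<in> fat_components D M N \<and> component_twist u C = of_int t" using ii N by blast
    from fat_component_props[OF D U(1) this[unfolded U(2)]]
    show "?F N t \<in> flip_components D N" "?F N t \<noteq> {}"
     "\<And>s. s \<in> tilings D N \<Longrightarrow> num_vertical_floors N s \<ge> M \<Longrightarrow> twist u s = of_int t \<Longrightarrow> s \<in> ?F N t"
      unfolding U(2) by blast+
  qed

  have partA: "\<exists>t0\<in>?F N t. \<exists>t1\<in>?F N (t + 1). trit t0 t1"
    if t: "of_int t \<in> {- c * real N + b' .. c * real N - b' - 1}" for N and t :: int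
  proof -
    have "c * real N > c * real (5 + M)" using t b'_def by auto
    then have "real N > real (5 + M)" using cpos by (simp only: mult_less_cancel_left_pos)
    then have N: "N > 5 + M" by (simp only: of_nat_less_iff)
    define N' where "N' = N - 4 - M"
    have N': "N = 4 + (N' + M)" "N' \<ge> 1" "N' + M \<ge> 1" using N by (simp_all add: N'_def)
    have cN: "c * real N = c * real (4 + M) + c * real N'" by (simp add: N'(1) algebra_simps)
    have c5: "c * real (5 + M) = c * real (4 + M) + c" by (simp add: algebra_simps)
    have "of_int (t - w0) \<in> {- c * real N' + b .. c * real N' - b}"
      using t cN c5 w0 cpos unfolding b'_def by auto
    then obtain C where C: "C \<in> fat_components D M N'" "component_twist u C = of_int (t - w0)"
      using ii N'(2) by blast
    then obtain r where r: "r \<in> C" "C \<in> flip_components D N'" unfolding fat_components_def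
      using in_quotient_imp_non_empty[OF flip_equiv] by (auto simp: flip_components_def)
    have rt: "r \<in> tilings D N'" "twist u r = of_int (t - w0)"
      using component_twist_eq[OF D U(1) r(2,1)] C(2) unfolding U(2) by simp_all
    define v where "v = stack N' r (t_vert D M)"
    have v: "v \<in> tilings D (N' + M)" unfolding v_def by (rule stack_tilings(1)[OF rt(1) tv])
    have tw_v: "twist u v = of_int (t - w0)"
      using twist_stack[OF D U(1) rt(1) tv] rt(2) twist_t_vert[OF D U(1) M_even]
      unfolding v_def U(2) by simp
    have fat_v: "num_vertical_floors (N' + M) v \<ge> M"
      unfolding v_def by (simp add: num_vertical_floors_stack[OF rt(1) tv] num_vertical_floors_t_vert[OF M_even])
    have t0: "stack 4 s0 v \<in> ?F N t"
    proof (rule props(3))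
      show "1 \<le> N" using N by simp
      show "of_int t \<in> {- c * real N + b' .. c * real N - b'}" using t by auto
      show "stack 4 s0 v \<in> tilings D N" unfolding N'(1) by (rule stack_tilings(1)[OF s(1) v])
      show "M \<le> num_vertical_floors N (stack 4 s0 v)"
        unfolding N'(1) num_vertical_floors_stack[OF s(1) v] using fat_v by simp
      show "twist u (stack 4 s0 v) = of_int t"
        using twist_stack[OF D U(1) s(1) v] tw_v w0 unfolding U(2) by simp
    qed
    have t1: "stack 4 s1 v \<in> ?F N (t + 1)"
    proof (rule props(3))
      show "1 \<le> N" using N by simp
      show "of_int (t + 1) \<in> {- c * real N + b' .. c * real N - b'}" using t by auto
      show "stack 4 s1 v \<in> tilings D N" unfolding N'(1) by (rule stack_tilings(1)[OF s(2) v])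
      show "M \<le> num_vertical_floors N (stack 4 s1 v)"
        unfolding N'(1) num_vertical_floors_stack[OF s(2) v] using fat_v by simp
      show "twist u (stack 4 s1 v) = of_int (t + 1)"
        using twist_stack[OF D U(1) s(2) v] tw_v w0 s(4) unfolding U(2) by simp
    qed
    show ?thesis using t0 t1 trit_stack[OF s(1) v s(3)] by blast
  qed

  let ?R = "\<lambda>N. {(t, t'). t \<in> tilings D N \<and> t' \<in> tilings D N \<and> flip_trit_connected t t'}"
  (* The choice for small N only has to be a tiling; there part (a) gives no information. *)
  define base where "base N = (SOME t. t \<in> (if b' \<le> c * real N then ?F N 0 else tilings D N))" for N
  define G where "G N = ?R N `` {base N}" for N
  have N1: "N \<ge> 1" if "b' \<le> c * real N" for N using that b'(2) by (cases N) auto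
  have range0: "of_int 0 \<in> {- c * real N + b' .. c * real N - b'}" if "b' \<le> c * real N" for N
    using that by simp
  have base_F: "base N \<in> ?F N 0" "base N \<in> tilings D N" if "b' \<le> c * real N" for N
  proof -
    note P = props(1,2)[OF N1[OF that] range0[OF that]]
    show "base N \<in> ?F N 0" unfolding base_def using that P(2) by (simp add: some_in_eq)
    then show "base N \<in> tilings D N" using component_twist_eq(2)[OF D U(1) P(1)] by blast
  qed
  have comp: "G N \<in> flip_trit_components D N" if "tilings D N \<noteq> {}" for N
  proof -
    have "base N \<in> tilings D N"
    proof (cases "b' \<le> c * real N")
      case True
      then show ?thesis by (rule base_F(2))
    next
      case False
      then show ?thesis using that by (simp add: base_def some_in_eq)
    qed
    then show ?thesis unfolding G_def flip_trit_components_def by (rule quotientI)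
  qed

  (* Starting from twist 0, part (a) leads step by step to all twists in the interval. *)
  have connected: "flip_trit_connected (base N) t"
    if N: "b' \<le> c * real N" and k: "of_int k \<in> {- c * real N + b' .. c * real N - b'}" and t: "t \<in> ?F N k" for N k t
  proof -
    have flips: "flip_trit_connected t t'"
      if "of_int k \<in> {- c * real N + b' .. c * real N - b'}" "t \<in> ?F N k" "t' \<in> ?F N k" for k t t'
    proof -
      have "flip_connected t t'"
        by (rule flip_component_connected[OF props(1)[OF N1[OF N] that(1)] that(2,3)])
      then show ?thesis by (rule rtranclp_mono[THEN predicate2D, rotated]) blast
    qed
    have F_til: "t \<in> tilings D N"
      if "of_int k \<in> {- c * real N + b' .. c * real N - b'}" "t \<in> ?F N k" for k t
      using component_twist_eq(2)[OF D U(1) props(1)[OF N1[OF N] that(1)] that(2)] .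
    have "of_int k \<in> {- c * real N + b' .. c * real N - b'} \<longrightarrow> (\<forall>t\<in>?F N k. flip_trit_connected (base N) t)"
    proof (induction k rule: int_induct[where k = 0])
      case base
      show ?case using flips[OF _ base_F(1)[OF N]] by blast
    next
      case (step1 k)
      show ?case
      proof (intro impI ballI)
        fix t assume k1: "of_int (k + 1) \<in> {- c * real N + b' .. c * real N - b'}" and t: "t \<in> ?F N (k + 1)"
        have kr: "of_int k \<in> {- c * real N + b' .. c * real N - b' - 1}" using step1(1) k1 N by auto
        then have kr': "of_int k \<in> {- c * real N + b' .. c * real N - b'}" by auto
        obtain t0 t1 where t01: "t0 \<in> ?F N k" "t1 \<in> ?F N (k + 1)" "trit t0 t1" using partA[OF kr] by blast
        have "flip_trit_connected (base N) t0" using step1(2) kr' t01(1) by blast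
        then have "flip_trit_connected (base N) t1" using t01(3) by (simp add: rtranclp.rtrancl_into_rtrancl)
        also have "flip_trit_connected t1 t" by (rule flips[OF k1 t01(2) t])
        finally show "flip_trit_connected (base N) t" .
      qed
    next
      case (step2 k)
      show ?case
      proof (intro impI ballI)
        fix t assume k1: "of_int (k - 1) \<in> {- c * real N + b' .. c * real N - b'}" and t: "t \<in> ?F N (k - 1)"
        have kr: "of_int (k - 1) \<in> {- c * real N + b' .. c * real N - b' - 1}" using step2(1) k1 N by auto
        then have kr': "of_int k \<in> {- c * real N + b' .. c * real N - b'}" by auto
        obtain t0 t1 where t01: "t0 \<in> ?F N (k - 1)" "t1 \<in> ?F N k" "trit t0 t1" using partA[OF kr] by auto
        have "t0 \<in> tilings_of (cylinder D N)" using F_til[OF k1 t01(1)] by (simp add: tilings_def)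
        then have "trit t1 t0" using t01(3) by (rule trit_sym)
        moreover have "flip_trit_connected (base N) t1" using step2(2) kr' t01(2) by blast
        ultimately have "flip_trit_connected (base N) t0" by (simp add: rtranclp.rtrancl_into_rtrancl)
        also have "flip_trit_connected t0 t" by (rule flips[OF k1 t01(1) t])
        finally show "flip_trit_connected (base N) t" .
      qed
    qed
    then show ?thesis using k t by blast
  qed

  obtain \<rho> C :: real and l where rare: "0 < \<rho>" "\<rho> < 1" "0 \<le> C" "0 < l"
    "\<And>N. real (card {t \<in> tilings D N. num_vertical_floors N t < M \<or> c * real N - b' \<le> \<bar>twist u t\<bar>})
       \<le> C * \<rho> ^ (N div l) * real (card (tilings D N))"
    using rare_tilings[OF D rect U(1) bound[unfolded U(2)], of M b'] unfolding U(2) by blast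
  have small: "\<bar>real (card (tilings D N - G N))\<bar> \<le> C * \<rho> ^ (N div l) * real (card (tilings D N))"
    if N: "b' \<le> c * real N" for N
  proof -
    have "tilings D N - G N \<subseteq> {t \<in> tilings D N. num_vertical_floors N t < M \<or> c * real N - b' \<le> \<bar>twist u t\<bar>}"
    proof
      fix t assume t: "t \<in> tilings D N - G N"
      show "t \<in> {t \<in> tilings D N. num_vertical_floors N t < M \<or> c * real N - b' \<le> \<bar>twist u t\<bar>}"
      proof (rule ccontr)
        assume "\<not> ?thesis"
        then have fat: "M \<le> num_vertical_floors N t" "\<bar>twist u t\<bar> < c * real N - b'" using t by auto
        obtain k :: int where k: "twist u t = of_int k"
          using twist_Ints[OF D evD U(1)] t unfolding U(2) by (meson DiffD1 Ints_cases)
        have kr: "of_int k \<in> {- c * real N + b' .. c * real N - b'}" using fat(2) k by auto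
        have "t \<in> ?F N k" using props(3)[OF N1[OF N] kr] t fat(1) k by blast
        from connected[OF N kr this] have "t \<in> G N" using t base_F(2)[OF N] by (simp add: G_def)
        then show False using t by simp
      qed
    qed
    then have "card (tilings D N - G N)
      \<le> card {t \<in> tilings D N. num_vertical_floors N t < M \<or> c * real N - b' \<le> \<bar>twist u t\<bar>}"
      using finite_tilings[OF D] by (intro card_mono) auto
    then show ?thesis using rare(5)[of N] by simp
  qed
  have "\<forall>\<^sub>F N in sequentially. b' \<le> c * real N"
  proof -
    obtain n :: nat where "b' / c \<le> real n" using real_arch_simple by blast
    then have "b' \<le> c * real N" if "n \<le> N" for N
      using that cpos by (simp add: pos_divide_le_eq mult.commute) (smt (verit) mult_left_mono of_nat_mono)
    then show ?thesis unfolding eventually_sequentially by blast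
  qed
  then have "\<forall>\<^sub>F N in sequentially. \<bar>real (card (tilings D N - G N))\<bar> \<le> C * \<rho> ^ (N div l) * real (card (tilings D N))"
    by (rule eventually_mono) (rule small)
  from geometric_blocks_smallo[OF rare(1,2,4,3) this]
  obtain q where "0 < q" "q < 1" "(\<lambda>N. real (card (tilings D N - G N))) \<in> o(\<lambda>N. real (card (tilings D N)) * q ^ N)"
    by blast
  then show ?thesis using b'(1) partA comp by blast
qed

end
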